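(* When $\kappa_0-\sum_{i=1}^N\theta_i=0$, the Hamiltonian system ${\cal H}_{L,N}$ possesses an $N(L-1)$-parameter family of particular solutions, each of which is expressed in terms of a hypergeometric function, i.e., an arbitrary solution of the system of linear differential equations (HG).
   Context: Fix integers $L\ge 2$ and $N\ge 1$. **The Hamiltonian system ${\cal H}_{L,N}$.** This is the completely integrable Hamiltonian system of partial differential equations, with variables $x=(x_1,\dots,x_N)$ and unknowns $q_n^{(i)},p_n^{(i)}$ ($1\le i\le N$, $1\le n\le L-1$), $$\frac{\partial q_n^{(i)}}{\partial x_j}=\frac{\partial H_j}{\partial p_n^{(i)}},\qquad \frac{\partial p_n^{(i)}}{\partial x_j}=-\frac{\partial H_j}{\partial q_n^{(i)}}\qquad (i,j=1,\dots,N;\ n=1,\dots,L-1),$$ where the Hamiltonian function $H_i$ ($1\le i\le N$) is given by $$x_iH_i=\sum_{n=0}^{L-1}e_nq_n^{(i)}p_n^{(i)}+\sum_{j=0}^N\ \sum_{0\le m<n\le L-1}q_m^{(i)}p_m^{(j)}q_n^{(j)}p_n^{(i)}+\sum_{\substack{j=0\\ j\ne i}}^N\frac{x_j}{x_i-x_j}\sum_{m,n=0}^{L-1}q_m^{(i)}p_m^{(j)}q_n^{(j)}p_n^{(i)},$$ with $x_0=q_n^{(0)}=q_0^{(i)}=1$ and $$p_n^{(0)}=\kappa_n-\sum_{i=1}^Nq_n^{(i)}p_n^{(i)}\ (0\le n\le L-1),\qquad p_0^{(i)}=\theta_i-\sum_{n=1}^{L-1}q_n^{(i)}p_n^{(i)}\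 (1\le i\le N).$$ Thus $H_i$ is a polynomial in the canonical variables. The complex constants $(e,\kappa,\theta)=(e_0,\dots,e_{L-1},\kappa_0,\dots,\kappa_{L-1},\theta_0,\dots,\theta_N)$ satisfy $$\sum_{n=0}^{L-1}e_n=\frac{L-1}{2},\qquad \sum_{n=0}^{L-1}\kappa_n=\sum_{i=0}^N\theta_i.$$ **The hypergeometric system (HG).** For complex constants $(\alpha,\beta,\gamma)=(\alpha_1,\dots,\alpha_{L-1},\beta_1,\dots,\beta_N,\gamma_1,\dots,\gamma_{L-1})$, and with $\delta_i=x_i\,\partial/\partial x_i$ and ${\cal D}=\sum_{i=1}^N\delta_i$, it is the system of linear differential equations $$\Bigl\{x_i(\beta_i+\delta_i)\prod_{k=1}^{L-1}(\alpha_k+{\cal D})-\delta_i\prod_{k=1}^{L-1}(\gamma_k-1+{\cal D})\Bigr\}y=0,\qquad i=1,\dots,N.$$ In the claim, the constants in (HG) are those determined by the parameters of ${\cal H}_{L,N}$ through $\alpha_n=e_n-e_0$, $\gamma_n=e_n-e_0-\kappa_n$ ($1\le n\le L-1$) and $\beta_i=-\theta_i$ ($1\le i\le N$).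
   Formalization: That an arbitrary solution of (HG) gives a solution is stated only for α_m ≠ γ_k (k<m) and, if N ≥ 2, α_m ≠ γ_k − 1 for all k, m; it fails otherwise. The N(L−1)-parameter family, each member built from some solution of (HG), is stated for all parameters. *)

theory Defs
  imports "HOL-Analysis.Analysis" "HOL-Computational_Algebra.Polynomial"
begin

text \<open>
  Conventions. The number of variables is \<open>N = CARD('n)\<close>; the index type \<open>'n\<close> plays the role of
  \<open>{1,\<dots>,N}\<close> and \<open>'n option\<close> that of \<open>{0,1,\<dots>,N}\<close>, with \<open>None\<close> for the index \<open>0\<close>. The lower
  indices \<open>0,\<dots>,L-1\<close> are natural numbers. A point of phase space is a pair \<open>q, p\<close> of functions
  \<open>'n \<Rightarrow> nat \<Rightarrow> complex\<close>, of which only the entries with lower index in \<open>{1..L-1}\<close> are used.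
\<close>

section \<open>Functions of several complex variables\<close>

text \<open>Holomorphy is complex Frechet differentiability: the real derivative is complex linear.\<close>

definition holomorphic_sev :: "(complex^'n) set \<Rightarrow> (complex^'n \<Rightarrow> complex) \<Rightarrow> bool" where
  "holomorphic_sev \<Omega> f \<longleftrightarrow>
     (\<forall>x\<in>\<Omega>. \<exists>a :: complex^'n. (f has_derivative (\<lambda>h. \<Sum>i\<in>UNIV. a $ i * h $ i)) (at x))"

definition pdiff :: "'n \<Rightarrow> (complex^'n \<Rightarrow> complex) \<Rightarrow> complex^'n \<Rightarrow> complex" where
  "pdiff j f x = deriv (\<lambda>z. f (\<chi> k. if k = j then z else x $ k)) (x $ j)"

text \<open>The Euler operators \<open>\<delta>\<^sub>i\<close> and \<open>\<D>\<close>.\<close>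

definition euler :: "'n \<Rightarrow> (complex^'n \<Rightarrow> complex) \<Rightarrow> complex^'n \<Rightarrow> complex" where
  "euler i f x = x $ i * pdiff i f x"

definition teuler :: "(complex^'n \<Rightarrow> complex) \<Rightarrow> complex^'n \<Rightarrow> complex" where
  "teuler f x = (\<Sum>i\<in>UNIV. euler i f x)"

text \<open>\<open>teuler_prod a K f\<close> is \<open>(a\<^sub>1 + \<D>) \<cdots> (a\<^sub>K + \<D>) f\<close>; the factors commute on holomorphic \<open>f\<close>.\<close>

primrec teuler_prod ::
    "(nat \<Rightarrow> complex) \<Rightarrow> nat \<Rightarrow> (complex^'n \<Rightarrow> complex) \<Rightarrow> complex^'n \<Rightarrow> complex" where
  "teuler_prod a 0 f = f"
| "teuler_prod a (Suc k) f =
     (\<lambda>x. a (Suc k) * teuler_prod a k f x + teuler (teuler_prod a k f) x)"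

definition teuler_poly ::
    "complex poly \<Rightarrow> (complex^'n \<Rightarrow> complex) \<Rightarrow> complex^'n \<Rightarrow> complex" where
  "teuler_poly P f x = (\<Sum>k\<le>degree P. coeff P k * (teuler ^^ k) f x)"

text \<open>The complement of the singular locus common to the Hamiltonian and hypergeometric systems.\<close>

definition regular_points :: "(complex^'n) set" where
  "regular_points =
     {x. (\<forall>i. x $ i \<noteq> 0 \<and> x $ i \<noteq> 1) \<and> (\<forall>i j. i \<noteq> j \<longrightarrow> x $ i \<noteq> x $ j)}"

section \<open>The Hamiltonian system\<close>

definition x_ext :: "complex^'n \<Rightarrow> 'n option \<Rightarrow> complex" where
  "x_ext x j = (case j of None \<Rightarrow> 1 | Some i \<Rightarrow> x $ i)"

definition q_ext :: "('n \<Rightarrow> nat \<Rightarrow> complex) \<Rightarrow> 'n option \<Rightarrow> nat \<Rightarrow> complex" where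
  "q_ext q j n = (case j of None \<Rightarrow> 1 | Some i \<Rightarrow> if n = 0 then 1 else q i n)"

definition p_pos :: "nat \<Rightarrow> ('n option \<Rightarrow> complex) \<Rightarrow>
    ('n \<Rightarrow> nat \<Rightarrow> complex) \<Rightarrow> ('n \<Rightarrow> nat \<Rightarrow> complex) \<Rightarrow> 'n \<Rightarrow> nat \<Rightarrow> complex" where
  "p_pos L \<theta> q p i n =
     (if n = 0 then \<theta> (Some i) - (\<Sum>m=1..L-1. q i m * p i m) else p i n)"

definition p_ext :: "nat \<Rightarrow> (nat \<Rightarrow> complex) \<Rightarrow> ('n::finite option \<Rightarrow> complex) \<Rightarrow>
    ('n \<Rightarrow> nat \<Rightarrow> complex) \<Rightarrow> ('n \<Rightarrow> nat \<Rightarrow> complex) \<Rightarrow> 'n option \<Rightarrow> nat \<Rightarrow> complex" where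
  "p_ext L \<kappa> \<theta> q p j n =
     (case j of
        None \<Rightarrow> \<kappa> n - (\<Sum>i\<in>UNIV. q_ext q (Some i) n * p_pos L \<theta> q p i n)
      | Some i \<Rightarrow> p_pos L \<theta> q p i n)"

definition hamiltonian ::
    "nat \<Rightarrow> (nat \<Rightarrow> complex) \<Rightarrow> (nat \<Rightarrow> complex) \<Rightarrow> ('n::finite option \<Rightarrow> complex) \<Rightarrow> 'n \<Rightarrow>
     complex^'n \<Rightarrow> ('n \<Rightarrow> nat \<Rightarrow> complex) \<Rightarrow> ('n \<Rightarrow> nat \<Rightarrow> complex) \<Rightarrow> complex" where
  "hamiltonian L e \<kappa> \<theta> i x q p =
     (let X = x_ext x; Q = q_ext q; P = p_ext L \<kappa> \<theta> q p; I = Some i in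
       ((\<Sum>n<L. e n * Q I n * P I n)
        + (\<Sum>j\<in>UNIV. \<Sum>n<L. \<Sum>m<n. Q I m * P j m * Q j n * P I n)
        + (\<Sum>j\<in>UNIV - {I}. X j / (X I - X j) *
             (\<Sum>m<L. \<Sum>n<L. Q I m * P j m * Q j n * P I n))) / x $ i)"

definition hamiltonian_solution ::
    "nat \<Rightarrow> (nat \<Rightarrow> complex) \<Rightarrow> (nat \<Rightarrow> complex) \<Rightarrow> ('n::finite option \<Rightarrow> complex) \<Rightarrow>
     (complex^'n) set \<Rightarrow> ('n \<Rightarrow> nat \<Rightarrow> complex^'n \<Rightarrow> complex) \<Rightarrow>
     ('n \<Rightarrow> nat \<Rightarrow> complex^'n \<Rightarrow> complex) \<Rightarrow> bool" where
  "hamiltonian_solution L e \<kappa> \<theta> \<Omega> q p \<longleftrightarrow>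
     (\<forall>i. \<forall>n\<in>{1..L-1}. holomorphic_sev \<Omega> (q i n) \<and> holomorphic_sev \<Omega> (p i n)) \<and>
     (\<forall>x\<in>\<Omega>. \<forall>i j. \<forall>n\<in>{1..L-1}.
        (let qx = (\<lambda>k m. q k m x); px = (\<lambda>k m. p k m x) in
          pdiff j (q i n) x =
            deriv (\<lambda>z. hamiltonian L e \<kappa> \<theta> j x qx (px(i := (px i)(n := z)))) (px i n) \<and>
          pdiff j (p i n) x =
            - deriv (\<lambda>z. hamiltonian L e \<kappa> \<theta> j x (qx(i := (qx i)(n := z))) px) (qx i n)))"

section \<open>The hypergeometric system\<close>

definition hg_solution ::
    "nat \<Rightarrow> (nat \<Rightarrow> complex) \<Rightarrow> ('n \<Rightarrow> complex) \<Rightarrow> (nat \<Rightarrow> complex) \<Rightarrow>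
     (complex^'n) set \<Rightarrow> (complex^'n \<Rightarrow> complex) \<Rightarrow> bool" where
  "hg_solution L \<alpha> \<beta> \<gamma> \<Omega> y \<longleftrightarrow>
     holomorphic_sev \<Omega> y \<and>
     (\<forall>x\<in>\<Omega>. \<forall>i.
        x $ i * (\<beta> i * teuler_prod \<alpha> (L-1) y x + euler i (teuler_prod \<alpha> (L-1) y) x)
        - euler i (teuler_prod (\<lambda>k. \<gamma> k - 1) (L-1) y) x = 0)"

section \<open>Expressing the canonical variables by a hypergeometric function\<close>

text \<open>
  As \<open>(\<gamma>\<^sub>k - 1 + \<D>) x\<^sub>i = x\<^sub>i (\<gamma>\<^sub>k + \<D>)\<close>, the hypergeometric system reads
  \<open>\<Prod>\<^sub>k (\<alpha>\<^sub>k + \<D>) (\<beta>\<^sub>i + \<delta>\<^sub>i) y = \<Prod>\<^sub>k (\<gamma>\<^sub>k + \<D>) (\<partial>y/\<partial>x\<^sub>i)\<close>. A chain attached to \<open>y\<close>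
  interpolates between \<open>(\<beta>\<^sub>i + \<delta>\<^sub>i) y\<close> and \<open>\<partial>y/\<partial>x\<^sub>i\<close> by exchanging one pair of factors at a time.
\<close>

definition hg_chain ::
    "nat \<Rightarrow> (nat \<Rightarrow> complex) \<Rightarrow> ('n \<Rightarrow> complex) \<Rightarrow> (nat \<Rightarrow> complex) \<Rightarrow>
     (complex^'n) set \<Rightarrow> (complex^'n \<Rightarrow> complex) \<Rightarrow>
     ('n \<Rightarrow> nat \<Rightarrow> complex^'n \<Rightarrow> complex) \<Rightarrow> bool" where
  "hg_chain L \<alpha> \<beta> \<gamma> \<Omega> y T \<longleftrightarrow>
     (\<forall>i. \<forall>n<L. holomorphic_sev \<Omega> (T i n)) \<and>
     (\<forall>x\<in>\<Omega>. \<forall>i.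
        T i 0 x = \<beta> i * y x + euler i y x \<and>
        T i (L-1) x = pdiff i y x \<and>
        (\<forall>n\<in>{1..L-1}. \<gamma> n * T i n x + teuler (T i n) x =
                       \<alpha> n * T i (n-1) x + teuler (T i (n-1)) x))"

definition hg_momentum ::
    "(complex^'n \<Rightarrow> complex) \<Rightarrow> ('n \<Rightarrow> nat \<Rightarrow> complex^'n \<Rightarrow> complex) \<Rightarrow>
     'n \<Rightarrow> nat \<Rightarrow> complex^'n \<Rightarrow> complex" where
  "hg_momentum y T i n x = (T i (n-1) x - T i n x) / y x"

definition affine_comb ::
    "nat \<Rightarrow> (complex^'n \<Rightarrow> complex) \<Rightarrow> ('n \<Rightarrow> nat \<Rightarrow> complex^'n \<Rightarrow> complex) \<Rightarrow>
     ('n \<Rightarrow> nat \<Rightarrow> complex) \<Rightarrow> complex^'n \<Rightarrow> complex" where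
  "affine_comb L f0 f c x = f0 x + (\<Sum>i\<in>UNIV. \<Sum>n=1..L-1. c i n * f i n x)"

end

theory Submission
  imports Defs "HOL-Complex_Analysis.Cauchy_Integral_Formula"
begin

text \<open>
  At \<open>q = 0\<close> and \<open>\<kappa>\<^sub>0 = \<Sum>\<theta>\<^sub>i\<close> the Hamiltonians do not depend on \<open>p\<close>, so \<open>q = 0\<close> is invariant and \<open>p\<close> satisfies
  Riccati equations. With \<open>p\<^sub>n\<^sup>(\<^sup>i\<^sup>) = (T i (n-1) - T i n) / y\<close> they become linear: the differences \<open>\<pi>\<^sup>i = y p\<^sup>(\<^sup>i\<^sup>)\<close> obey the
  Euler--Darboux relations \<open>(x\<^sub>j - x\<^sub>i) \<partial>\<^sub>j \<pi>\<^sup>i = \<beta>\<^sub>i \<pi>\<^sup>j - \<beta>\<^sub>j \<pi>\<^sup>i\<close>, and \<open>T\<close> is a chain, whose composition is (HG).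
  This linear system for \<open>y\<close> and \<open>y p\<close> is completely integrable, so by the Frobenius theorem (Picard iteration
  along the rays issuing from \<open>x\<^sub>0\<close>) its initial values are arbitrary. Conversely, for a given solution
  of (HG), coprimality of the Euler-operator polynomials involved yields the Euler--Darboux relations
  and, by Bezout identities, the chain.
\<close>

section \<open>Functions of several complex variables\<close>

text \<open>Origin of y: telescoping a chain gives \<theta>_j + sum of the \<open>p_n^(j)\<close> =
  (x_j - 1) d_j(log y). So the factor 1/(x_j - 1) in the Riccati equations, which is the
  contribution of the index 0 with x_0 = 1, becomes d_j y / y, and the quadratic terms become those
  of the quotient rule for (y p)/y. Count of parameters: y and y p are N(L-1) + 1 unknowns of a
  linear system, but p depends only on their ratios; normalising y to 1 at the base point leaves
  N(L-1) free values. The family comes from the linear system and not from (HG), because the Bezout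
  identities that recover a chain from y alone need coprime factors, whereas the linear system
  carries its chain along for all parameters. Rays: contracting the overdetermined system with the
  radial vector field leaves an equation that is always solvable; integrability enters only to show
  that the residuals of the full system satisfy a radial equation whose only solution is 0.
  Convergence and second derivatives rest on Cauchy's formula in one coordinate at a time, since
  holomorphy here is just complex Frechet differentiability.\<close>

definition hol_at :: "(complex^'n::finite \<Rightarrow> complex) \<Rightarrow> complex^'n \<Rightarrow> bool" where
  "hol_at f x \<longleftrightarrow> (\<exists>a :: complex^'n. (f has_derivative (\<lambda>h. \<Sum>i\<in>UNIV. a $ i * h $ i)) (at x))"

lemma holomorphic_sev_iff: "holomorphic_sev \<Omega> f \<longleftrightarrow> (\<forall>x\<in>\<Omega>. hol_at f x)"
  by (simp add: holomorphic_sev_def hol_at_def)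

lemma slice_eq: "(\<chi> k. if k = j then z else x $ k) = x + axis j (z - x $ j)" for x :: "complex^'n"
  by (auto simp: vec_eq_iff axis_def)

lemma sum_mult_axis: "(\<Sum>i\<in>UNIV. a i * axis j z $ i) = a j * (z::complex)"
  by (simp add: axis_def if_distrib cong: if_cong)

lemma bounded_linear_axis: "bounded_linear (axis j :: complex \<Rightarrow> complex^'n::finite)"
  by (auto intro!: linear_conv_bounded_linear[THEN iffD1] linearI simp: vec_eq_iff axis_def)

lemma norm_axis: "norm (axis j z :: complex^'n::finite) = norm z"
proof -
  have "(norm (axis j z $ i))\<^sup>2 = (if i = j then (norm z)\<^sup>2 else 0)" for i by (simp add: axis_def)
  thus ?thesis by (simp add: norm_vec_def L2_set_def)
qed

lemmas has_derivative_axis = bounded_linear.has_derivative[OF bounded_linear_axis has_derivative_ident]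

lemma has_derivative_slice:
  fixes f :: "complex^'n::finite \<Rightarrow> complex"
  assumes "(f has_derivative (\<lambda>h. \<Sum>i\<in>UNIV. a i * h $ i)) (at (x + axis j w))"
  shows "((\<lambda>z. f (x + axis j z)) has_field_derivative a j) (at w)"
proof -
  have "((\<lambda>z. x + axis j z) has_derivative axis j) (at w)"
    using has_derivative_add[OF has_derivative_const[of x] has_derivative_axis[of j "at w"]] by simp
  from has_derivative_compose[OF this, of f "\<lambda>h. \<Sum>i\<in>UNIV. a i * h $ i"] assms
  show ?thesis
    unfolding has_field_derivative_def by (simp add: sum_mult_axis)
qed

text \<open>\<open>deriv\<close> is a choice over the derivative relation; matching that relation
  for every \<open>D\<close> gives equality even where no derivative exists.\<close>

lemma deriv_shift: "deriv (\<lambda>z. f (z - c)) (c::complex) = deriv f 0"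
proof -
  have "((\<lambda>z. f (z - c)) has_field_derivative D) (at c) \<longleftrightarrow> (f has_field_derivative D) (at 0)" for D
    using DERIV_shift[of "\<lambda>z. f (z - c)" D 0 c] by (simp add: add.commute)
  thus ?thesis by (simp add: deriv_def)
qed

lemma pdiff_eq_deriv: "pdiff j f x = deriv (\<lambda>z. f (x + axis j z)) 0"
  unfolding pdiff_def slice_eq by (rule deriv_shift)

lemma pdiff_unique:
  assumes "(f has_derivative (\<lambda>h. \<Sum>i\<in>UNIV. a i * h $ i)) (at x)"
  shows "pdiff j f x = a j"
  unfolding pdiff_eq_deriv
  by (rule DERIV_imp_deriv, rule has_derivative_slice) (use assms in \<open>simp add: axis_def zero_vec_def[symmetric]\<close>)

lemma hol_at_has_derivative:
  assumes "hol_at f x"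
  shows "(f has_derivative (\<lambda>h. \<Sum>i\<in>UNIV. pdiff i f x * h $ i)) (at x)"
proof -
  obtain a where a: "(f has_derivative (\<lambda>h. \<Sum>i\<in>UNIV. a $ i * h $ i)) (at x)"
    using assms unfolding hol_at_def by auto
  show ?thesis using a by (simp add: pdiff_unique[OF a])
qed

lemma hol_atI:
  assumes "(f has_derivative (\<lambda>h. \<Sum>i\<in>UNIV. a i * h $ i)) (at x)"
  shows "hol_at f x"
  unfolding hol_at_def by (rule exI[of _ "\<chi> i. a i"]) (use assms in simp)

lemma hol_at_imp_continuous: "hol_at f x \<Longrightarrow> isCont f x"
  unfolding hol_at_def by (blast intro: has_derivative_continuous)

lemma hol_at_transform:
  assumes "hol_at f x" "open S" "x \<in> S" "\<And>z. z \<in> S \<Longrightarrow> f z = g z"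
  shows "hol_at g x"
  using assms unfolding hol_at_def by (meson has_derivative_transform_within_open)

text \<open>Valid for arbitrary functions: the slice map is continuous at 0, so the two slices agree
  near 0, and \<open>deriv\<close> sees only germs.\<close>

lemma pdiff_cong_open:
  assumes "open S" "x \<in> S" "\<And>z. z \<in> S \<Longrightarrow> f z = g z"
  shows "pdiff j f x = pdiff j g x"
proof -
  have *: "eventually (\<lambda>y. f y = g y) (nhds x)"
    using assms by (auto simp: eventually_nhds)
  have "isCont (\<lambda>z. x + axis j z) (0::complex)"
    by (intro continuous_intros has_derivative_continuous[OF has_derivative_axis])
  hence "((\<lambda>z. x + axis j z) \<longlongrightarrow> x + axis j 0) (nhds (0::complex))"
    unfolding isCont_def tendsto_at_iff_tendsto_nhds[of "\<lambda>z. x + axis j z" 0] .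
  moreover have "axis j (0::complex) = 0" by (simp add: axis_def zero_vec_def)
  ultimately have "filterlim (\<lambda>z. x + axis j z) (nhds x) (nhds (0::complex))" by simp
  with * have "eventually (\<lambda>z. f (x + axis j z) = g (x + axis j z)) (nhds 0)"
    by (rule eventually_compose_filterlim)
  thus ?thesis unfolding pdiff_eq_deriv by (intro deriv_cong_ev) auto
qed

section \<open>Differentiation rules\<close>

lemma hol_at_const [simp]: "hol_at (\<lambda>x. c) x"
  and pdiff_const [simp]: "pdiff j (\<lambda>x. c) x = 0"
proof -
  have *: "((\<lambda>x. c) has_derivative (\<lambda>h. \<Sum>i\<in>UNIV. (\<lambda>i. 0) i * h $ i)) (at x)" for x :: "complex^'n" by simp
  show "hol_at (\<lambda>x. c) x" by (rule hol_atI[OF *])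
  show "pdiff j (\<lambda>x. c) x = 0" by (rule pdiff_unique[OF *])
qed

lemma has_derivative_coord:
  "((\<lambda>x. x $ i) has_derivative (\<lambda>h. \<Sum>k\<in>UNIV. (\<lambda>k. if k = i then 1 else 0) k * h $ k)) (at x)"
  for x :: "complex^'n::finite"
proof -
  have "((\<lambda>x. x $ i) has_derivative (\<lambda>h. h $ i)) (at x)"
    by (rule bounded_linear.has_derivative[OF bounded_linear_vec_nth has_derivative_ident])
  moreover have "(\<lambda>h :: complex^'n. h $ i) = (\<lambda>h. \<Sum>k\<in>UNIV. (\<lambda>k. if k = i then 1 else 0) k * h $ k)"
    by (auto simp: if_distrib[of "\<lambda>x. x * _"] cong: if_cong)
  ultimately show ?thesis by simp
qed

lemma hol_at_coord [simp]: "hol_at (\<lambda>x. x $ i) x" for x :: "complex^'n::finite"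
  by (rule hol_atI[OF has_derivative_coord])

lemma pdiff_coord [simp]: "pdiff j (\<lambda>x. x $ i) x = (if j = i then 1 else 0)" for x :: "complex^'n::finite"
  by (rule pdiff_unique[OF has_derivative_coord])

context
  fixes f g :: "complex^'n::finite \<Rightarrow> complex" and x :: "complex^'n"
  assumes f: "hol_at f x" and g: "hol_at g x"
begin

private lemma add_deriv: "((\<lambda>z. f z + g z) has_derivative (\<lambda>h. \<Sum>i\<in>UNIV. (\<lambda>i. pdiff i f x + pdiff i g x) i * h $ i)) (at x)"
  using has_derivative_add[OF f[THEN hol_at_has_derivative] g[THEN hol_at_has_derivative]]
  by (simp add: distrib_right sum.distrib)

private lemma diff_deriv: "((\<lambda>z. f z - g z) has_derivative (\<lambda>h. \<Sum>i\<in>UNIV. (\<lambda>i. pdiff i f x - pdiff i g x) i * h $ i)) (at x)"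
  using has_derivative_diff[OF f[THEN hol_at_has_derivative] g[THEN hol_at_has_derivative]]
  by (simp add: left_diff_distrib sum_subtractf)

private lemma mult_deriv: "((\<lambda>z. f z * g z) has_derivative (\<lambda>h. \<Sum>i\<in>UNIV. (\<lambda>i. pdiff i f x * g x + f x * pdiff i g x) i * h $ i)) (at x)"
  by (rule has_derivative_eq_rhs[OF has_derivative_mult[OF f[THEN hol_at_has_derivative] g[THEN hol_at_has_derivative]]])
     (auto simp: fun_eq_iff sum_distrib_left sum_distrib_right sum.distrib[symmetric] intro!: sum.cong simp: algebra_simps)

private lemma divide_deriv: 
  assumes "g x \<noteq> 0"
  shows "((\<lambda>z. f z / g z) has_derivative (\<lambda>h. \<Sum>i\<in>UNIV. (\<lambda>i. (pdiff i f x * g x - f x * pdiff i g x) / (g x * g x)) i * h $ i)) (at x)"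
  by (rule has_derivative_eq_rhs[OF has_derivative_divide'[OF f[THEN hol_at_has_derivative] g[THEN hol_at_has_derivative] assms]])
     (auto simp: fun_eq_iff sum_distrib_left sum_distrib_right sum_divide_distrib sum_subtractf[symmetric] diff_divide_distrib intro!: sum.cong simp: algebra_simps)

lemma hol_at_add: "hol_at (\<lambda>z. f z + g z) x" by (rule hol_atI[OF add_deriv])
lemma pdiff_add: "pdiff j (\<lambda>z. f z + g z) x = pdiff j f x + pdiff j g x" by (rule pdiff_unique[OF add_deriv])
lemma hol_at_diff: "hol_at (\<lambda>z. f z - g z) x" by (rule hol_atI[OF diff_deriv])
lemma pdiff_diff: "pdiff j (\<lambda>z. f z - g z) x = pdiff j f x - pdiff j g x" by (rule pdiff_unique[OF diff_deriv])
lemma hol_at_mult: "hol_at (\<lambda>z. f z * g z) x" by (rule hol_atI[OF mult_deriv])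
lemma pdiff_mult: "pdiff j (\<lambda>z. f z * g z) x = pdiff j f x * g x + f x * pdiff j g x" by (rule pdiff_unique[OF mult_deriv])
lemma hol_at_divide: "g x \<noteq> 0 \<Longrightarrow> hol_at (\<lambda>z. f z / g z) x" by (rule hol_atI[OF divide_deriv])
lemma pdiff_divide: "g x \<noteq> 0 \<Longrightarrow> pdiff j (\<lambda>z. f z / g z) x = (pdiff j f x * g x - f x * pdiff j g x) / (g x * g x)"
  by (rule pdiff_unique[OF divide_deriv])

end

lemma hol_at_minus: "hol_at f x \<Longrightarrow> hol_at (\<lambda>z. - f z) x"
  and pdiff_minus: "hol_at f x \<Longrightarrow> pdiff j (\<lambda>z. - f z) x = - pdiff j f x"
  using hol_at_diff[of "\<lambda>_. 0" x f] pdiff_diff[of "\<lambda>_. 0" x f j] by auto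

lemma hol_at_sum:
  assumes "\<And>i. i \<in> I \<Longrightarrow> hol_at (f i) x"
  shows "hol_at (\<lambda>z. \<Sum>i\<in>I. f i z) x"
  using assms by (induction I rule: infinite_finite_induct) (auto intro: hol_at_add)

lemma pdiff_sum:
  assumes "\<And>i. i \<in> I \<Longrightarrow> hol_at (f i) x"
  shows "pdiff j (\<lambda>z. \<Sum>i\<in>I. f i z) x = (\<Sum>i\<in>I. pdiff j (f i) x)"
  using assms by (induction I rule: infinite_finite_induct) (auto simp: pdiff_add hol_at_sum)

lemmas hol_at_intros = hol_at_add hol_at_diff hol_at_mult hol_at_divide hol_at_minus hol_at_sum
lemmas pdiff_rules = pdiff_add pdiff_diff pdiff_mult pdiff_divide pdiff_minus pdiff_sum

section \<open>Cauchy's formula in one coordinate and regularity of partial derivatives\<close>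

lemma hol_at_imp_field_derivative_slice:
  assumes "hol_at f (x + axis j w)"
  shows "((\<lambda>z. f (x + axis j z)) has_field_derivative pdiff j f (x + axis j w)) (at w)"
  by (rule has_derivative_slice[OF hol_at_has_derivative[OF assms]])

lemma continuous_on_axis [continuous_intros]:
  "continuous_on S f \<Longrightarrow> continuous_on S (\<lambda>x. axis j (f x) :: complex^'n::finite)"
  by (rule bounded_linear.continuous_on[OF bounded_linear_axis])

lemma hol_at_imp_continuous_on: "(\<And>z. z \<in> S \<Longrightarrow> hol_at f z) \<Longrightarrow> continuous_on S f"
  by (simp add: continuous_at_imp_continuous_on hol_at_imp_continuous)

text \<open>On the circle w(t) = r exp(2 pi i t) one has dw = 2 pi i w dt, which cancels the
  prefactor 1/(2 pi i) and one of the two powers of w in Cauchy's formula for the first derivative.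
  The parametrised form makes the dependence on the centre \<open>x\<close> accessible to the
  Leibniz rule.\<close>

lemma pdiff_Cauchy_integral:
  fixes f :: "complex^'n::finite \<Rightarrow> complex"
  assumes r: "r > 0" and f: "\<And>z. z \<in> cball x r \<Longrightarrow> hol_at f z"
  shows "pdiff j f x = integral {0..1} (\<lambda>t. f (x + axis j (of_real r * exp (2 * of_real pi * \<i> * of_real t)))
            / (of_real r * exp (2 * of_real pi * \<i> * of_real t)))"
proof -
  define \<phi> where "\<phi> z = f (x + axis j z)" for z
  have d: "(\<phi> has_field_derivative pdiff j f (x + axis j w)) (at w)" if "w \<in> cball 0 r" for w
    unfolding \<phi>_def by (rule hol_at_imp_field_derivative_slice[OF f]) (use that in \<open>auto simp: dist_norm norm_axis\<close>)
  have "continuous_on (cball 0 r) \<phi>"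
    by (meson d DERIV_continuous continuous_at_imp_continuous_on)
  moreover have "\<phi> holomorphic_on ball 0 r"
    unfolding holomorphic_on_def field_differentiable_def
    by (meson d ball_subset_cball has_field_derivative_at_within subsetD)
  ultimately have D: "(\<phi> has_field_derivative (1 / (2 * of_real pi * \<i>) * contour_integral (circlepath 0 r) (\<lambda>u. \<phi> u / (u - 0)^2))) (at 0)"
    using r by (intro Cauchy_derivative_integral_circlepath) auto
  have cp: "circlepath 0 r t = of_real r * exp (2 * of_real pi * \<i> * of_real t)" for t
    by (simp add: circlepath)
  have "axis j (0::complex) = 0" by (simp add: axis_def zero_vec_def)
  with DERIV_unique[OF d[of 0] D] have
    "pdiff j f x = 1 / (2 * of_real pi * \<i>) * contour_integral (circlepath 0 r) (\<lambda>u. \<phi> u / u^2)"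
    using r by simp
  also have "\<dots> = integral {0..1} (\<lambda>t. \<phi> (of_real r * exp (2 * of_real pi * \<i> * of_real t))
            / (of_real r * exp (2 * of_real pi * \<i> * of_real t)))"
    unfolding contour_integral_integral integral_mult_right[symmetric]
    using r by (intro integral_cong) (simp add: vector_derivative_circlepath cp power2_eq_square field_simps)
  finally show ?thesis unfolding \<phi>_def .
qed

text \<open>One radius serves all centres in a small ball, so the Cauchy integrand is jointly
  continuous in centre and parameter. This continuity is what differentiation under the integral
  sign asks for below.\<close>

lemma continuous_pdiff:
  fixes f :: "complex^'n::finite \<Rightarrow> complex"
  assumes "open S" and f: "\<And>z. z \<in> S \<Longrightarrow> hol_at f z"
  shows "continuous_on S (pdiff j f)"
proof -
  have "isCont (pdiff j f) x" if "x \<in> S" for x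
  proof -
    obtain e where e: "e > 0" "cball x e \<subseteq> S" using assms(1) \<open>x \<in> S\<close> open_contains_cball by blast
    define r where "r = e / 2"
    have r: "r > 0" "cball y r \<subseteq> S" if "y \<in> ball x r" for y
    proof -
      show "cball y r \<subseteq> S"
      proof
        fix z assume "z \<in> cball y r"
        hence "dist x z \<le> e" using that dist_triangle[of x z y] unfolding r_def by auto
        thus "z \<in> S" using e by auto
      qed
    qed (use e in \<open>simp add: r_def\<close>)
    have r0: "r > 0" using e by (simp add: r_def)
    define w where "w t = of_real r * exp (2 * of_real pi * \<i> * of_real t)" for t :: real
    have w0: "w t \<noteq> 0" for t using r0 by (simp add: w_def)
    have nw: "norm (w t) = r" for t using r0 by (simp add: w_def norm_mult)
    have cw: "continuous_on A w" for A unfolding w_def by (intro continuous_intros)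
    have "continuous_on (ball x r \<times> cbox 0 1) (\<lambda>(y, t). f (y + axis j (w t)) / w t)"
      unfolding case_prod_unfold
    proof (intro continuous_on_divide continuous_on_compose2[OF hol_at_imp_continuous_on[OF f]] continuous_intros continuous_on_compose2[OF cw])
      show "(\<lambda>p. fst p + axis j (w (snd p))) ` (ball x r \<times> cbox 0 1) \<subseteq> S"
        using r(2) by (fastforce simp: dist_norm nw norm_axis)
    qed (auto simp: w0)
    from integral_continuous_on_param[OF this]
    have "continuous_on (ball x r) (\<lambda>y. integral {0..1} (\<lambda>t. f (y + axis j (w t)) / w t))" by simp
    moreover have "integral {0..1} (\<lambda>t. f (y + axis j (w t)) / w t) = pdiff j f y" if "y \<in> ball x r" for y
      unfolding w_def using r[OF that] f by (intro pdiff_Cauchy_integral[symmetric]) auto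
    ultimately have "continuous_on (ball x r) (pdiff j f)"
      by (rule continuous_on_cong[OF refl, THEN iffD1, rotated])
    thus ?thesis using r0 by (simp add: continuous_on_eq_continuous_at)
  qed
  thus ?thesis by (simp add: continuous_at_imp_continuous_on)
qed

text \<open>The Leibniz rule for a weighted integral along an affine motion of \<open>x\<close>. The
  shape covers two cases: \<open>c t = 1\<close> with \<open>d t\<close> on a circle in one
  coordinate (Cauchy integrals), and \<open>c t = t\<close> with \<open>d t\<close> the rest of a
  convex combination (means along rays).\<close>

lemma
  fixes f :: "complex^'n::finite \<Rightarrow> complex" and c :: "real \<Rightarrow> real"
  assumes S: "open S" and f: "\<And>z. z \<in> S \<Longrightarrow> hol_at f z"
    and U: "open U" "convex U" "x \<in> U"
    and sub: "\<And>t y. t \<in> {0..1} \<Longrightarrow> y \<in> U \<Longrightarrow> c t *\<^sub>R y + d t \<in> S"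
    and cont: "continuous_on {0..1} c" "continuous_on {0..1} d" "continuous_on {0..1} w"
  shows hol_at_integral: "hol_at (\<lambda>x. integral {0..1} (\<lambda>t. w t * f (c t *\<^sub>R x + d t))) x" (is ?th1)
    and pdiff_integral: "pdiff j (\<lambda>x. integral {0..1} (\<lambda>t. w t * f (c t *\<^sub>R x + d t))) x
          = integral {0..1} (\<lambda>t. w t * of_real (c t) * pdiff j f (c t *\<^sub>R x + d t))" (is ?th2)
proof -
  \<comment> \<open>\<open>leibniz_rule\<close> expects the derivative as a continuous family of
    bounded linear operators; \<open>Fapp\<close> returns to coordinates.\<close>
  define F where "F y t = (\<Sum>i\<in>UNIV. blinfun_mult_right (w t * of_real (c t) * pdiff i f (c t *\<^sub>R y + d t)) o\<^sub>L Blinfun (\<lambda>h::complex^'n. h $ i))" for y t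
  have Fapp: "blinfun_apply (F y t) h = (\<Sum>i\<in>UNIV. w t * of_real (c t) * pdiff i f (c t *\<^sub>R y + d t) * h $ i)" for y t h
    unfolding F_def by (simp add: blinfun.sum_left bounded_linear_Blinfun_apply bounded_linear_vec_nth)
  have fst_c: "continuous_on (A \<times> {0..1}) (\<lambda>p. g (snd p))" if "continuous_on {0..1} g" for g :: "real \<Rightarrow> 'b::topological_space" and A :: "(complex^'n) set"
    by (rule continuous_on_compose2[OF that]) (auto intro!: continuous_intros)
  have contF: "continuous_on (U \<times> cbox 0 1) (\<lambda>(y, t). F y t)"
    unfolding F_def case_prod_unfold cbox_interval
    by (intro continuous_intros fst_c cont continuous_on_compose2[OF continuous_pdiff[OF S f]]
        bounded_linear.continuous_on[OF bounded_linear_blinfun_mult_right]) (use sub in auto)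
  have c1: "continuous_on {0..1} (\<lambda>t. F x t)"
    using continuous_on_compose2[OF contF, of "{0..1}" "\<lambda>t. (x, t)"] U
    by (force intro!: continuous_intros simp: case_prod_unfold)
  have D: "((\<lambda>y. integral (cbox 0 1) (\<lambda>t. w t * f (c t *\<^sub>R y + d t))) has_derivative
          blinfun_apply (integral (cbox 0 1) (F x))) (at x within U)"
  proof (rule leibniz_rule[OF _ _ contF U(3,2)])
    fix y t assume y: "y \<in> U" and t: "t \<in> cbox 0 (1::real)"
    have "((\<lambda>y. c t *\<^sub>R y + d t) has_derivative (\<lambda>h. c t *\<^sub>R h)) (at y within U)"
      by (auto intro!: derivative_eq_intros)
    from has_derivative_compose[OF this hol_at_has_derivative[OF f[OF sub]]] t y
    have "((\<lambda>y. f (c t *\<^sub>R y + d t)) has_derivative (\<lambda>h. \<Sum>i\<in>UNIV. pdiff i f (c t *\<^sub>R y + d t) * (c t *\<^sub>R h) $ i)) (at y within U)"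
      by auto
    from has_derivative_mult_right[OF this, of "w t"]
    show "((\<lambda>y. w t * f (c t *\<^sub>R y + d t)) has_derivative blinfun_apply (F y t)) (at y within U)"
      by (rule has_derivative_eq_rhs) (simp add: fun_eq_iff Fapp sum_distrib_left scaleR_conv_of_real[where 'a=complex] mult_ac)
  next
    fix y assume y: "y \<in> U"
    show "(\<lambda>t. w t * f (c t *\<^sub>R y + d t)) integrable_on cbox 0 1"
      by (intro integrable_continuous, unfold cbox_interval)
        (intro continuous_intros cont continuous_on_compose2[OF hol_at_imp_continuous_on[OF f]], use sub y in auto)
  qed
  have "blinfun_apply (integral {0..1} (F x)) h
      = (\<Sum>i\<in>UNIV. (\<lambda>i. integral {0..1} (\<lambda>t. w t * of_real (c t) * pdiff i f (c t *\<^sub>R x + d t))) i * h $ i)" for h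
  proof -
    have "blinfun_apply (integral {0..1} (F x)) h = integral {0..1} (\<lambda>t. blinfun_apply (F x t) h)"
      by (rule blinfun_apply_integral) (rule integrable_continuous_interval[OF c1])
    also have "\<dots> = (\<Sum>i\<in>UNIV. integral {0..1} (\<lambda>t. w t * of_real (c t) * pdiff i f (c t *\<^sub>R x + d t) * h $ i))"
      unfolding Fapp
      by (intro integral_sum integrable_continuous_interval)
        (auto intro!: continuous_intros cont continuous_on_compose2[OF continuous_pdiff[OF S f]] sub U)
    finally show ?thesis by (simp add: integral_mult_left)
  qed
  hence eq: "blinfun_apply (integral (cbox 0 1) (F x)) = (\<lambda>h. \<Sum>i\<in>UNIV. (\<lambda>i. integral {0..1} (\<lambda>t. w t * of_real (c t) * pdiff i f (c t *\<^sub>R x + d t))) i * h $ i)"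
    by auto
  have *: "((\<lambda>x. integral {0..1} (\<lambda>t. w t * f (c t *\<^sub>R x + d t))) has_derivative (\<lambda>h. \<Sum>i\<in>UNIV. (\<lambda>i. integral {0..1} (\<lambda>t. w t * of_real (c t) * pdiff i f (c t *\<^sub>R x + d t))) i * h $ i)) (at x)"
    using D unfolding eq at_within_open[OF U(3,1)] by simp
  show ?th1 by (rule hol_atI[OF *])
  show ?th2 by (rule pdiff_unique[OF *])
qed

context
  fixes S :: "(complex^'n::finite) set"
  assumes S: "open S"
begin

text \<open>Cauchy's formula with a radius common to all nearby centres. Writing
  \<open>1 *\<^sub>R y\<close> makes it an instance of \<open>c t *\<^sub>R x + d t\<close> for
  \<open>c t = 1\<close>.\<close>

private lemma local_Cauchy:
  assumes "x \<in> S"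
  obtains r and w :: "real \<Rightarrow> complex" where "r > 0" "\<And>t. w t \<noteq> 0" "\<And>A. continuous_on A w"
    "\<And>j y t. y \<in> ball x r \<Longrightarrow> 1 *\<^sub>R y + axis j (w t) \<in> S"
    "\<And>j y g. y \<in> ball x r \<Longrightarrow> (\<And>z. z \<in> S \<Longrightarrow> hol_at g z) \<Longrightarrow>
       pdiff j g y = integral {0..1} (\<lambda>t. 1 / w t * g (1 *\<^sub>R y + axis j (w t)))"
proof -
  obtain e where e: "e > 0" "cball x e \<subseteq> S" using S assms open_contains_cball by blast
  define r where "r = e / 2"
  have r: "cball y r \<subseteq> S" if "y \<in> ball x r" for y
  proof
    fix z assume "z \<in> cball y r"
    hence "dist x z \<le> e" using that dist_triangle[of x z y] unfolding r_def by auto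
    thus "z \<in> S" using e by auto
  qed
  have r0: "r > 0" using e by (simp add: r_def)
  define w where "w t = of_real r * exp (2 * of_real pi * \<i> * of_real t)" for t :: real
  have nw: "norm (w t) = r" for t using r0 by (simp add: w_def norm_mult)
  show ?thesis
  proof (rule that[of r w])
    show "w t \<noteq> 0" for t using r0 by (simp add: w_def)
    show "continuous_on A w" for A unfolding w_def by (intro continuous_intros)
    show "1 *\<^sub>R y + axis j (w t) \<in> S" if "y \<in> ball x r" for y t j
      using r[OF that] by (auto simp: subset_iff dist_norm nw norm_axis)
    show "pdiff j g y = integral {0..1} (\<lambda>t. 1 / w t * g (1 *\<^sub>R y + axis j (w t)))"
      if "y \<in> ball x r" and "\<And>z. z \<in> S \<Longrightarrow> hol_at g z" for j y g
      using pdiff_Cauchy_integral[OF r0, of y g j] that(2) r[OF that(1)] by (simp add: w_def subset_iff)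
  qed (rule r0)
qed

text \<open>Near \<open>x\<close> the partial derivative is a Cauchy integral of \<open>f\<close>,
  and such integrals are holomorphic in the centre.\<close>

lemma hol_at_pdiff:
  assumes f: "\<And>z. z \<in> S \<Longrightarrow> hol_at f z" and x: "x \<in> S"
  shows "hol_at (pdiff j f) x"
proof -
  obtain r and w :: "real \<Rightarrow> complex" where r: "r > 0" "\<And>t. w t \<noteq> 0" "\<And>A. continuous_on A w"
    "\<And>j y t. y \<in> ball x r \<Longrightarrow> 1 *\<^sub>R y + axis j (w t) \<in> S"
    "\<And>j y g. y \<in> ball x r \<Longrightarrow> (\<And>z. z \<in> S \<Longrightarrow> hol_at g z) \<Longrightarrow>
       pdiff j g y = integral {0..1} (\<lambda>t. 1 / w t * g (1 *\<^sub>R y + axis j (w t)))"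
    using local_Cauchy[OF x] by blast
  show ?thesis
  proof (rule hol_at_transform[of _ _ "ball x r"])
    show "hol_at (\<lambda>x. integral {0..1} (\<lambda>t. 1 / w t * f (1 *\<^sub>R x + axis j (w t)))) x"
      by (rule hol_at_integral[where U="ball x r", OF S f open_ball convex_ball _ r(4)])
         (use r in \<open>auto intro!: continuous_intros r(3)\<close>)
  qed (use r f in auto)
qed

text \<open>The inner derivative becomes a Cauchy integral, the outer one passes under it, and the
  result is Cauchy's formula for \<open>pdiff k f\<close> read backwards.\<close>

lemma pdiff_commute:
  assumes f: "\<And>z. z \<in> S \<Longrightarrow> hol_at f z" and x: "x \<in> S"
  shows "pdiff k (pdiff j f) x = pdiff j (pdiff k f) x"
proof -
  obtain r and w :: "real \<Rightarrow> complex" where r: "r > 0" "\<And>t. w t \<noteq> 0" "\<And>A. continuous_on A w"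
    "\<And>j y t. y \<in> ball x r \<Longrightarrow> 1 *\<^sub>R y + axis j (w t) \<in> S"
    "\<And>j y g. y \<in> ball x r \<Longrightarrow> (\<And>z. z \<in> S \<Longrightarrow> hol_at g z) \<Longrightarrow>
       pdiff j g y = integral {0..1} (\<lambda>t. 1 / w t * g (1 *\<^sub>R y + axis j (w t)))"
    using local_Cauchy[OF x] by blast
  have "pdiff k (pdiff j f) x = pdiff k (\<lambda>x. integral {0..1} (\<lambda>t. 1 / w t * f (1 *\<^sub>R x + axis j (w t)))) x"
    by (rule pdiff_cong_open[of "ball x r"]) (use r f in auto)
  also have "\<dots> = integral {0..1} (\<lambda>t. 1 / w t * of_real 1 * pdiff k f (1 *\<^sub>R x + axis j (w t)))"
    by (rule pdiff_integral[where U="ball x r" and c="\<lambda>_. 1", OF S f open_ball convex_ball _ r(4)])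
       (use r in \<open>auto intro!: continuous_intros r(3)\<close>)
  also have "\<dots> = pdiff j (pdiff k f) x"
    using r(5)[of x "pdiff k f" j] hol_at_pdiff f r(1) by simp
  finally show ?thesis .
qed

end

section \<open>Cauchy estimates and series of holomorphic functions\<close>

lemma norm_pdiff_le:
  fixes f :: "complex^'n::finite \<Rightarrow> complex"
  assumes r: "r > 0" and f: "\<And>z. z \<in> cball x r \<Longrightarrow> hol_at f z" and B: "\<And>z. z \<in> cball x r \<Longrightarrow> norm (f z) \<le> B"
  shows "norm (pdiff j f x) \<le> B / r"
proof -
  define w where "w t = of_real r * exp (2 * of_real pi * \<i> * of_real t)" for t :: real
  have w0: "w t \<noteq> 0" for t using r by (simp add: w_def)
  have nw: "norm (w t) = r" for t using r by (simp add: w_def norm_mult)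
  have cw: "continuous_on A w" for A unfolding w_def by (intro continuous_intros)
  have mem: "x + axis j (w t) \<in> cball x r" for t by (simp add: dist_norm nw norm_axis)
  have "norm (integral {0..1} (\<lambda>t. f (x + axis j (w t)) / w t)) \<le> B / r * (1 - 0)"
  proof (rule integral_bound)
    show "continuous_on {0..1} (\<lambda>t. f (x + axis j (w t)) / w t)"
      by (intro continuous_intros continuous_on_compose2[OF hol_at_imp_continuous_on[where S="cball x r", OF f]] cw)
        (use mem w0 in auto)
    show "norm (f (x + axis j (w t)) / w t) \<le> B / r" for t
      using B[OF mem] r by (simp add: norm_divide nw divide_right_mono)
  qed auto
  thus ?thesis using pdiff_Cauchy_integral[where j=j, OF r f] by (simp add: w_def)
qed

text \<open>Weierstrass' theorem: on a ball of half the available radius, Cauchy estimates turn the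
  majorant \<open>M k\<close> of the terms into the majorant \<open>M k / r\<close> of all their
  partial derivatives.\<close>

lemma
  fixes f :: "nat \<Rightarrow> complex^'n::finite \<Rightarrow> complex"
  assumes S: "open S" and f: "\<And>k z. z \<in> S \<Longrightarrow> hol_at (f k) z"
    and M: "\<And>k z. z \<in> S \<Longrightarrow> norm (f k z) \<le> M k" "summable M" and x: "x \<in> S"
  shows hol_at_suminf: "hol_at (\<lambda>z. \<Sum>k. f k z) x" (is ?th1)
    and pdiff_suminf: "(\<lambda>k. pdiff j (f k) x) sums pdiff j (\<lambda>z. \<Sum>k. f k z) x" (is ?th2)
proof -
  obtain e where e: "e > 0" "cball x e \<subseteq> S" using S x open_contains_cball by blast
  define r where "r = e / 2"
  have r: "r > 0" using e by (simp add: r_def)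
  have sub: "cball y r \<subseteq> S" if "y \<in> ball x r" for y
  proof
    fix z assume "z \<in> cball y r"
    hence "dist x z \<le> e" using that dist_triangle[of x z y] unfolding r_def by auto
    thus "z \<in> S" using e by auto
  qed
  have mem: "y \<in> S" if "y \<in> ball x r" for y using sub[OF that] r by auto
  have bound: "norm (pdiff i (f k) z) \<le> M k / r" if "z \<in> ball x r" for i k z
    using sub[OF that] f M(1) r by (intro norm_pdiff_le) auto
  have summ: "summable (\<lambda>k. M k / r)" using M(2) by (rule summable_divide)
  define g' where "g' z h = (\<Sum>i\<in>UNIV. (\<Sum>k. pdiff i (f k) z) * h $ i)" for z and h :: "complex^'n"
  have lim: "\<forall>\<^sub>F n in sequentially. \<forall>z\<in>ball x r. \<forall>h. norm ((\<Sum>k<n. \<Sum>i\<in>UNIV. pdiff i (f k) z * h $ i) - g' z h) \<le> e * norm h"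
    if "e > 0" for e
  proof -
    \<comment> \<open>The admissible error is shared equally among the coordinates of
      \<open>h\<close>, each of which is at most \<open>norm h\<close>.\<close>
    define d where "d = e / CARD('n)"
    have d: "d > 0" using that by (simp add: d_def)
    have "\<forall>\<^sub>F n in sequentially. \<forall>i\<in>(UNIV :: 'n set). \<forall>z\<in>ball x r. dist (\<Sum>k<n. pdiff i (f k) z) (\<Sum>k. pdiff i (f k) z) < d"
    proof (rule eventually_ball_finite, simp, safe)
      fix i :: 'n
      have "uniform_limit (ball x r) (\<lambda>n z. \<Sum>k<n. pdiff i (f k) z) (\<lambda>z. \<Sum>k. pdiff i (f k) z) sequentially"
        by (rule Weierstrass_m_test[OF bound summ])
      thus "\<forall>\<^sub>F n in sequentially. \<forall>z\<in>ball x r. dist (\<Sum>k<n. pdiff i (f k) z) (\<Sum>k. pdiff i (f k) z) < d"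
        using d by (rule uniform_limitD)
    qed
    thus ?thesis
    proof (rule eventually_mono, safe)
      fix n z h
      assume A: "\<forall>i\<in>(UNIV :: 'n set). \<forall>z\<in>ball x r. dist (\<Sum>k<n. pdiff i (f k) z) (\<Sum>k. pdiff i (f k) z) < d"
        and z: "z \<in> ball x r"
      have "(\<Sum>k<n. \<Sum>i\<in>UNIV. pdiff i (f k) z * h $ i) - g' z h
          = (\<Sum>i\<in>UNIV. ((\<Sum>k<n. pdiff i (f k) z) - (\<Sum>k. pdiff i (f k) z)) * h $ i)"
        unfolding g'_def by (subst sum.swap) (simp add: sum_subtractf[symmetric] sum_distrib_right left_diff_distrib)
      also have "norm \<dots> \<le> (\<Sum>i\<in>(UNIV::'n set). d * norm h)"
        unfolding norm_mult using A z d
        by (intro sum_norm_le) (auto simp: norm_mult dist_norm Finite_Cartesian_Product.norm_nth_le intro!: mult_mono intro: less_imp_le)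
      also have "\<dots> = e * norm h" by (simp add: d_def)
      finally show "norm ((\<Sum>k<n. \<Sum>i\<in>UNIV. pdiff i (f k) z * h $ i) - g' z h) \<le> e * norm h" .
    qed
  qed
  have sums: "(\<lambda>k. f k z) sums (\<Sum>k. f k z)" if "z \<in> S" for z
  proof -
    have "norm (f n z) \<le> M n" for n by (rule M(1)[OF that])
    from summable_comparison_test'[OF M(2) this] show ?thesis by (rule summable_sums)
  qed
  have "\<exists>g. \<forall>z\<in>ball x r. (\<lambda>n. f n z) sums (g z) \<and> (g has_derivative g' z) (at z within ball x r)"
  proof (rule has_derivative_series[where f=f and S="ball x r" and f'="\<lambda>k z h. \<Sum>i\<in>UNIV. pdiff i (f k) z * h $ i"
        and x=x and g'=g' and l="\<Sum>k. f k x"])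
    show "(f k has_derivative (\<lambda>h. \<Sum>i\<in>UNIV. pdiff i (f k) z * h $ i)) (at z within ball x r)" if "z \<in> ball x r" for k z
      by (rule has_derivative_at_withinI[OF hol_at_has_derivative[OF f[OF mem[OF that]]]])
    show "(\<lambda>k. f k x) sums (\<Sum>k. f k x)" by (rule sums[OF x])
    show "x \<in> ball x r" using r by simp
  qed (rule convex_ball, rule lim)
  then obtain g where g: "\<And>z. z \<in> ball x r \<Longrightarrow> (\<lambda>n. f n z) sums (g z)"
     "\<And>z. z \<in> ball x r \<Longrightarrow> (g has_derivative g' z) (at z within ball x r)" by blast
  have "(g has_derivative g' x) (at x)"
    using g(2)[of x] r by (simp add: at_within_open[of x "ball x r"])
  hence D: "((\<lambda>z. \<Sum>k. f k z) has_derivative (\<lambda>h. \<Sum>i\<in>UNIV. (\<lambda>i. \<Sum>k. pdiff i (f k) x) i * h $ i)) (at x)"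
    unfolding g'_def
    by (rule has_derivative_transform_within_open[where s="ball x r"]) (use r g(1) in \<open>auto simp: sums_iff\<close>)
  show ?th1 by (rule hol_atI[OF D])
  have "norm (pdiff j (f n) x) \<le> M n / r" for n using bound[of x] r by simp
  from summable_comparison_test'[OF summ this] have "summable (\<lambda>k. pdiff j (f k) x)" .
  thus ?th2 unfolding pdiff_unique[OF D] by (rule summable_sums)
qed

section \<open>Integrable linear systems\<close>

lemma onorm_scaleR_le: "norm w \<le> B \<Longrightarrow> onorm (\<lambda>h::real. h *\<^sub>R w) \<le> B"
  by (intro onorm_le) (simp add: mult.commute[of B] mult_left_mono)

lemma line_has_vector_derivative:
  fixes f :: "complex^'n::finite \<Rightarrow> complex"
  assumes "hol_at f (t *\<^sub>R x + (1 - t) *\<^sub>R x0)"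
  shows "((\<lambda>t. f (t *\<^sub>R x + (1 - t) *\<^sub>R x0)) has_vector_derivative
           (\<Sum>k\<in>UNIV. pdiff k f (t *\<^sub>R x + (1 - t) *\<^sub>R x0) * (x $ k - x0 $ k))) (at t within T)"
proof -
  have "((\<lambda>t. t *\<^sub>R x + (1 - t) *\<^sub>R x0) has_derivative (\<lambda>s. s *\<^sub>R (x - x0))) (at t within T)"
    by (rule has_derivative_eq_rhs, (rule derivative_intros)+) (auto simp: algebra_simps)
  from has_derivative_compose[OF this hol_at_has_derivative[OF assms]]
  show ?thesis unfolding has_vector_derivative_def
    by (rule has_derivative_eq_rhs) (auto simp: fun_eq_iff scaleR_sum_right intro!: sum.cong)
qed

text \<open>Multiplied by x_j - x0_j and summed over j, the means of functions g_j give the integral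
  of the form sum g_j dx_j along the segment from \<open>x0\<close> to \<open>x\<close>.\<close>

definition ray_mean :: "complex^'n::finite \<Rightarrow> (complex^'n \<Rightarrow> complex) \<Rightarrow> complex^'n \<Rightarrow> complex" where
  "ray_mean x0 g x = integral {0..1} (\<lambda>t. g (t *\<^sub>R x + (1 - t) *\<^sub>R x0))"

lemma ray_in_ball: "x \<in> ball x0 r \<Longrightarrow> t \<in> {0..1} \<Longrightarrow> t *\<^sub>R x + (1 - t) *\<^sub>R x0 \<in> ball x0 r"
  for x x0 :: "complex^'n::finite"
  using convexD_alt[OF convex_ball, of x0 x0 r x t] by (auto simp: add.commute dest: le_less_trans[OF zero_le_dist])

context
  fixes x0 :: "complex^'n::finite" and r :: real and g :: "complex^'n \<Rightarrow> complex"
  assumes g: "\<And>z. z \<in> ball x0 r \<Longrightarrow> hol_at g z"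
begin

private lemma ray_continuous:
  assumes "x \<in> ball x0 r" and "\<And>z. z \<in> ball x0 r \<Longrightarrow> hol_at f z"
  shows "continuous_on {0..1} (\<lambda>t. f (t *\<^sub>R x + (1 - t) *\<^sub>R x0))"
  by (rule continuous_on_compose2[OF hol_at_imp_continuous_on[where S="ball x0 r" and f=f]])
     (use assms ray_in_ball[of x x0 r] in \<open>auto intro!: continuous_intros\<close>)

lemma hol_at_ray_mean:
  assumes "x \<in> ball x0 r"
  shows "hol_at (ray_mean x0 g) x"
proof -
  have "hol_at (\<lambda>x. integral {0..1} (\<lambda>t. 1 * g (t *\<^sub>R x + (1 - t) *\<^sub>R x0))) x"
    by (rule hol_at_integral[where S="ball x0 r" and U="ball x0 r" and c="\<lambda>t. t" and w="\<lambda>_. 1"])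
       (use assms in \<open>auto intro!: continuous_intros ray_in_ball g simp del: mem_ball\<close>)
  thus ?thesis by (simp add: ray_mean_def[abs_def])
qed

lemma norm_ray_mean_le:
  assumes "x \<in> ball x0 r" "\<And>z. z \<in> ball x0 r \<Longrightarrow> norm (g z) \<le> B"
  shows "norm (ray_mean x0 g x) \<le> B"
  unfolding ray_mean_def
  using integral_bound[OF _ ray_continuous[OF assms(1) g], of B] assms ray_in_ball[OF assms(1)] by auto

text \<open>The derivative of t g(t x + (1-t) x0) is integrated over [0,1]. Thus
  \<open>ray_mean x0\<close> is a right inverse of 1 + E, where E is the radial vector field at
  \<open>x0\<close>.\<close>

lemma ray_mean_euler:
  assumes x: "x \<in> ball x0 r"
  shows "ray_mean x0 g x + (\<Sum>k\<in>UNIV. (x $ k - x0 $ k) * pdiff k (ray_mean x0 g) x) = g x"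
proof -
  let ?\<gamma> = "\<lambda>t. t *\<^sub>R x + (1 - t) *\<^sub>R x0"
  have pd: "pdiff k (ray_mean x0 g) x = integral {0..1} (\<lambda>t. of_real t * pdiff k g (?\<gamma> t))" for k
  proof -
    have "pdiff k (\<lambda>x. integral {0..1} (\<lambda>t. 1 * g (t *\<^sub>R x + (1 - t) *\<^sub>R x0))) x
        = integral {0..1} (\<lambda>t. 1 * of_real t * pdiff k g (?\<gamma> t))"
      by (rule pdiff_integral[where S="ball x0 r" and U="ball x0 r" and c="\<lambda>t. t" and w="\<lambda>_. 1"])
         (use x in \<open>auto intro!: continuous_intros ray_in_ball g simp del: mem_ball\<close>)
    thus ?thesis by (simp add: ray_mean_def[abs_def])
  qed
  have cont: "continuous_on {0..1} (\<lambda>t. pdiff k g (?\<gamma> t))" for k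
    by (rule ray_continuous[OF x hol_at_pdiff[OF open_ball g]])
  have "((\<lambda>t. g (?\<gamma> t) + of_real t * (\<Sum>k\<in>UNIV. pdiff k g (?\<gamma> t) * (x $ k - x0 $ k))) has_integral
         of_real 1 * g (?\<gamma> 1) - of_real 0 * g (?\<gamma> 0)) {0..1}"
  proof (rule fundamental_theorem_of_calculus)
    fix t :: real assume t: "t \<in> {0..1}"
    show "((\<lambda>t. of_real t * g (?\<gamma> t)) has_vector_derivative
       g (?\<gamma> t) + of_real t * (\<Sum>k\<in>UNIV. pdiff k g (?\<gamma> t) * (x $ k - x0 $ k))) (at t within {0..1})"
      using has_vector_derivative_mult[OF has_vector_derivative_of_real[OF DERIV_ident]
          line_has_vector_derivative[OF g[OF ray_in_ball[OF x t]]]]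
      by (simp add: add.commute)
  qed simp
  hence "g x = integral {0..1} (\<lambda>t. g (?\<gamma> t) + of_real t * (\<Sum>k\<in>UNIV. pdiff k g (?\<gamma> t) * (x $ k - x0 $ k)))"
    by (simp add: integral_unique)
  also have "\<dots> = ray_mean x0 g x + integral {0..1} (\<lambda>t. \<Sum>k\<in>UNIV. (x $ k - x0 $ k) * (of_real t * pdiff k g (?\<gamma> t)))"
    unfolding ray_mean_def
    by (subst integral_add[symmetric])
       (auto intro!: integrable_continuous_interval continuous_intros ray_continuous[OF x g] cont simp: sum_distrib_left mult_ac)
  also have "integral {0..1} (\<lambda>t. \<Sum>k\<in>UNIV. (x $ k - x0 $ k) * (of_real t * pdiff k g (?\<gamma> t)))
      = (\<Sum>k\<in>UNIV. (x $ k - x0 $ k) * pdiff k (ray_mean x0 g) x)"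
    unfolding pd integral_mult_right[symmetric]
    by (rule integral_sum) (auto intro!: integrable_continuous_interval continuous_intros cont)
  finally show ?thesis by simp
qed

end

text \<open>These are the terms of the Neumann series, not its partial sums: each is the ray
  integral of \<open>A\<close> applied to its predecessor. All terms but the zeroth vanish at
  \<open>x0\<close>, so their sum has initial value \<open>u0\<close>.\<close>

primrec picard :: "'m set \<Rightarrow> ('n \<Rightarrow> 'm \<Rightarrow> 'm \<Rightarrow> complex^'n::finite \<Rightarrow> complex) \<Rightarrow> complex^'n \<Rightarrow> ('m \<Rightarrow> complex) \<Rightarrow>
    nat \<Rightarrow> 'm \<Rightarrow> complex^'n \<Rightarrow> complex" where
  "picard I A x0 u0 0 = (\<lambda>a x. u0 a)"
| "picard I A x0 u0 (Suc k) = (\<lambda>a x. \<Sum>j\<in>UNIV. (x $ j - x0 $ j) *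
     ray_mean x0 (\<lambda>z. \<Sum>b\<in>I. A j a b z * picard I A x0 u0 k b z) x)"

context
  fixes I :: "'m set" and A :: "'n \<Rightarrow> 'm \<Rightarrow> 'm \<Rightarrow> complex^'n::finite \<Rightarrow> complex" and x0 :: "complex^'n"
    and r M :: real
  assumes I: "finite I" and r: "r > 0"
    and A: "\<And>j a b z. a \<in> I \<Longrightarrow> b \<in> I \<Longrightarrow> z \<in> ball x0 r \<Longrightarrow> hol_at (A j a b) z"
    and M: "\<And>j a z. a \<in> I \<Longrightarrow> z \<in> ball x0 r \<Longrightarrow> (\<Sum>b\<in>I. norm (A j a b z)) \<le> M"
    and small: "CARD('n) * (r * M) \<le> 1 / 2"
begin

lemma picard_hol:
  assumes "a \<in> I" "x \<in> ball x0 r"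
  shows "hol_at (picard I A x0 u0 k a) x"
  using assms
proof (induction k arbitrary: a x)
  case (Suc k)
  have "hol_at (ray_mean x0 (\<lambda>z. \<Sum>b\<in>I. A j a b z * picard I A x0 u0 k b z)) x" for j
    by (rule hol_at_ray_mean[of x0 r]) (use Suc A in \<open>auto intro!: hol_at_intros\<close>)
  thus ?case by (auto intro!: hol_at_intros)
qed simp

lemma contraction:
  assumes "a \<in> I" "z \<in> ball x0 r" "\<And>b. b \<in> I \<Longrightarrow> norm (v b) \<le> B"
  shows "norm (\<Sum>b\<in>I. A j a b z * v b) \<le> M * B"
proof (cases "I = {}")
  case False
  hence "B \<ge> 0" using assms(3) norm_ge_zero order_trans by blast
  have "norm (\<Sum>b\<in>I. A j a b z * v b) \<le> (\<Sum>b\<in>I. norm (A j a b z) * B)"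
    by (rule sum_norm_le) (use assms in \<open>auto simp: norm_mult mult_left_mono\<close>)
  also have "\<dots> \<le> M * B"
    unfolding sum_distrib_right[symmetric] using M assms \<open>B \<ge> 0\<close> by (intro mult_right_mono) auto
  finally show ?thesis .
qed (use assms in simp)

text \<open>One integration along a ray gains the factor N r M, which \<open>small\<close> bounds by
  1/2; this is the source of all powers of 2 below.\<close>

lemma contraction_sum:
  assumes "x \<in> ball x0 r" "\<And>j. norm (w j) \<le> M * B" "B \<ge> 0"
  shows "norm (\<Sum>j\<in>UNIV. (x $ j - x0 $ j) * w j) \<le> B / 2"
proof -
  have "norm (x $ j - x0 $ j) \<le> r" for j
    using assms(1) Finite_Cartesian_Product.norm_nth_le[of "x - x0" j] by (auto simp: dist_norm norm_minus_commute)
  hence "norm (\<Sum>j\<in>UNIV. (x $ j - x0 $ j) * w j) \<le> (\<Sum>j\<in>(UNIV::'n set). r * (M * B))"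
    using assms r by (intro sum_norm_le) (auto simp: norm_mult intro!: mult_mono)
  also have "\<dots> = CARD('n) * (r * M) * B" by simp
  also have "\<dots> \<le> 1 / 2 * B" using small assms(3) by (rule mult_right_mono)
  finally show ?thesis by simp
qed

lemma picard_bound:
  assumes C: "\<And>b. b \<in> I \<Longrightarrow> norm (u0 b) \<le> C" and "a \<in> I" "x \<in> ball x0 r"
  shows "norm (picard I A x0 u0 k a x) \<le> C / 2 ^ k"
  using assms(2,3)
proof (induction k arbitrary: a x)
  case (Suc k)
  have C0: "C \<ge> 0" using C[OF Suc.prems(1)] norm_ge_zero order_trans by blast
  have "norm (picard I A x0 u0 (Suc k) a x) \<le> (C / 2 ^ k) / 2"
    unfolding picard.simps
  proof (rule contraction_sum)
    have b: "norm (\<Sum>b\<in>I. A j a b z * picard I A x0 u0 k b z) \<le> M * (C / 2 ^ k)" if "z \<in> ball x0 r" for j z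
      by (rule contraction[OF Suc.prems(1) that]) (rule Suc.IH[OF _ that])
    show "norm (ray_mean x0 (\<lambda>z. \<Sum>b\<in>I. A j a b z * picard I A x0 u0 k b z) x) \<le> M * (C / 2 ^ k)" for j
      by (rule norm_ray_mean_le[OF _ Suc.prems(2) b])
         (use Suc.prems A picard_hol in \<open>auto intro!: hol_at_intros\<close>)
  qed (use Suc C0 in auto)
  thus ?case by simp
qed (use C in simp)

text \<open>Summing the Neumann series solves the contraction of the system with the radial field.
  No integrability is involved, since this is a single equation for each unknown.\<close>

lemma ray_solution:
  shows "\<exists>U. \<forall>a\<in>I. U a x0 = u0 a \<and> (\<forall>z\<in>ball x0 r. hol_at (U a) z \<and>
       (\<Sum>j\<in>UNIV. (z $ j - x0 $ j) * pdiff j (U a) z) = (\<Sum>j\<in>UNIV. (z $ j - x0 $ j) * (\<Sum>b\<in>I. A j a b z * U b z)))"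
proof -
  let ?W = "picard I A x0 u0"
  define C where "C = (\<Sum>b\<in>I. norm (u0 b))"
  have C: "norm (u0 b) \<le> C" if "b \<in> I" for b unfolding C_def using that I by (intro member_le_sum) auto
  have summ: "summable (\<lambda>k. C / 2 ^ k)"
    using summable_mult[OF summable_geometric[of "1/2::real"], of C] by (simp add: power_divide)
  define U where "U a z = (\<Sum>k. ?W k a z)" for a z
  have U: "(\<lambda>k. ?W k a z) sums U a z" if "a \<in> I" "z \<in> ball x0 r" for a z
  proof -
    have "norm (?W k a z) \<le> C / 2 ^ k" for k by (rule picard_bound[OF C that])
    from summable_comparison_test'[OF summ this] show ?thesis unfolding U_def by (rule summable_sums)
  qed
  show ?thesis
  proof (intro exI[of _ U] ballI conjI)
    fix a assume a: "a \<in> I"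
    have "?W k a x0 = (if k = 0 then u0 a else 0)" for k by (cases k) auto
    hence "(\<lambda>k. ?W k a x0) sums u0 a" using sums_single[of 0 "\<lambda>_. u0 a"] by simp
    with U[OF a, of x0] r show "U a x0 = u0 a" by (auto dest: sums_unique2)
    fix z assume z: "z \<in> ball x0 r"
    show "hol_at (U a) z" unfolding U_def[abs_def]
      by (rule hol_at_suminf[OF open_ball picard_hol[OF a] picard_bound[OF C a] summ z])
    have "(\<lambda>k. \<Sum>j\<in>UNIV. (z $ j - x0 $ j) * pdiff j (?W k a) z) sums (\<Sum>j\<in>UNIV. (z $ j - x0 $ j) * pdiff j (U a) z)"
      unfolding U_def[abs_def]
      by (intro sums_sum sums_mult pdiff_suminf[OF open_ball picard_hol[OF a] picard_bound[OF C a] summ z])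
    moreover have "(\<lambda>k. \<Sum>j\<in>UNIV. (z $ j - x0 $ j) * pdiff j (?W k a) z) sums
         (\<Sum>j\<in>UNIV. (z $ j - x0 $ j) * (\<Sum>b\<in>I. A j a b z * U b z))"
    proof -
      \<comment> \<open>With h_j = z_j - x0_j, E the radial field and m_j the ray mean of
        \<open>?G j\<close>: E(h_j m_j) = h_j (m_j + E m_j) = h_j \<open>?G j\<close> by
        \<open>ray_mean_euler\<close>.\<close>
      have step: "(\<Sum>j\<in>UNIV. (z $ j - x0 $ j) * pdiff j (?W (Suc k) a) z)
          = (\<Sum>j\<in>UNIV. (z $ j - x0 $ j) * (\<Sum>b\<in>I. A j a b z * ?W k b z))" for k
      proof -
        let ?G = "\<lambda>j z. \<Sum>b\<in>I. A j a b z * ?W k b z"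
        have G: "hol_at (?G j) y" if "y \<in> ball x0 r" for j y
          using that a A picard_hol by (auto intro!: hol_at_intros)
        have R: "hol_at (ray_mean x0 (?G j)) z" for j by (rule hol_at_ray_mean[of x0 r, OF G z])
        have "pdiff i (?W (Suc k) a) z = ray_mean x0 (?G i) z + (\<Sum>j\<in>UNIV. (z $ j - x0 $ j) * pdiff i (ray_mean x0 (?G j)) z)" for i
          using R by (simp add: pdiff_rules hol_at_intros sum.distrib if_distrib[of "\<lambda>x. x * _"] cong: if_cong)
        hence "(\<Sum>i\<in>UNIV. (z $ i - x0 $ i) * pdiff i (?W (Suc k) a) z) =
           (\<Sum>i\<in>UNIV. (z $ i - x0 $ i) * ray_mean x0 (?G i) z) +
           (\<Sum>i\<in>UNIV. \<Sum>j\<in>UNIV. (z $ j - x0 $ j) * ((z $ i - x0 $ i) * pdiff i (ray_mean x0 (?G j)) z))"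
          by (simp add: distrib_left sum.distrib sum_distrib_left mult.left_commute)
        also have "(\<Sum>i\<in>UNIV. \<Sum>j\<in>UNIV. (z $ j - x0 $ j) * ((z $ i - x0 $ i) * pdiff i (ray_mean x0 (?G j)) z))
           = (\<Sum>j\<in>UNIV. (z $ j - x0 $ j) * (\<Sum>i\<in>UNIV. (z $ i - x0 $ i) * pdiff i (ray_mean x0 (?G j)) z))"
          by (subst sum.swap) (simp add: sum_distrib_left)
        also have "(\<Sum>i\<in>UNIV. (z $ i - x0 $ i) * ray_mean x0 (?G i) z) + \<dots> = (\<Sum>j\<in>UNIV. (z $ j - x0 $ j) * ?G j z)"
          unfolding sum.distrib[symmetric] distrib_left[symmetric]
          using ray_mean_euler[of x0 r, OF G z] by simp
        finally show ?thesis .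
      qed
      have "(\<lambda>k. \<Sum>j\<in>UNIV. (z $ j - x0 $ j) * (\<Sum>b\<in>I. A j a b z * ?W k b z)) sums
          (\<Sum>j\<in>UNIV. (z $ j - x0 $ j) * (\<Sum>b\<in>I. A j a b z * U b z))"
        by (intro sums_sum sums_mult U z)
      hence "(\<lambda>k. \<Sum>j\<in>UNIV. (z $ j - x0 $ j) * pdiff j (?W (Suc k) a) z) sums
          (\<Sum>j\<in>UNIV. (z $ j - x0 $ j) * (\<Sum>b\<in>I. A j a b z * U b z))" unfolding step .
      \<comment> \<open>The zeroth term is constant, so the shifted series has the same sum as the
        full one.\<close>
      moreover have "(\<Sum>j\<in>UNIV. (z $ j - x0 $ j) * pdiff j (?W 0 a) z) = 0" by simp
      ultimately show ?thesis
        using sums_Suc[of "\<lambda>k. \<Sum>j\<in>UNIV. (z $ j - x0 $ j) * pdiff j (?W k a) z"] by simp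
    qed
    ultimately show "(\<Sum>j\<in>UNIV. (z $ j - x0 $ j) * pdiff j (U a) z) = (\<Sum>j\<in>UNIV. (z $ j - x0 $ j) * (\<Sum>b\<in>I. A j a b z * U b z))"
      by (rule sums_unique2)
  qed
qed

text \<open>The zeroth-order term \<open>R a z\<close> replaces an initial condition: along a ray, t
  R satisfies a homogeneous linear differential equation in t and vanishes at t = 0 in any
  case.\<close>

lemma ray_uniqueness:
  assumes R: "\<And>a z. a \<in> I \<Longrightarrow> z \<in> ball x0 r \<Longrightarrow> hol_at (R a) z"
    and eq: "\<And>a z. a \<in> I \<Longrightarrow> z \<in> ball x0 r \<Longrightarrow>
       R a z + (\<Sum>j\<in>UNIV. (z $ j - x0 $ j) * pdiff j (R a) z) = (\<Sum>j\<in>UNIV. (z $ j - x0 $ j) * (\<Sum>b\<in>I. A j a b z * R b z))"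
    and a: "a \<in> I" and x: "x \<in> ball x0 r"
  shows "R a x = 0"
proof -
  define \<gamma> where "\<gamma> t = t *\<^sub>R x + (1 - t) *\<^sub>R x0" for t :: real
  have \<gamma>: "\<gamma> t \<in> ball x0 r" if "t \<in> {0..1}" for t unfolding \<gamma>_def by (rule ray_in_ball[OF x that])
  define \<rho> where "\<rho> b t = of_real t * R b (\<gamma> t)" for b t
  have d\<rho>: "(\<rho> b has_vector_derivative (\<Sum>j\<in>UNIV. (x $ j - x0 $ j) * (\<Sum>c\<in>I. A j b c (\<gamma> t) * \<rho> c t))) (at t within {0..1})"
    if b: "b \<in> I" and t: "t \<in> {0..1}" for b t
  proof -
    have "(\<rho> b has_vector_derivative R b (\<gamma> t) + of_real t * (\<Sum>k\<in>UNIV. pdiff k (R b) (\<gamma> t) * (x $ k - x0 $ k))) (at t within {0..1})"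
      using has_vector_derivative_mult[OF has_vector_derivative_of_real[OF DERIV_ident]
          line_has_vector_derivative[OF R[OF b ray_in_ball[OF x t]]]]
      by (simp add: add.commute \<rho>_def[abs_def] \<gamma>_def)
    moreover have "\<gamma> t $ j - x0 $ j = of_real t * (x $ j - x0 $ j)" for j
      unfolding \<gamma>_def by (simp add: scaleR_conv_of_real[where 'a=complex] algebra_simps)
    hence "R b (\<gamma> t) + of_real t * (\<Sum>k\<in>UNIV. pdiff k (R b) (\<gamma> t) * (x $ k - x0 $ k))
        = (\<Sum>j\<in>UNIV. (x $ j - x0 $ j) * (\<Sum>c\<in>I. A j b c (\<gamma> t) * \<rho> c t))"
      using eq[OF b \<gamma>[OF t]] by (simp add: \<rho>_def sum_distrib_left mult_ac)
    ultimately show ?thesis by simp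
  qed
  have "\<exists>C. \<forall>t\<in>{0..1}. norm (\<rho> b t) \<le> C" if "b \<in> I" for b
  proof -
    have "continuous_on {0..1} (\<rho> b)"
      unfolding continuous_on_eq_continuous_within
      using d\<rho>[OF that] has_vector_derivative_continuous by blast
    hence "bounded (\<rho> b ` {0..1})" by (intro compact_imp_bounded compact_continuous_image) auto
    thus ?thesis by (auto simp: bounded_iff)
  qed
  then obtain C' where C': "\<And>b t. b \<in> I \<Longrightarrow> t \<in> {0..1} \<Longrightarrow> norm (\<rho> b t) \<le> C' b" by metis
  define C where "C = (\<Sum>b\<in>I. \<bar>C' b\<bar>)"
  have C0: "C \<ge> 0" unfolding C_def by (rule sum_nonneg) auto
  \<comment> \<open>Iteration in place of Gronwall's inequality: a bound on \<rho> bounds its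
    derivative by half as much, and integrating from \<rho>(0) = 0 over a length of at most 1 keeps
    that half.\<close>
  have "norm (\<rho> b t) \<le> C / 2 ^ k" if "b \<in> I" "t \<in> {0..1}" for b t k
    using that
  proof (induction k arbitrary: b t)
    case 0
    have "\<bar>C' b\<bar> \<le> C" unfolding C_def by (rule member_le_sum) (use 0 I in auto)
    thus ?case using C'[OF 0] by simp
  next
    case (Suc k)
    have "norm (\<rho> b t - \<rho> b 0) \<le> (C / 2 ^ k / 2) * norm (t - 0)"
    proof (rule differentiable_bound[of "{0..1}"])
      fix s :: real assume s: "s \<in> {0..1}"
      show "(\<rho> b has_derivative (\<lambda>h. h *\<^sub>R (\<Sum>j\<in>UNIV. (x $ j - x0 $ j) * (\<Sum>c\<in>I. A j b c (\<gamma> s) * \<rho> c s)))) (at s within {0..1})"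
        using d\<rho>[OF Suc.prems(1) s] unfolding has_vector_derivative_def .
      have "norm (\<Sum>j\<in>UNIV. (x $ j - x0 $ j) * (\<Sum>c\<in>I. A j b c (\<gamma> s) * \<rho> c s)) \<le> C / 2 ^ k / 2"
        by (rule contraction_sum[OF x contraction]) (use Suc C0 \<gamma> s in auto)
      thus "onorm (\<lambda>h::real. h *\<^sub>R (\<Sum>j\<in>UNIV. (x $ j - x0 $ j) * (\<Sum>c\<in>I. A j b c (\<gamma> s) * \<rho> c s))) \<le> C / 2 ^ k / 2"
        by (rule onorm_scaleR_le)
    qed (use Suc in auto)
    also have "\<dots> \<le> C / 2 ^ k / 2 * 1" using Suc.prems C0 by (intro mult_left_mono) auto
    finally show ?case by (simp add: \<rho>_def)
  qed
  from this[OF a, of 1] have bd: "norm (R a x) \<le> C / 2 ^ k" for k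
    by (simp add: \<rho>_def \<gamma>_def)
  have "(\<lambda>k. C / 2 ^ k) \<longlonglongrightarrow> 0"
    using tendsto_mult[OF tendsto_const[of C] LIMSEQ_realpow_zero[of "1/2"]] by (simp add: power_divide)
  from LIMSEQ_le_const[OF this, of "norm (R a x)"] bd have "norm (R a x) \<le> 0" by blast
  thus ?thesis by simp
qed

end


text \<open>The integrability condition is tested on functions that solve the system to first order at one
  point, so that it can be checked by differentiating the right-hand sides.\<close>

theorem frobenius:
  fixes A :: "'n \<Rightarrow> 'm \<Rightarrow> 'm \<Rightarrow> complex^'n::finite \<Rightarrow> complex"
  assumes S: "open S" "x0 \<in> S" and I: "finite I"
    and A: "\<And>j a b z. a \<in> I \<Longrightarrow> b \<in> I \<Longrightarrow> z \<in> S \<Longrightarrow> hol_at (A j a b) z"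
    and integrable: "\<And>u z j k a. z \<in> S \<Longrightarrow> a \<in> I \<Longrightarrow> (\<And>b y. hol_at (u b) y) \<Longrightarrow>
        (\<And>b k. b \<in> I \<Longrightarrow> pdiff k (u b) z = (\<Sum>c\<in>I. A k b c z * u c z)) \<Longrightarrow>
        pdiff k (\<lambda>y. \<Sum>b\<in>I. A j a b y * u b y) z = pdiff j (\<lambda>y. \<Sum>b\<in>I. A k a b y * u b y) z"
  obtains r where "r > 0" "ball x0 r \<subseteq> S"
    "\<And>u0. \<exists>U. \<forall>a\<in>I. U a x0 = u0 a \<and>
       (\<forall>z\<in>ball x0 r. hol_at (U a) z \<and> (\<forall>j. pdiff j (U a) z = (\<Sum>b\<in>I. A j a b z * U b z)))"
proof -
  obtain e where e: "e > 0" "cball x0 e \<subseteq> S" using S open_contains_cball by blast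
  have "\<exists>K. \<forall>z\<in>cball x0 e. norm (A j a b z) \<le> K" if "a \<in> I" "b \<in> I" for j a b
  proof -
    have "continuous_on (cball x0 e) (A j a b)" by (rule hol_at_imp_continuous_on) (use that A e in auto)
    hence "bounded (A j a b ` cball x0 e)" by (intro compact_imp_bounded compact_continuous_image) auto
    thus ?thesis by (auto simp: bounded_iff)
  qed
  note ex = this
  define K where "K j a b = (SOME K. \<forall>z\<in>cball x0 e. norm (A j a b z) \<le> K)" for j a b
  have K: "norm (A j a b z) \<le> K j a b" if "a \<in> I" "b \<in> I" "z \<in> cball x0 e" for j a b z
    using someI_ex[OF ex[OF that(1,2), of j]] that(3) unfolding K_def by blast
  \<comment> \<open>One bound for all row sums of all coefficient matrices; the summand 1 makes it
    positive, so that it can stand in a denominator.\<close>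
  define M where "M = 1 + (\<Sum>j\<in>UNIV. \<Sum>a\<in>I. \<Sum>b\<in>I. \<bar>K j a b\<bar>)"
  have M: "(\<Sum>b\<in>I. norm (A j a b z)) \<le> M" if "a \<in> I" "z \<in> cball x0 e" for j a z
  proof -
    have "(\<Sum>b\<in>I. norm (A j a b z)) \<le> (\<Sum>b\<in>I. \<bar>K j a b\<bar>)"
      by (rule sum_mono) (rule order_trans[OF K[OF that(1) _ that(2)] abs_ge_self])
    also have "\<dots> \<le> (\<Sum>a\<in>I. \<Sum>b\<in>I. \<bar>K j a b\<bar>)"
      by (rule member_le_sum[of a I "\<lambda>a. \<Sum>b\<in>I. \<bar>K j a b\<bar>"]) (use that I in \<open>auto intro: sum_nonneg\<close>)
    also have "\<dots> \<le> (\<Sum>j\<in>UNIV. \<Sum>a\<in>I. \<Sum>b\<in>I. \<bar>K j a b\<bar>)"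
      by (rule member_le_sum[of j UNIV "\<lambda>j. \<Sum>a\<in>I. \<Sum>b\<in>I. \<bar>K j a b\<bar>"]) (auto intro: sum_nonneg)
    finally show ?thesis by (simp add: M_def)
  qed
  have M0: "M > 0" unfolding M_def by (intro add_pos_nonneg sum_nonneg) auto
  \<comment> \<open>The second entry is the contraction threshold N r M = 1/2. It depends on
    \<open>A\<close> alone, so the same ball serves every initial vector.\<close>
  define r where "r = min e (1 / (2 * CARD('n) * M))"
  have r: "r > 0" "r \<le> e" using e M0 by (auto simp: r_def)
  have "CARD('n) * (r * M) \<le> CARD('n) * (1 / (2 * CARD('n) * M) * M)"
    using M0 by (intro mult_left_mono mult_right_mono) (auto simp: r_def)
  also have "\<dots> = 1 / 2" using M0 by simp
  finally have small: "CARD('n) * (r * M) \<le> 1 / 2" .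
  have sub: "ball x0 r \<subseteq> S" "ball x0 r \<subseteq> cball x0 e" using e r by auto
  have A': "hol_at (A j a b) z" if "a \<in> I" "b \<in> I" "z \<in> ball x0 r" for j a b z using that A sub by auto
  have M': "(\<Sum>b\<in>I. norm (A j a b z)) \<le> M" if "a \<in> I" "z \<in> ball x0 r" for j a z using that M sub by auto
  show ?thesis
  proof (rule that[OF r(1) sub(1)])
    fix u0
    obtain U where U0: "\<And>a. a \<in> I \<Longrightarrow> U a x0 = u0 a"
      and U: "\<And>a z. a \<in> I \<Longrightarrow> z \<in> ball x0 r \<Longrightarrow> hol_at (U a) z"
      and EU: "\<And>a z. a \<in> I \<Longrightarrow> z \<in> ball x0 r \<Longrightarrow>
       (\<Sum>j\<in>UNIV. (z $ j - x0 $ j) * pdiff j (U a) z) = (\<Sum>j\<in>UNIV. (z $ j - x0 $ j) * (\<Sum>b\<in>I. A j a b z * U b z))"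
      using ray_solution[where A=A and ?u0.0=u0, OF I r(1) A' M' small] by blast
    \<comment> \<open>By integrability the residuals satisfy the same equation along rays as in \<open>ray_uniqueness\<close>.\<close>
    define R where "R j a z = pdiff j (U a) z - (\<Sum>b\<in>I. A j a b z * U b z)" for j a z
    have U1: "hol_at (pdiff j (U a)) z" if "a \<in> I" "z \<in> ball x0 r" for j a z
      by (rule hol_at_pdiff[OF open_ball U]) (use that in auto)
    have R: "hol_at (R j a) z" if "a \<in> I" "z \<in> ball x0 r" for j a z
      unfolding R_def[abs_def] using that U1 U A' by (auto intro!: hol_at_intros)
    have "R j a z + (\<Sum>k\<in>UNIV. (z $ k - x0 $ k) * pdiff k (R j a) z) = (\<Sum>k\<in>UNIV. (z $ k - x0 $ k) * (\<Sum>b\<in>I. A k a b z * R j b z))"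
      if a: "a \<in> I" and z: "z \<in> ball x0 r" for j a z
    proof -
      let ?h = "\<lambda>k. z $ k - x0 $ k"
      have pR: "pdiff k (R j a) z = pdiff j (pdiff k (U a)) z - (\<Sum>b\<in>I. pdiff k (A j a b) z * U b z) - (\<Sum>b\<in>I. A j a b z * pdiff k (U b) z)" for k
      proof -
        have "pdiff k (R j a) z = pdiff k (pdiff j (U a)) z - (\<Sum>b\<in>I. pdiff k (A j a b) z * U b z + A j a b z * pdiff k (U b) z)"
          unfolding R_def[abs_def] using a z U1 U A' by (simp add: pdiff_rules hol_at_intros)
        thus ?thesis using pdiff_commute[OF open_ball U[OF a] z] by (simp add: sum.distrib)
      qed
      \<comment> \<open>The radial equation differentiated in direction j; the derivative of z_j -
        x0_j releases the undifferentiated terms on both sides.\<close>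
      have E1: "pdiff j (U a) z + (\<Sum>k\<in>UNIV. ?h k * pdiff j (pdiff k (U a)) z)
         = (\<Sum>b\<in>I. A j a b z * U b z) + (\<Sum>k\<in>UNIV. ?h k * ((\<Sum>b\<in>I. pdiff j (A k a b) z * U b z) + (\<Sum>b\<in>I. A k a b z * pdiff j (U b) z)))"
      proof -
        have "pdiff j (\<lambda>z. \<Sum>k\<in>UNIV. (z $ k - x0 $ k) * pdiff k (U a) z) z
            = pdiff j (\<lambda>z. \<Sum>k\<in>UNIV. (z $ k - x0 $ k) * (\<Sum>b\<in>I. A k a b z * U b z)) z"
          by (rule pdiff_cong_open[OF open_ball z EU[OF a]])
        moreover have "pdiff j (\<lambda>z. \<Sum>k\<in>UNIV. (z $ k - x0 $ k) * pdiff k (U a) z) z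
            = pdiff j (U a) z + (\<Sum>k\<in>UNIV. ?h k * pdiff j (pdiff k (U a)) z)"
          using U1[OF a z] by (simp add: pdiff_rules hol_at_intros sum.distrib if_distrib[of "\<lambda>x. x * _"] cong: if_cong)
        moreover have "pdiff j (\<lambda>z. \<Sum>k\<in>UNIV. (z $ k - x0 $ k) * (\<Sum>b\<in>I. A k a b z * U b z)) z
            = (\<Sum>b\<in>I. A j a b z * U b z) + (\<Sum>k\<in>UNIV. ?h k * ((\<Sum>b\<in>I. pdiff j (A k a b) z * U b z) + (\<Sum>b\<in>I. A k a b z * pdiff j (U b) z)))"
          using a z U A' by (simp add: pdiff_rules hol_at_intros sum.distrib if_distrib[of "\<lambda>x. x * _"] cong: if_cong)
        ultimately show ?thesis by simp
      qed
      have int: "(\<Sum>b\<in>I. pdiff k (A j a b) z * U b z) + (\<Sum>b\<in>I. A j a b z * (\<Sum>c\<in>I. A k b c z * U c z))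
          = (\<Sum>b\<in>I. pdiff j (A k a b) z * U b z) + (\<Sum>b\<in>I. A k a b z * (\<Sum>c\<in>I. A j b c z * U c z))" for k
      proof -
        \<comment> \<open>An admissible test function: the affine function with value U(z) whose
          gradient is dictated by the system at z. \<open>U\<close> itself is so far known to solve
          only the radial equation.\<close>
        define u where "u b y = U b z + (\<Sum>k\<in>UNIV. (y $ k - z $ k) * (\<Sum>c\<in>I. A k b c z * U c z))" for b y
        have u: "hol_at (u b) y" for b y unfolding u_def[abs_def] by (intro hol_at_intros hol_at_coord hol_at_const)
        have uz: "u b z = U b z" for b by (simp add: u_def)
        have du: "pdiff k (u b) z = (\<Sum>c\<in>I. A k b c z * U c z)" for b k
          unfolding u_def[abs_def] by (simp add: pdiff_rules hol_at_intros if_distrib[of "\<lambda>x. x * _"] cong: if_cong)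
        have "pdiff k (\<lambda>y. \<Sum>b\<in>I. A j a b y * u b y) z = pdiff j (\<lambda>y. \<Sum>b\<in>I. A k a b y * u b y) z"
          by (rule integrable) (use sub a z u du uz in auto)
        moreover have "pdiff k (\<lambda>y. \<Sum>b\<in>I. A j a b y * u b y) z
            = (\<Sum>b\<in>I. pdiff k (A j a b) z * U b z) + (\<Sum>b\<in>I. A j a b z * (\<Sum>c\<in>I. A k b c z * U c z))" for j k
          using a z A' u by (simp add: pdiff_rules hol_at_intros sum.distrib uz du)
        ultimately show ?thesis by simp
      qed
      \<comment> \<open>Single derivatives of \<open>U\<close> cannot be replaced yet, only their
        radial combination; hence the sum over k is moved inside first.\<close>
      have swap: "(\<Sum>k\<in>UNIV. ?h k * (\<Sum>b\<in>I. A j a b z * pdiff k (U b) z))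
          = (\<Sum>k\<in>UNIV. ?h k * (\<Sum>b\<in>I. A j a b z * (\<Sum>c\<in>I. A k b c z * U c z)))"
      proof -
        have "(\<Sum>k\<in>UNIV. ?h k * (\<Sum>b\<in>I. A j a b z * V k b)) = (\<Sum>b\<in>I. A j a b z * (\<Sum>k\<in>UNIV. ?h k * V k b))" for V
          unfolding sum_distrib_left by (subst sum.swap) (simp add: mult.left_commute)
        thus ?thesis using EU z by simp
      qed
      have "R j a z + (\<Sum>k\<in>UNIV. ?h k * pdiff k (R j a) z)
         = (pdiff j (U a) z + (\<Sum>k\<in>UNIV. ?h k * pdiff j (pdiff k (U a)) z)) - (\<Sum>b\<in>I. A j a b z * U b z)
           - (\<Sum>k\<in>UNIV. ?h k * (\<Sum>b\<in>I. pdiff k (A j a b) z * U b z)) - (\<Sum>k\<in>UNIV. ?h k * (\<Sum>b\<in>I. A j a b z * pdiff k (U b) z))"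
        unfolding pR by (simp add: R_def right_diff_distrib sum_subtractf)
      also have "\<dots> = (\<Sum>k\<in>UNIV. ?h k * ((\<Sum>b\<in>I. pdiff j (A k a b) z * U b z) + (\<Sum>b\<in>I. A k a b z * pdiff j (U b) z)
           - (\<Sum>b\<in>I. pdiff k (A j a b) z * U b z) - (\<Sum>b\<in>I. A j a b z * (\<Sum>c\<in>I. A k b c z * U c z))))"
        unfolding E1 swap by (simp add: right_diff_distrib sum_subtractf)
      also have "\<dots> = (\<Sum>k\<in>UNIV. ?h k * (\<Sum>b\<in>I. A k a b z * R j b z))"
      proof (intro sum.cong refl arg_cong[where f="\<lambda>w. _ * w"])
        fix k
        have "(\<Sum>b\<in>I. A k a b z * R j b z) = (\<Sum>b\<in>I. A k a b z * pdiff j (U b) z) - (\<Sum>b\<in>I. A k a b z * (\<Sum>c\<in>I. A j b c z * U c z))"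
          by (simp add: R_def right_diff_distrib sum_subtractf)
        thus "(\<Sum>b\<in>I. pdiff j (A k a b) z * U b z) + (\<Sum>b\<in>I. A k a b z * pdiff j (U b) z)
           - (\<Sum>b\<in>I. pdiff k (A j a b) z * U b z) - (\<Sum>b\<in>I. A j a b z * (\<Sum>c\<in>I. A k b c z * U c z))
           = (\<Sum>b\<in>I. A k a b z * R j b z)"
          using int[of k] by (simp add: algebra_simps)
      qed
      finally show ?thesis .
    qed
    from ray_uniqueness[where A=A, OF I r(1) A' M' small R this]
    have "R j a z = 0" if "a \<in> I" "z \<in> ball x0 r" for j a z using that by blast
    thus "\<exists>U. \<forall>a\<in>I. U a x0 = u0 a \<and>
       (\<forall>z\<in>ball x0 r. hol_at (U a) z \<and> (\<forall>j. pdiff j (U a) z = (\<Sum>b\<in>I. A j a b z * U b z)))"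
      using U0 U by (intro exI[of _ U]) (auto simp: R_def)
  qed
qed

section \<open>Polynomials in the Euler operator\<close>

lemma holomorphic_sevD: "holomorphic_sev S f \<Longrightarrow> z \<in> S \<Longrightarrow> hol_at f z"
  by (simp add: holomorphic_sev_iff)

lemma holomorphic_sevI: "(\<And>z. z \<in> S \<Longrightarrow> hol_at f z) \<Longrightarrow> holomorphic_sev S f"
  by (simp add: holomorphic_sev_iff)

context
  fixes S :: "(complex^'n::finite) set"
  assumes S: "open S"
begin

lemma euler_cong: "z \<in> S \<Longrightarrow> (\<And>z. z \<in> S \<Longrightarrow> f z = g z) \<Longrightarrow> euler i f z = euler i g z"
  unfolding euler_def using pdiff_cong_open[OF S, of z f g i] by simp

lemma teuler_cong: "z \<in> S \<Longrightarrow> (\<And>z. z \<in> S \<Longrightarrow> f z = g z) \<Longrightarrow> teuler f z = teuler g z"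
  unfolding teuler_def using euler_cong[of z f g] by simp

lemma holomorphic_sev_pdiff: "holomorphic_sev S f \<Longrightarrow> holomorphic_sev S (pdiff i f)"
  using hol_at_pdiff[OF S] by (auto simp: holomorphic_sev_iff)

lemma holomorphic_sev_const: "holomorphic_sev S (\<lambda>z. c)"
  by (simp add: holomorphic_sev_iff)

text \<open>The shape \<open>c * f + g\<close> gives sums for c = 1 and differences for c = -1, and
  it is the recursion step of \<open>teuler_prod\<close>.\<close>

lemma holomorphic_sev_lincomb:
  "holomorphic_sev S f \<Longrightarrow> holomorphic_sev S g \<Longrightarrow> holomorphic_sev S (\<lambda>z. c * f z + g z)"
  by (simp add: holomorphic_sev_iff hol_at_intros)

lemma holomorphic_sev_euler: "holomorphic_sev S f \<Longrightarrow> holomorphic_sev S (euler i f)"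
  unfolding euler_def[abs_def] using holomorphic_sev_pdiff[of f i]
  by (simp add: holomorphic_sev_iff hol_at_intros)

lemma holomorphic_sev_teuler: "holomorphic_sev S f \<Longrightarrow> holomorphic_sev S (teuler f)"
  unfolding teuler_def[abs_def] using holomorphic_sev_euler[of f]
  by (simp add: holomorphic_sev_iff hol_at_intros)

lemma holomorphic_sev_teuler_prod: "holomorphic_sev S f \<Longrightarrow> holomorphic_sev S (teuler_prod a k f)"
  by (induction k) (auto intro: holomorphic_sev_lincomb holomorphic_sev_teuler)

lemma holomorphic_sev_teuler_pow: "holomorphic_sev S f \<Longrightarrow> holomorphic_sev S ((teuler ^^ k) f)"
  by (induction k) (auto intro: holomorphic_sev_teuler)

lemma holomorphic_sev_teuler_poly: "holomorphic_sev S f \<Longrightarrow> holomorphic_sev S (teuler_poly p f)"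
  unfolding teuler_poly_def[abs_def] using holomorphic_sev_teuler_pow[of f]
  by (simp add: holomorphic_sev_iff hol_at_intros)

lemma pdiff_lincomb:
  "holomorphic_sev S f \<Longrightarrow> holomorphic_sev S g \<Longrightarrow> z \<in> S \<Longrightarrow>
   pdiff i (\<lambda>z. c * f z + g z) z = c * pdiff i f z + pdiff i g z"
  by (simp add: holomorphic_sev_iff pdiff_rules hol_at_intros)

lemma euler_lincomb:
  "holomorphic_sev S f \<Longrightarrow> holomorphic_sev S g \<Longrightarrow> z \<in> S \<Longrightarrow>
   euler i (\<lambda>z. c * f z + g z) z = c * euler i f z + euler i g z"
  by (simp add: euler_def pdiff_lincomb distrib_left mult.left_commute)

lemma teuler_lincomb:
  "holomorphic_sev S f \<Longrightarrow> holomorphic_sev S g \<Longrightarrow> z \<in> S \<Longrightarrow>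
   teuler (\<lambda>z. c * f z + g z) z = c * teuler f z + teuler g z"
  by (simp add: teuler_def euler_lincomb sum.distrib sum_distrib_left)

lemma teuler_mult_coord:
  "hol_at f z \<Longrightarrow> teuler (\<lambda>z. z $ i * f z) z = z $ i * f z + z $ i * teuler f z"
  by (simp add: teuler_def euler_def pdiff_rules hol_at_intros distrib_left sum.distrib sum_distrib_left mult.left_commute
      if_distrib[of "\<lambda>x. x * _"] if_distrib[of "\<lambda>x. _ * x"] cong: if_cong)

text \<open>The commutator of d_i and D is d_i, because d_i x_i = x_i d_i + 1 and mixed derivatives
  commute.\<close>

lemma pdiff_teuler:
  assumes "holomorphic_sev S f" "z \<in> S"
  shows "pdiff i (teuler f) z = teuler (pdiff i f) z + pdiff i f z"
proof -
  have "pdiff i (teuler f) z = (\<Sum>k\<in>UNIV. (if i = k then 1 else 0) * pdiff k f z + z $ k * pdiff i (pdiff k f) z)"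
    unfolding teuler_def[abs_def] euler_def[abs_def]
    using holomorphic_sevD[OF holomorphic_sev_pdiff[OF assms(1)] assms(2)] by (simp add: pdiff_rules hol_at_intros)
  also have "\<dots> = pdiff i f z + teuler (pdiff i f) z"
    using pdiff_commute[OF S holomorphic_sevD[OF assms(1)] assms(2), of i]
    by (simp add: sum.distrib teuler_def euler_def if_distrib[of "\<lambda>x. x * _"] cong: if_cong)
  finally show ?thesis by simp
qed

lemma euler_teuler:
  assumes "holomorphic_sev S f" "z \<in> S"
  shows "euler i (teuler f) z = teuler (euler i f) z"
  using teuler_mult_coord[OF holomorphic_sevD[OF holomorphic_sev_pdiff[OF assms(1), of i] assms(2)], of i] pdiff_teuler[OF assms]
  by (simp add: euler_def[abs_def] algebra_simps)

lemma teuler_prod_cong: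
  assumes "\<And>z. z \<in> S \<Longrightarrow> f z = g z" "z \<in> S"
  shows "teuler_prod a k f z = teuler_prod a k g z"
  using assms(2)
proof (induction k arbitrary: z)
  case (Suc k)
  thus ?case using teuler_cong[of z "teuler_prod a k f" "teuler_prod a k g"] by simp
qed (use assms in simp)

text \<open>E D = (D + s) E implies E (a + D) = (a + s + D) E, so every factor is shifted by s. It
  is applied with s = 1 to d_i and to the Euler--Darboux operator, and with s = 0 to operators that
  commute with D.\<close>

lemma teuler_prod_commute:
  fixes E :: "(complex^'n \<Rightarrow> complex) \<Rightarrow> complex^'n \<Rightarrow> complex"
  assumes lin: "\<And>f g c z. holomorphic_sev S f \<Longrightarrow> holomorphic_sev S g \<Longrightarrow> z \<in> S \<Longrightarrow> E (\<lambda>z. c * f z + g z) z = c * E f z + E g z"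
    and comm: "\<And>f z. holomorphic_sev S f \<Longrightarrow> z \<in> S \<Longrightarrow> E (teuler f) z = teuler (E f) z + s * E f z"
    and f: "holomorphic_sev S f" and "z \<in> S"
  shows "E (teuler_prod a k f) z = teuler_prod (\<lambda>n. a n + s) k (E f) z"
  using \<open>z \<in> S\<close>
proof (induction k arbitrary: z)
  case (Suc k)
  let ?g = "teuler_prod a k f"
  have g: "holomorphic_sev S ?g" by (rule holomorphic_sev_teuler_prod[OF f])
  have "E (teuler_prod a (Suc k) f) z = a (Suc k) * E ?g z + (teuler (E ?g) z + s * E ?g z)"
    using lin[OF g holomorphic_sev_teuler[OF g] Suc.prems] comm[OF g Suc.prems] by simp
  also have "teuler (E ?g) z = teuler (teuler_prod (\<lambda>n. a n + s) k (E f)) z"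
    by (rule teuler_cong[OF Suc.prems Suc.IH])
  finally show ?case using Suc by (simp add: algebra_simps)
qed simp

lemma pdiff_teuler_prod:
  assumes "holomorphic_sev S f" "z \<in> S"
  shows "pdiff i (teuler_prod a k f) z = teuler_prod (\<lambda>n. a n + 1) k (pdiff i f) z"
  by (rule teuler_prod_commute[where E="pdiff i"]) (use assms in \<open>auto simp: pdiff_lincomb pdiff_teuler\<close>)

lemma euler_teuler_prod:
  assumes "holomorphic_sev S f" "z \<in> S"
  shows "b * teuler_prod a k f z + euler i (teuler_prod a k f) z = teuler_prod a k (\<lambda>z. b * f z + euler i f z) z"
proof -
  have "(\<lambda>f z. b * f z + euler i f z) (teuler_prod a k f) z = teuler_prod (\<lambda>n. a n + 0) k ((\<lambda>f z. b * f z + euler i f z) f) z"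
    by (rule teuler_prod_commute[where E="\<lambda>f z. b * f z + euler i f z"])
       (use assms in \<open>auto simp: euler_lincomb teuler_lincomb euler_teuler holomorphic_sev_euler distrib_left mult.left_commute\<close>)
  thus ?thesis by simp
qed

end

section \<open>The polynomial ring acting through D\<close>

lemma teuler_poly_extend:
  assumes "degree p \<le> N"
  shows "teuler_poly p f x = (\<Sum>k\<le>N. coeff p k * (teuler ^^ k) f x)"
  unfolding teuler_poly_def using assms by (intro sum.mono_neutral_left) (auto simp: coeff_eq_0 not_le)

lemma teuler_poly_0 [simp]: "teuler_poly 0 f x = 0"
  and teuler_poly_1 [simp]: "teuler_poly 1 f x = f x"
  by (simp_all add: teuler_poly_def)

lemma teuler_poly_add: "teuler_poly (p + q) f x = teuler_poly p f x + teuler_poly q f x"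
  by (simp add: teuler_poly_extend[of _ "max (degree p) (degree q)"] degree_add_le_max sum.distrib algebra_simps)

lemma teuler_poly_smult: "teuler_poly (smult c p) f x = c * teuler_poly p f x"
  by (simp add: teuler_poly_extend[of _ "degree p"] sum_distrib_left mult_ac)

text \<open>The remaining polynomial acts on \<open>teuler f\<close> from outside, so no linearity
  of \<open>teuler\<close> is involved and the identity holds for every function; inductions over
  the polynomial therefore generalise over \<open>f\<close>.\<close>

lemma teuler_poly_pCons: "teuler_poly (pCons c p) f x = c * f x + teuler_poly p (teuler f) x"
  unfolding teuler_poly_extend[of "pCons c p" "Suc (degree p)", OF degree_pCons_le] sum.atMost_Suc_shift
  by (simp add: teuler_poly_def funpow_Suc_right del: funpow.simps(2))

context
  fixes S :: "(complex^'n::finite) set"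
  assumes S: "open S"
begin

lemma teuler_pow_cong:
  assumes "\<And>z. z \<in> S \<Longrightarrow> f z = g z" "z \<in> S"
  shows "(teuler ^^ k) f z = (teuler ^^ k) g z"
  using assms(2) by (induction k arbitrary: z) (auto intro: teuler_cong[OF S] assms)

lemma teuler_poly_cong:
  assumes "\<And>z. z \<in> S \<Longrightarrow> f z = g z" "z \<in> S"
  shows "teuler_poly p f z = teuler_poly p g z"
  unfolding teuler_poly_def using teuler_pow_cong[OF assms] by simp

lemma teuler_pow_lincomb:
  assumes "holomorphic_sev S f" "holomorphic_sev S g" "z \<in> S"
  shows "(teuler ^^ k) (\<lambda>z. c * f z + g z) z = c * (teuler ^^ k) f z + (teuler ^^ k) g z"
  using assms(3)
proof (induction k arbitrary: z)
  case (Suc k)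
  have "teuler ((teuler ^^ k) (\<lambda>z. c * f z + g z)) z = teuler (\<lambda>z. c * (teuler ^^ k) f z + (teuler ^^ k) g z) z"
    by (rule teuler_cong[OF S Suc.prems Suc.IH])
  thus ?case using Suc.prems
    by (simp add: teuler_lincomb[OF S] holomorphic_sev_teuler_pow[OF S] assms)
qed simp

lemma teuler_poly_lincomb:
  assumes "holomorphic_sev S f" "holomorphic_sev S g" "z \<in> S"
  shows "teuler_poly p (\<lambda>z. c * f z + g z) z = c * teuler_poly p f z + teuler_poly p g z"
  by (simp add: teuler_poly_def teuler_pow_lincomb[OF assms] sum.distrib sum_distrib_left distrib_left mult.left_commute)

lemma teuler_poly_zero: 
  assumes "\<And>z. z \<in> S \<Longrightarrow> f z = 0" "z \<in> S"
  shows "teuler_poly p f z = 0"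
  \<comment> \<open>After replacing \<open>f\<close> by the literal zero function, linearity with c
    = 1 reads X = X + X.\<close>
  using teuler_poly_cong[of f "\<lambda>z. 0 * 0 + 0" z p] teuler_poly_lincomb[of "\<lambda>_. 0" "\<lambda>_. 0" z p 1] assms
  by (simp add: holomorphic_sev_const[OF S])

lemma teuler_teuler_poly:
  assumes "holomorphic_sev S f" "z \<in> S"
  shows "teuler (teuler_poly p f) z = teuler_poly p (teuler f) z"
  using assms
proof (induction p arbitrary: f z)
  case 0
  thus ?case by (simp add: teuler_def euler_def teuler_poly_0[abs_def])
next
  case (pCons c p)
  have "teuler (teuler_poly (pCons c p) f) z = teuler (\<lambda>z. c * f z + teuler_poly p (teuler f) z) z"
    by (simp add: teuler_poly_pCons[abs_def])
  also have "\<dots> = c * teuler f z + teuler (teuler_poly p (teuler f)) z"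
    by (rule teuler_lincomb[OF S]) (use pCons.prems in \<open>auto intro!: holomorphic_sev_teuler[OF S] holomorphic_sev_teuler_poly[OF S]\<close>)
  also have "teuler (teuler_poly p (teuler f)) z = teuler_poly p (teuler (teuler f)) z"
    by (rule pCons.IH) (use pCons.prems in \<open>auto intro!: holomorphic_sev_teuler[OF S]\<close>)
  finally show ?case by (simp add: teuler_poly_pCons)
qed

lemma teuler_poly_mult:
  assumes "holomorphic_sev S f" "z \<in> S"
  shows "teuler_poly (p * q) f z = teuler_poly p (teuler_poly q f) z"
  using assms
proof (induction p arbitrary: f z)
  case (pCons c p)
  have "teuler_poly (pCons c p * q) f z = c * teuler_poly q f z + teuler_poly (p * q) (teuler f) z"
    by (simp add: teuler_poly_add teuler_poly_smult teuler_poly_pCons)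
  also have "teuler_poly (p * q) (teuler f) z = teuler_poly p (teuler_poly q (teuler f)) z"
    by (rule pCons.IH) (use pCons.prems in \<open>auto intro!: holomorphic_sev_teuler[OF S]\<close>)
  also have "\<dots> = teuler_poly p (teuler (teuler_poly q f)) z"
    by (rule teuler_poly_cong) (use pCons.prems teuler_teuler_poly in auto)
  finally show ?case by (simp add: teuler_poly_pCons)
qed simp

lemma teuler_prod_eq_poly:
  assumes "holomorphic_sev S f" "z \<in> S"
  shows "teuler_prod a k f z = teuler_poly (\<Prod>m\<in>{1..k}. [:a m, 1:]) f z"
  using assms(2)
proof (induction k arbitrary: z)
  case (Suc k)
  let ?p = "\<Prod>m\<in>{1..k}. [:a m, 1:]"
  have "teuler_prod a (Suc k) f z = a (Suc k) * teuler_poly ?p f z + teuler (teuler_poly ?p f) z"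
    using Suc teuler_cong[OF S Suc.prems Suc.IH] by simp
  also have "\<dots> = teuler_poly [:a (Suc k), 1:] (teuler_poly ?p f) z"
    by (simp add: teuler_poly_pCons)
  also have "\<dots> = teuler_poly ([:a (Suc k), 1:] * ?p) f z"
    by (rule teuler_poly_mult[symmetric]) (use assms Suc.prems in auto)
  also have "[:a (Suc k), 1:] * ?p = (\<Prod>m\<in>{1..Suc k}. [:a m, 1:])"
    by (simp only: prod.nat_ivl_Suc'[of 1 k] le_add1 plus_1_eq_Suc)
  finally show ?case .
qed simp

text \<open>The Bezout identity, applied to \<open>f\<close> as an identity of operators, writes
  \<open>f\<close> as a sum of two vanishing terms.\<close>

lemma teuler_poly_comaximal:
  assumes "holomorphic_sev S f" "r * p + s * q = 1"
    and "\<And>z. z \<in> S \<Longrightarrow> teuler_poly p f z = 0" "\<And>z. z \<in> S \<Longrightarrow> teuler_poly q f z = 0" "z \<in> S"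
  shows "f z = 0"
proof -
  have "f z = teuler_poly (r * p + s * q) f z" using assms by simp
  also have "\<dots> = teuler_poly r (teuler_poly p f) z + teuler_poly s (teuler_poly q f) z"
    by (simp add: teuler_poly_add teuler_poly_mult[OF assms(1,5)])
  also have "\<dots> = 0" using assms by (simp add: teuler_poly_zero)
  finally show ?thesis .
qed

end

text \<open>The Bezout identity itself is the notion wanted, because its cofactors are going to be
  applied as differential operators.\<close>

definition comaximal :: "'a::comm_ring_1 \<Rightarrow> 'a \<Rightarrow> bool" where
  "comaximal p q \<longleftrightarrow> (\<exists>r s. r * p + s * q = 1)"

lemma comaximalE:
  assumes "comaximal p q"
  obtains r s where "r * p + s * q = 1"
  using assms unfolding comaximal_def by blast

lemma comaximal_1: "comaximal 1 q" 
  unfolding comaximal_def by (rule exI[of _ 1], rule exI[of _ 0]) simp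

lemma comaximal_sym: "comaximal p q \<Longrightarrow> comaximal q p"
  unfolding comaximal_def by (metis add.commute)

text \<open>Multiply the two Bezout identities and collect the multiples of
  \<open>q\<close>.\<close>

lemma comaximal_mult:
  assumes "comaximal p q" "comaximal p' q"
  shows "comaximal (p * p') q"
proof -
  obtain r s r' s' where e: "r * p + s * q = 1" "r' * p' + s' * q = 1" using assms unfolding comaximal_def by auto
  have "(r * r') * (p * p') + (r * p * s' + s * (r' * p' + s' * q)) * q = (r * p + s * q) * (r' * p' + s' * q)"
    by (simp add: algebra_simps)
  thus ?thesis unfolding comaximal_def e by (metis mult_1)
qed

lemma comaximal_prod: "(\<And>i. i \<in> A \<Longrightarrow> comaximal (f i) q) \<Longrightarrow> comaximal (prod f A) q"
  by (induction A rule: infinite_finite_induct) (auto intro: comaximal_1 comaximal_mult)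

lemma comaximal_linear:
  assumes "a \<noteq> b"
  shows "comaximal [:a, 1:] [:b, 1 :: complex:]"
proof -
  have "[:1 / (a - b):] * [:a, 1:] + [:- 1 / (a - b):] * [:b, 1:] = 1"
    using assms by (simp add: one_pCons diff_divide_distrib[symmetric])
  thus ?thesis unfolding comaximal_def by blast
qed

lemma comaximal_prod_linear:
  assumes "\<And>i j. i \<in> A \<Longrightarrow> j \<in> B \<Longrightarrow> a i \<noteq> (b j :: complex)"
  shows "comaximal (\<Prod>i\<in>A. [:a i, 1:]) (\<Prod>j\<in>B. [:b j, 1:])"
  using assms by (intro comaximal_prod comaximal_sym[OF comaximal_prod] comaximal_sym[OF comaximal_linear]) metis

section \<open>The Euler--Darboux equations\<close>

text \<open>For \<open>F\<^sub>i = \<partial>y/\<partial>x\<^sub>i\<close> this is the Euler--Darboux system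
  \<open>(x\<^sub>j - x\<^sub>i) \<partial>\<^sub>i\<partial>\<^sub>j y = \<beta>\<^sub>i \<partial>\<^sub>j y - \<beta>\<^sub>j \<partial>\<^sub>i y\<close>.\<close>

definition transversal :: "(complex^'n) set \<Rightarrow> ('n \<Rightarrow> complex) \<Rightarrow> ('n \<Rightarrow> complex^'n \<Rightarrow> complex) \<Rightarrow> bool" where
  "transversal S \<beta> F \<longleftrightarrow> (\<forall>z\<in>S. \<forall>i j. i \<noteq> j \<longrightarrow>
     (z $ j - z $ i) * pdiff j (F i) z = \<beta> i * F j z - \<beta> j * F i z)"

context
  fixes S :: "(complex^'n::finite) set" and \<beta> :: "'n \<Rightarrow> complex"
  assumes S: "open S"
begin

lemma transversal_lincomb:
  assumes "transversal S \<beta> F" "transversal S \<beta> G" "\<And>i. holomorphic_sev S (F i)" "\<And>i. holomorphic_sev S (G i)"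
  shows "transversal S \<beta> (\<lambda>i z. c * F i z + G i z)"
  unfolding transversal_def
proof (intro ballI allI impI)
  fix z i j assume z: "z \<in> S" and "i \<noteq> (j :: 'n)"
  with assms(1,2) have "(z $ j - z $ i) * pdiff j (F i) z = \<beta> i * F j z - \<beta> j * F i z"
    "(z $ j - z $ i) * pdiff j (G i) z = \<beta> i * G j z - \<beta> j * G i z" by (auto simp: transversal_def)
  thus "(z $ j - z $ i) * pdiff j (\<lambda>z. c * F i z + G i z) z = \<beta> i * (c * F j z + G j z) - \<beta> j * (c * F i z + G i z)"
    unfolding pdiff_lincomb[OF S assms(3,4) z] by algebra
qed

text \<open>Moving D past the factor z_j - z_i, homogeneous of degree 1, and past d_j, of degree -1,
  produces two corrections that cancel.\<close>

lemma transversal_teuler: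
  assumes F: "transversal S \<beta> F" and hol: "\<And>i. holomorphic_sev S (F i)"
  shows "transversal S \<beta> (\<lambda>i. teuler (F i))"
  unfolding transversal_def
proof (intro ballI allI impI)
  fix z i j assume z: "z \<in> S" and ij: "i \<noteq> (j :: 'n)"
  note h = hol[THEN holomorphic_sevD, OF z] hol[of i, THEN holomorphic_sev_pdiff[OF S, of _ j], THEN holomorphic_sevD, OF z]
  have tc: "teuler (\<lambda>z. (z $ j - z $ i) * f z) z = (z $ j - z $ i) * f z + (z $ j - z $ i) * teuler f z" if "hol_at f z" for f
  proof -
    have "teuler (\<lambda>z. (z $ j - z $ i) * f z) z = teuler (\<lambda>z. z $ j * f z) z - teuler (\<lambda>z. z $ i * f z) z"
      using that by (simp add: teuler_def euler_def pdiff_rules hol_at_intros sum_subtractf[symmetric] algebra_simps)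
    thus ?thesis unfolding teuler_mult_coord[OF S that] by algebra
  qed
  have "teuler (\<lambda>z. (z $ j - z $ i) * pdiff j (F i) z) z = teuler (\<lambda>z. \<beta> i * F j z - \<beta> j * F i z) z"
    by (rule teuler_cong[OF S z]) (use F ij in \<open>auto simp: transversal_def\<close>)
  also have "\<dots> = \<beta> i * teuler (F j) z - \<beta> j * teuler (F i) z"
    using h(1) by (simp add: teuler_def euler_def pdiff_rules hol_at_intros sum_subtractf sum_distrib_left algebra_simps)
  finally show "(z $ j - z $ i) * pdiff j (teuler (F i)) z = \<beta> i * teuler (F j) z - \<beta> j * teuler (F i) z"
    unfolding tc[OF h(2)] pdiff_teuler[OF S hol z] by (simp add: algebra_simps)
qed

lemma transversal_teuler_poly:
  assumes "transversal S \<beta> F" "\<And>i. holomorphic_sev S (F i)"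
  shows "transversal S \<beta> (\<lambda>i. teuler_poly p (F i))"
  using assms
proof (induction p arbitrary: F)
  case 0
  show ?case by (simp add: transversal_def teuler_poly_0[abs_def])
next
  case (pCons c p)
  have "transversal S \<beta> (\<lambda>i z. c * F i z + teuler_poly p (teuler (F i)) z)"
    using pCons.prems holomorphic_sev_teuler[OF S] holomorphic_sev_teuler_poly[OF S]
    by (intro transversal_lincomb pCons.IH transversal_teuler) auto
  thus ?case by (simp add: teuler_poly_pCons[abs_def])
qed

text \<open>For i and j distinct, d_j(\<beta>_i y + x_i d_i y) = \<beta>_i d_j y + x_i d_j d_i y,
  and the Euler--Darboux equation for y eliminates the second derivative.\<close>

lemma transversal_euler:
  assumes y: "holomorphic_sev S y" and t: "transversal S \<beta> (\<lambda>i. pdiff i y)"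
  shows "transversal S \<beta> (\<lambda>i z. \<beta> i * y z + euler i y z)"
  unfolding transversal_def
proof (intro ballI allI impI)
  fix z i j assume z: "z \<in> S" and ij: "i \<noteq> (j :: 'n)"
  have "pdiff j (\<lambda>z. \<beta> i * y z + euler i y z) z = \<beta> i * pdiff j y z + z $ i * pdiff j (pdiff i y) z"
    unfolding euler_def[abs_def]
    using holomorphic_sevD[OF y z] holomorphic_sevD[OF holomorphic_sev_pdiff[OF S y] z] ij by (simp add: pdiff_rules hol_at_intros)
  moreover have "(z $ j - z $ i) * pdiff j (pdiff i y) z = \<beta> i * pdiff j y z - \<beta> j * pdiff i y z"
    using t z ij by (simp add: transversal_def)
  ultimately show "(z $ j - z $ i) * pdiff j (\<lambda>z. \<beta> i * y z + euler i y z) z =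
      \<beta> i * (\<beta> j * y z + euler j y z) - \<beta> j * (\<beta> i * y z + euler i y z)"
    unfolding euler_def by algebra
qed

text \<open>Moving d_i through the product raises each \<gamma>_k - 1 to \<gamma>_k; the common
  factor x_i can then be divided out, as it is nonzero at regular points.\<close>

lemma hg_solution_iff:
  assumes reg: "S \<subseteq> regular_points"
  shows "hg_solution L \<alpha> \<beta> \<gamma> S y \<longleftrightarrow> holomorphic_sev S y \<and>
    (\<forall>z\<in>S. \<forall>i. teuler_prod \<alpha> (L-1) (\<lambda>z. \<beta> i * y z + euler i y z) z = teuler_prod \<gamma> (L-1) (pdiff i y) z)"
proof -
  have "(z $ i * (\<beta> i * teuler_prod \<alpha> (L-1) y z + euler i (teuler_prod \<alpha> (L-1) y) z)
        - euler i (teuler_prod (\<lambda>k. \<gamma> k - 1) (L-1) y) z = 0) \<longleftrightarrow>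
    teuler_prod \<alpha> (L-1) (\<lambda>z. \<beta> i * y z + euler i y z) z = teuler_prod \<gamma> (L-1) (pdiff i y) z"
    if "holomorphic_sev S y" "z \<in> S" for z i
  proof -
    have "z $ i \<noteq> 0" using that reg by (auto simp: regular_points_def)
    moreover have "euler i (teuler_prod (\<lambda>k. \<gamma> k - 1) (L-1) y) z = z $ i * teuler_prod \<gamma> (L-1) (pdiff i y) z"
      using pdiff_teuler_prod[OF S that, of i "\<lambda>k. \<gamma> k - 1"] by (simp add: euler_def)
    ultimately show ?thesis unfolding euler_teuler_prod[OF S that] by (simp add: right_diff_distrib[symmetric])
  qed
  thus ?thesis unfolding hg_solution_def by auto
qed

text \<open>The Euler--Darboux operator \<open>E\<close> satisfies \<open>E \<D> = (\<D> + 1) E\<close>. Cross-differentiating (HG) shows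
  that \<open>E\<close> annihilates \<open>f = \<Prod>(\<alpha>\<^sub>k + \<D>) y\<close> and \<open>g = \<Prod>(\<gamma>\<^sub>k - 1 + \<D>) y\<close>, so \<open>E y\<close> is annihilated by the
  two coprime operators \<open>\<Prod>(\<alpha>\<^sub>k + 1 + \<D>)\<close> and \<open>\<Prod>(\<gamma>\<^sub>k + \<D>)\<close>.\<close>

lemma hg_solution_transversal:
  assumes reg: "S \<subseteq> regular_points" and y: "hg_solution L \<alpha> \<beta> \<gamma> S y"
    and ne: "CARD('n) \<ge> 2 \<Longrightarrow> \<forall>m\<in>{1..L-1}. \<forall>k\<in>{1..L-1}. \<alpha> m \<noteq> \<gamma> k - 1"
  shows "transversal S \<beta> (\<lambda>i. pdiff i y)"
  unfolding transversal_def
proof (intro ballI allI impI)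
  fix z0 i j assume z0: "z0 \<in> S" and ij: "i \<noteq> (j :: 'n)"
  \<comment> \<open>Two distinct indices force N \<ge> 2, which releases the parameter condition;
    for N = 1 the claim is vacuous.\<close>
  have "card {i, j} \<le> CARD('n)" by (rule card_mono) auto
  with ij ne have ne: "\<And>m k. m \<in> {1..L-1} \<Longrightarrow> k \<in> {1..L-1} \<Longrightarrow> \<alpha> m + 1 \<noteq> \<gamma> k" by (auto simp: eq_diff_eq)
  define E where "E f z = (z $ j - z $ i) * pdiff j (pdiff i f) z - \<beta> i * pdiff j f z + \<beta> j * pdiff i f z" for f :: "complex^'n \<Rightarrow> complex" and z
  have hy: "holomorphic_sev S y" using y by (simp add: hg_solution_def)
  note d1 = holomorphic_sevD[OF holomorphic_sev_pdiff[OF S]]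
  note d2 = holomorphic_sevD[OF holomorphic_sev_pdiff[OF S holomorphic_sev_pdiff[OF S]]]
  have E_lin: "E (\<lambda>z. c * f z + g z) z = c * E f z + E g z"
    if f: "holomorphic_sev S f" and g: "holomorphic_sev S g" and z: "z \<in> S" for f g c z
  proof -
    have "pdiff j (pdiff i (\<lambda>z. c * f z + g z)) z = pdiff j (\<lambda>z. c * pdiff i f z + pdiff i g z) z"
      by (rule pdiff_cong_open[OF S z pdiff_lincomb[OF S f g]])
    also have "\<dots> = c * pdiff j (pdiff i f) z + pdiff j (pdiff i g) z"
      by (rule pdiff_lincomb[OF S _ _ z]) (use f g holomorphic_sev_pdiff[OF S] in auto)
    finally show ?thesis unfolding E_def pdiff_lincomb[OF S f g z] by algebra
  qed
  have E_comm: "E (teuler f) z = teuler (E f) z + 1 * E f z" if f: "holomorphic_sev S f" and z: "z \<in> S" for f z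
  proof -
    note f1 = holomorphic_sev_pdiff[OF S f]
    have "pdiff j (pdiff i (teuler f)) z = pdiff j (\<lambda>z. 1 * teuler (pdiff i f) z + pdiff i f z) z"
      by (rule pdiff_cong_open[OF S z]) (use pdiff_teuler[OF S f] in simp)
    also have "\<dots> = teuler (pdiff j (pdiff i f)) z + 2 * pdiff j (pdiff i f) z"
      using pdiff_lincomb[OF S holomorphic_sev_teuler[OF S f1] f1 z, of j 1] pdiff_teuler[OF S f1 z] by simp
    finally have 1: "pdiff j (pdiff i (teuler f)) z = teuler (pdiff j (pdiff i f)) z + 2 * pdiff j (pdiff i f) z" .
    have "teuler (E f) z = teuler (\<lambda>z. z $ j * pdiff j (pdiff i f) z) z - teuler (\<lambda>z. z $ i * pdiff j (pdiff i f) z) z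
        - \<beta> i * teuler (pdiff j f) z + \<beta> j * teuler (pdiff i f) z"
      unfolding E_def[abs_def] using d1[OF f z] d2[OF f z]
      by (simp add: teuler_def euler_def pdiff_rules hol_at_intros sum_subtractf sum.distrib sum_distrib_left algebra_simps)
    thus ?thesis unfolding E_def 1 pdiff_teuler[OF S f z] teuler_mult_coord[OF S d2[OF f z]] by (simp add: algebra_simps)
  qed
  have E_hol: "holomorphic_sev S (E f)" if "holomorphic_sev S f" for f
    unfolding E_def[abs_def] using d1[OF that] d2[OF that] by (auto intro!: holomorphic_sevI hol_at_intros)
  define f where "f = teuler_prod \<alpha> (L-1) y"
  define g where "g = teuler_prod (\<lambda>k. \<gamma> k - 1) (L-1) y"
  have hf: "holomorphic_sev S f" and hg: "holomorphic_sev S g"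
    unfolding f_def g_def by (intro holomorphic_sev_teuler_prod[OF S hy])+
  have fg: "pdiff k g z = \<beta> k * f z + z $ k * pdiff k f z" if "z \<in> S" for k z
  proof -
    have "z $ k \<noteq> 0" using that reg by (auto simp: regular_points_def)
    moreover have "z $ k * (\<beta> k * f z + euler k f z) - euler k g z = 0"
      using y that unfolding hg_solution_def f_def g_def by blast
    ultimately show ?thesis by (simp add: euler_def right_diff_distrib[symmetric])
  qed
  have fg2: "pdiff k (pdiff l g) z = \<beta> l * pdiff k f z + z $ l * pdiff k (pdiff l f) z" if "z \<in> S" "k \<noteq> l" for k l z
  proof -
    have "pdiff k (pdiff l g) z = pdiff k (\<lambda>z. \<beta> l * f z + z $ l * pdiff l f z) z"
      by (rule pdiff_cong_open[OF S that(1) fg])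
    thus ?thesis using that holomorphic_sevD[OF hf that(1)] d1[OF hf that(1)] by (simp add: pdiff_rules hol_at_intros)
  qed
  \<comment> \<open>The two values that (HG) assigns to the mixed second derivative of
    \<open>g\<close> differ by exactly \<open>E f z\<close>.\<close>
  have Ef: "E f z = 0" if z: "z \<in> S" for z
    using fg2[OF z, of i j] fg2[OF z, of j i] ij pdiff_commute[OF S holomorphic_sevD[OF hg] z, of i j]
      pdiff_commute[OF S holomorphic_sevD[OF hf] z, of i j]
    unfolding E_def by (simp add: algebra_simps)
  have Eg: "E g z = 0" if z: "z \<in> S" for z
  proof -
    \<comment> \<open>The two terms containing \<beta>_i \<beta>_j f cancel, and x_i factors out of
      the rest.\<close>
    have "E g z = z $ i * E f z"
      unfolding E_def fg[OF z] fg2[OF z ij[symmetric]] by algebra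
    thus ?thesis using Ef[OF z] by simp
  qed
  have "E y z0 = 0"
  proof -
    have "comaximal (\<Prod>m\<in>{1..L-1}. [:\<alpha> m + 1, 1:]) (\<Prod>m\<in>{1..L-1}. [:\<gamma> m, 1:])"
      by (rule comaximal_prod_linear) (rule ne)
    then obtain r s where rs: "r * (\<Prod>m\<in>{1..L-1}. [:\<alpha> m + 1, 1:]) + s * (\<Prod>m\<in>{1..L-1}. [:\<gamma> m, 1:]) = 1"
      by (rule comaximalE)
    have 1: "teuler_poly (\<Prod>m\<in>{1..L-1}. [:\<alpha> m + 1, 1:]) (E y) z = 0" if z: "z \<in> S" for z
    proof -
      have "E f z = teuler_prod (\<lambda>n. \<alpha> n + 1) (L-1) (E y) z"
        unfolding f_def by (rule teuler_prod_commute[where E=E and s=1, OF S E_lin E_comm hy z])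
      thus ?thesis using Ef[OF z] teuler_prod_eq_poly[OF S E_hol[OF hy] z, of "\<lambda>n. \<alpha> n + 1" "L-1"] by simp
    qed
    have 2: "teuler_poly (\<Prod>m\<in>{1..L-1}. [:\<gamma> m, 1:]) (E y) z = 0" if z: "z \<in> S" for z
    proof -
      have "E g z = teuler_prod (\<lambda>n. (\<gamma> n - 1) + 1) (L-1) (E y) z"
        unfolding g_def by (rule teuler_prod_commute[where E=E and s=1, OF S E_lin E_comm hy z])
      thus ?thesis using Eg[OF z] teuler_prod_eq_poly[OF S E_hol[OF hy] z, of \<gamma> "L-1"] by simp
    qed
    show ?thesis by (rule teuler_poly_comaximal[OF S E_hol[OF hy] rs 1 2 z0])
  qed
  thus "(z0 $ j - z0 $ i) * pdiff j (pdiff i y) z0 = \<beta> i * pdiff j y z0 - \<beta> j * pdiff i y z0"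
    unfolding E_def by algebra
qed

end

lemma prod_split_at: "n \<le> K \<Longrightarrow> prod f {1..n} * prod f {n+1..K} = prod f {1..K::nat}"
  by (subst prod.union_disjoint[symmetric]) (auto intro!: prod.cong)

text \<open>A chain from \<open>u\<close> to \<open>v\<close> has \<open>G\<^sub>n T\<^sub>n = a\<^sub>n u\<close> and \<open>A\<^sub>n T\<^sub>n = g\<^sub>n v\<close> with
  \<open>G\<^sub>n = \<Prod>\<^bsub>k\<le>n\<^esub>(\<gamma>\<^sub>k + \<D>)\<close>, \<open>A\<^sub>n = \<Prod>\<^bsub>m>n\<^esub>(\<alpha>\<^sub>m + \<D>)\<close>, \<open>a\<^sub>n = \<Prod>\<^bsub>k\<le>n\<^esub>(\<alpha>\<^sub>k + \<D>)\<close>, \<open>g\<^sub>n = \<Prod>\<^bsub>m>n\<^esub>(\<gamma>\<^sub>m + \<D>)\<close>.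
  A Bezout identity \<open>r\<^sub>n G\<^sub>n + s\<^sub>n A\<^sub>n = 1\<close> therefore forces \<open>T\<^sub>n = r\<^sub>n a\<^sub>n u + s\<^sub>n g\<^sub>n v\<close>.\<close>

lemma teuler_chain_polynomials:
  fixes \<alpha> \<gamma> :: "nat \<Rightarrow> complex"
  assumes ne: "\<And>m k. m \<in> {1..K} \<Longrightarrow> k \<in> {1..<m} \<Longrightarrow> \<alpha> m \<noteq> \<gamma> k"
  shows "\<exists>P Q. \<forall>(S :: (complex^'n::finite) set) u v. open S \<longrightarrow> holomorphic_sev S u \<longrightarrow> holomorphic_sev S v \<longrightarrow>
       (\<forall>z\<in>S. teuler_prod \<alpha> K u z = teuler_prod \<gamma> K v z) \<longrightarrow>
       (let T = (\<lambda>n z. teuler_poly (P n) u z + teuler_poly (Q n) v z) in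
        \<forall>z\<in>S. T 0 z = u z \<and> T K z = v z \<and>
          (\<forall>n\<in>{1..K}. \<gamma> n * T n z + teuler (T n) z = \<alpha> n * T (n-1) z + teuler (T (n-1)) z))"
proof -
  define G where "G n = (\<Prod>k\<in>{1..n}. [:\<gamma> k, 1:])" for n
  define A where "A n = (\<Prod>k\<in>{n+1..K}. [:\<alpha> k, 1:])" for n
  define a where "a n = (\<Prod>k\<in>{1..n}. [:\<alpha> k, 1:])" for n
  define g where "g n = (\<Prod>k\<in>{n+1..K}. [:\<gamma> k, 1:])" for n
  have com: "comaximal (G n) (A m)" if "n \<le> m" for n m
    \<comment> \<open>\<open>G n\<close> has the \<gamma>_k with k \<le> n and \<open>A m\<close>
      the \<alpha>_l with l > m \<ge> n, so only pairs with k < l meet. Besides n = m, the pair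
      (n-1, n) is used in the proof of the recursion.\<close>
    unfolding G_def A_def by (rule comaximal_prod_linear) (use ne that in \<open>force dest: not_sym\<close>)
  \<comment> \<open>The cofactors are chosen from \<alpha> and \<gamma> alone, so the same
    polynomials serve every domain and every u, v.\<close>
  define r where "r n = (SOME r. \<exists>s. r * G n + s * A n = 1)" for n
  define s where "s n = (SOME s. r n * G n + s * A n = 1)" for n
  have rs: "r n * G n + s n * A n = 1" for n
    using someI_ex[OF com[OF order_refl, unfolded comaximal_def]] unfolding r_def s_def by (rule someI_ex)
  have aA: "a n * A n = a K" and Gg: "G n * g n = G K" if "n \<le> K" for n
    using prod_split_at[OF that] unfolding a_def A_def G_def g_def by blast+
  show ?thesis
  proof (rule exI[of _ "\<lambda>n. r n * a n"], rule exI[of _ "\<lambda>n. s n * g n"], intro allI impI, unfold Let_def)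
    fix S :: "(complex^'n) set" and u v
    assume S: "open S" and u: "holomorphic_sev S u" and v: "holomorphic_sev S v"
      and eq: "\<forall>z\<in>S. teuler_prod \<alpha> K u z = teuler_prod \<gamma> K v z"
    note mult = teuler_poly_mult[OF S]
    have eq': "teuler_poly (p * a K) u z = teuler_poly (p * G K) v z" if "z \<in> S" for z p
      unfolding mult[OF u that] mult[OF v that]
      by (rule teuler_poly_cong[OF S _ that])
         (use eq teuler_prod_eq_poly[OF S u] teuler_prod_eq_poly[OF S v] in \<open>simp add: a_def G_def\<close>)
    define T where "T n z = teuler_poly (r n * a n) u z + teuler_poly (s n * g n) v z" for n z
    have hT: "holomorphic_sev S (T n)" for n
      unfolding T_def[abs_def]
      using holomorphic_sev_lincomb[OF S holomorphic_sev_teuler_poly[OF S u] holomorphic_sev_teuler_poly[OF S v], of 1] by simp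
    have pT: "teuler_poly p (T n) z = teuler_poly (p * (r n * a n)) u z + teuler_poly (p * (s n * g n)) v z" if z: "z \<in> S" for p n z
      using teuler_poly_lincomb[OF S holomorphic_sev_teuler_poly[OF S u] holomorphic_sev_teuler_poly[OF S v] z, of p 1]
      unfolding mult[OF u z] mult[OF v z] T_def[abs_def] by simp
    have GT: "teuler_poly (G n) (T n) z = teuler_poly (a n) u z" if z: "z \<in> S" and n: "n \<le> K" for n z
    proof -
      have "G n * (r n * a n) + s n * a K = (r n * G n + s n * A n) * a n" by (simp add: aA[OF n, symmetric] algebra_simps)
      hence 1: "teuler_poly (G n * (r n * a n)) u z + teuler_poly (s n * a K) u z = teuler_poly (a n) u z"
        unfolding rs teuler_poly_add[symmetric] by simp
      have "G n * (s n * g n) = s n * G K" by (simp add: Gg[OF n, symmetric] mult_ac)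
      thus ?thesis using 1 eq'[OF z, of "s n"] by (simp only: pT[OF z])
    qed
    have AT: "teuler_poly (A n) (T n) z = teuler_poly (g n) v z" if z: "z \<in> S" and n: "n \<le> K" for n z
    proof -
      have "A n * (s n * g n) + r n * G K = (r n * G n + s n * A n) * g n" by (simp add: Gg[OF n, symmetric] algebra_simps)
      hence 1: "teuler_poly (A n * (s n * g n)) v z + teuler_poly (r n * G K) v z = teuler_poly (g n) v z"
        unfolding rs teuler_poly_add[symmetric] by simp
      have "A n * (r n * a n) = r n * a K" by (simp add: aA[OF n, symmetric] mult_ac)
      thus ?thesis using 1 eq'[OF z, of "r n"] by (simp only: pT[OF z] add.commute)
    qed
    have "T 0 z = u z" if "z \<in> S" for z using GT[OF that, of 0] by (simp add: G_def a_def)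
    moreover have "T K z = v z" if "z \<in> S" for z using AT[OF that, of K] by (simp add: A_def g_def)
    moreover have "\<gamma> n * T n z + teuler (T n) z = \<alpha> n * T (n-1) z + teuler (T (n-1)) z"
      if z: "z \<in> S" and n: "n \<in> {1..K}" for n z
    proof -
      \<comment> \<open>The defect of the recursion. \<open>G (n-1)\<close> and \<open>A n\<close>
        both annihilate it: the linear factors inside \<Delta> complete them to \<open>G n\<close>
        on \<open>T n\<close> and to \<open>A (n-1)\<close> on \<open>T (n-1)\<close>, where the
        defining relations apply.\<close>
      define \<Delta> where "\<Delta> z = (- 1) * teuler_poly [:\<alpha> n, 1:] (T (n-1)) z + teuler_poly [:\<gamma> n, 1:] (T n) z" for z
      note hp = holomorphic_sev_teuler_poly[OF S hT]
      have h\<Delta>: "holomorphic_sev S \<Delta>" unfolding \<Delta>_def[abs_def] by (rule holomorphic_sev_lincomb[OF S hp hp])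
      have p\<Delta>: "teuler_poly p \<Delta> z = teuler_poly [:\<gamma> n, 1:] (teuler_poly p (T n)) z - teuler_poly [:\<alpha> n, 1:] (teuler_poly p (T (n-1))) z"
        if z: "z \<in> S" for p z
      proof -
        have swap: "teuler_poly p (teuler_poly q (T m)) z = teuler_poly q (teuler_poly p (T m)) z" for p q m
          by (simp only: mult[OF hT z, symmetric] mult.commute)
        show ?thesis
          unfolding \<Delta>_def[abs_def] teuler_poly_lincomb[OF S hp hp z] swap[of p] by simp
      qed
      have n': "n - 1 \<le> K" "n \<le> K" "Suc (n - 1) = n" "n - 1 + 1 = n" using n by auto
      have "prod f {1..n} = f n * prod f {1..n-1}" for f :: "nat \<Rightarrow> complex poly"
        using prod.nat_ivl_Suc'[of 1 "n-1" f] n' by simp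
      hence G_Suc: "G n = [:\<gamma> n, 1:] * G (n-1)" and a_Suc: "a n = [:\<alpha> n, 1:] * a (n-1)"
        unfolding G_def a_def by blast+
      have "prod f {n-1+1..K} = f n * prod f {n+1..K}" for f :: "nat \<Rightarrow> complex poly"
        using prod.atLeast_Suc_atMost[of n K f] n' by simp
      hence A_Suc: "A (n-1) = [:\<alpha> n, 1:] * A n" and g_Suc: "g (n-1) = [:\<gamma> n, 1:] * g n"
        unfolding A_def g_def by blast+
      obtain r' s' where rs': "r' * G (n-1) + s' * A n = 1"
        by (rule comaximalE[OF com[of "n-1" n]]) simp_all
      have "\<Delta> z = 0"
      proof (rule teuler_poly_comaximal[OF S h\<Delta> rs' _ _ z])
        fix z assume z: "z \<in> S"
        have "teuler_poly [:\<gamma> n, 1:] (teuler_poly (G (n-1)) (T n)) z = teuler_poly (a n) u z"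
          using GT[OF z n'(2)] unfolding G_Suc mult[OF hT z] .
        moreover have "teuler_poly [:\<alpha> n, 1:] (teuler_poly (G (n-1)) (T (n-1))) z = teuler_poly (a n) u z"
          unfolding a_Suc mult[OF u z] by (rule teuler_poly_cong[OF S GT[OF _ n'(1)] z])
        ultimately show "teuler_poly (G (n-1)) \<Delta> z = 0" by (simp add: p\<Delta>[OF z])
        have "teuler_poly [:\<alpha> n, 1:] (teuler_poly (A n) (T (n-1))) z = teuler_poly (g (n-1)) v z"
          using AT[OF z n'(1)] unfolding A_Suc mult[OF hT z] .
        moreover have "teuler_poly [:\<gamma> n, 1:] (teuler_poly (A n) (T n)) z = teuler_poly (g (n-1)) v z"
          unfolding g_Suc mult[OF v z] by (rule teuler_poly_cong[OF S AT[OF _ n'(2)] z])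
        ultimately show "teuler_poly (A n) \<Delta> z = 0" by (simp add: p\<Delta>[OF z])
      qed
      thus ?thesis unfolding \<Delta>_def teuler_poly_pCons by (simp only: teuler_poly_0) algebra
    qed
    ultimately show "\<forall>z\<in>S. teuler_poly (r 0 * a 0) u z + teuler_poly (s 0 * g 0) v z = u z \<and>
        teuler_poly (r K * a K) u z + teuler_poly (s K * g K) v z = v z \<and>
        (\<forall>n\<in>{1..K}. \<gamma> n * (teuler_poly (r n * a n) u z + teuler_poly (s n * g n) v z) +
            teuler (\<lambda>z. teuler_poly (r n * a n) u z + teuler_poly (s n * g n) v z) z =
            \<alpha> n * (teuler_poly (r (n - 1) * a (n - 1)) u z + teuler_poly (s (n - 1) * g (n - 1)) v z) +
            teuler (\<lambda>z. teuler_poly (r (n - 1) * a (n - 1)) u z + teuler_poly (s (n - 1) * g (n - 1)) v z) z)"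
      unfolding T_def[abs_def] by blast
  qed
qed

section \<open>The Hamiltonians near \<open>q = 0\<close>\<close>

lemma sum_lessThan_split: "L \<ge> 2 \<Longrightarrow> (\<Sum>n<L. f n) = f 0 + (\<Sum>n=1..L-1. f n)"
  for f :: "nat \<Rightarrow> 'a::comm_monoid_add"
proof -
  assume "L \<ge> 2"
  hence "{..<L} = insert 0 {1..L-1}" by auto
  thus ?thesis by simp
qed

lemma sum_option: "(\<Sum>j\<in>UNIV. f j) = f None + (\<Sum>i\<in>UNIV. f (Some i))"
  for f :: "'n::finite option \<Rightarrow> 'a::comm_monoid_add"
  by (simp add: UNIV_option_conv sum.reindex)

lemma sum_option_minus: "(\<Sum>j\<in>UNIV - {Some i}. f j) = f None + (\<Sum>a\<in>UNIV - {i}. f (Some a))"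
  for f :: "'n::finite option \<Rightarrow> 'a::comm_monoid_add"
proof -
  have "UNIV - {Some i} = insert None (Some ` (UNIV - {i}))" by (auto simp: UNIV_option_conv)
  thus ?thesis by (simp add: sum.reindex)
qed

context
  fixes L :: nat and e \<kappa> :: "nat \<Rightarrow> complex" and \<theta> :: "'n::finite option \<Rightarrow> complex"
  assumes L: "L \<ge> 2" and \<kappa>0: "\<kappa> 0 = (\<Sum>i\<in>UNIV. \<theta> (Some i))"
begin

text \<open>The hypothesis on \<kappa>_0 makes the eliminated momentum \<open>p_0^(0)\<close> vanish
  at q = 0, and there every term that contains a free momentum carries it as a factor.\<close>

lemma hamiltonian_q_zero:
  "hamiltonian L e \<kappa> \<theta> j x (\<lambda>_ _. 0) p =
     (e 0 * \<theta> (Some j) + (\<Sum>a\<in>UNIV-{j}. x $ a / (x $ j - x $ a) * (\<theta> (Some a) * \<theta> (Some j)))) / x $ j"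
proof -
  have tri: "(\<Sum>n<L. \<Sum>m<n. q_ext (\<lambda>_ _. 0) (Some j) m * P m * q_ext (\<lambda>_ _. 0) a n * R n) =
     (if a = None then P 0 * (\<Sum>n=1..L-1. R n) else 0)" for a and P R :: "nat \<Rightarrow> complex"
  proof -
    have "(\<Sum>m<n. q_ext (\<lambda>_ _. 0) (Some j) m * P m * q_ext (\<lambda>_ _. 0) a n * R n) = (if a = None \<and> n \<noteq> 0 then P 0 * R n else 0)" for n
    proof -
      have "(\<Sum>m<n. q_ext (\<lambda>_ _. 0) (Some j) m * P m * q_ext (\<lambda>_ _. 0) a n * R n) =
        (\<Sum>m<n. if m = 0 then (if a = None \<and> n \<noteq> 0 then P 0 * R n else 0) else 0)"
        by (rule sum.cong) (auto simp: q_ext_def split: option.splits)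
      thus ?thesis by simp
    qed
    thus ?thesis by (cases a) (simp_all add: sum_lessThan_split[OF L] sum_distrib_left)
  qed
  have sq: "(\<Sum>m<L. \<Sum>n<L. q_ext (\<lambda>_ _. 0) (Some j) m * P m * q_ext (\<lambda>_ _. 0) a n * R n) =
     (if a = None then P 0 * (\<Sum>n<L. R n) else P 0 * R 0)" for a and P R :: "nat \<Rightarrow> complex"
    by (auto simp: sum_lessThan_split[OF L] q_ext_def sum_distrib_left distrib_left split: option.splits)
  have p0: "p_ext L \<kappa> \<theta> (\<lambda>_ _. 0) p None 0 = 0" "p_ext L \<kappa> \<theta> (\<lambda>_ _. 0) p (Some a) 0 = \<theta> (Some a)" for a
    by (auto simp: p_ext_def p_pos_def q_ext_def \<kappa>0)
  have "(\<Sum>n<L. e n * q_ext (\<lambda>_ _. 0) (Some j) n * p_ext L \<kappa> \<theta> (\<lambda>_ _. 0) p (Some j) n) = e 0 * \<theta> (Some j)"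
    by (simp add: sum_lessThan_split[OF L] q_ext_def p0)
  thus ?thesis
    unfolding hamiltonian_def Let_def tri sq by (simp add: sum_option sum_option_minus x_ext_def p0)
qed

lemma deriv_hamiltonian_p: "deriv (\<lambda>z. hamiltonian L e \<kappa> \<theta> j x (\<lambda>_ _. 0) (p z)) w = 0"
  by (simp add: hamiltonian_q_zero)

text \<open>The linear part of H_j in a single \<open>q_n^(i)\<close> at q = 0, which is all that
  the momentum equations need. The terms with 1/(x_j - 1) come from the index \<open>None\<close>,
  where x_0 = 1.\<close>

lemma deriv_hamiltonian_q:
  fixes i j :: 'n and n :: nat
  assumes n: "n \<in> {1..L-1}"
  shows "deriv (\<lambda>z. hamiltonian L e \<kappa> \<theta> j x ((\<lambda>_ _. 0)(i := ((\<lambda>_. 0)(n := z)))) p) 0 =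
    ((if i = j then (e n - e 0) * p j n + \<kappa> n * (\<Sum>m=n+1..L-1. p j m) + \<kappa> n / (x $ j - 1) * (\<theta> (Some j) + (\<Sum>m=1..L-1. p j m))
         + (\<Sum>a\<in>UNIV-{j}. x $ a / (x $ j - x $ a) * (\<theta> (Some j) * p a n - \<theta> (Some a) * p j n))
       else x $ i / (x $ j - x $ i) * (\<theta> (Some i) * p j n - \<theta> (Some j) * p i n))
     + p i n * (\<Sum>m=1..L-1. p j m) + \<theta> (Some i) * p j n + 1 / (x $ j - 1) * p i n * (\<theta> (Some j) + (\<Sum>m=1..L-1. p j m))) / x $ j"
proof -
  define q where "q z = ((\<lambda>_ _. 0)(i := ((\<lambda>_. 0)(n := z))) :: 'n \<Rightarrow> nat \<Rightarrow> complex)" for z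
  define Q where "Q a m z = q_ext (q z) a m" for a m z
  define P where "P a m z = p_ext L \<kappa> \<theta> (q z) p a m" for a m z
  define dQ where "dQ a m = (if a = Some i \<and> m = n then 1 else 0 :: complex)" for a m
  \<comment> \<open>Besides its direct occurrences, z enters through the eliminated momenta:
    \<open>p_0^(i)\<close> loses z \<open>p_n^(i)\<close>, therefore \<open>p_0^(0)\<close> gains
    it, while \<open>p_n^(0)\<close> loses it.\<close>
  define dP where "dP a m = (case a of None \<Rightarrow> (if m = 0 then p i n else if m = n then - p i n else 0)
       | Some k \<Rightarrow> (if k = i \<and> m = 0 then - p i n else 0))" for a m
  have n0: "n \<noteq> 0" and nL: "n < L" using n by auto
  have dQ: "(Q a m has_field_derivative dQ a m) (at 0)" for a m
  proof -
    have "Q a m z = (if a = Some i \<and> m = n then z else if a = None \<or> m = 0 then 1 else 0)" for z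
      by (auto simp: Q_def q_ext_def q_def n0 split: option.splits)
    hence "Q a m = (\<lambda>z. if a = Some i \<and> m = n then z else if a = None \<or> m = 0 then 1 else 0)" by auto
    thus ?thesis by (cases "a = Some i \<and> m = n") (auto simp: dQ_def simp del: if_split intro: DERIV_ident DERIV_const)
  qed
  have qv: "q z k m = (if k = i \<and> m = n then z else 0)" for k m z by (simp add: q_def)
  have pp: "p_pos L \<theta> (q z) p k m = (if m = 0 then \<theta> (Some k) - (if k = i then z * p i n else 0) else p k m)" for k m z
  proof -
    have "(\<Sum>m=1..L-1. q z k m * p k m) = (\<Sum>m=1..L-1. if m = n then (if k = i then z * p i n else 0) else 0)"
      by (rule sum.cong) (auto simp: q_def)
    also have "\<dots> = (if k = i then z * p i n else 0)" using n by simp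
    finally show ?thesis by (simp add: p_pos_def)
  qed
  have Peq: "P a m z = (case a of None \<Rightarrow> (if m = 0 then z * p i n else if m = n then \<kappa> m - z * p i n else \<kappa> m)
       | Some k \<Rightarrow> (if m = 0 then \<theta> (Some k) - (if k = i then z * p i n else 0) else p k m))" for a m z
  proof (cases a)
    case None
    have "(\<Sum>k\<in>UNIV. q_ext (q z) (Some k) m * p_pos L \<theta> (q z) p k m) =
       (\<Sum>k\<in>UNIV. if m = 0 then \<theta> (Some k) - (if k = i then z * p i n else 0) else if k = i then (if m = n then z * p i n else 0) else 0)"
      by (rule sum.cong) (auto simp: pp q_ext_def qv)
    also have "\<dots> = (if m = 0 then \<kappa> 0 - z * p i n else if m = n then z * p i n else 0)"
      by (simp add: sum_subtractf \<kappa>0)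
    finally show ?thesis using None n0 by (auto simp: P_def p_ext_def)
  qed (simp add: P_def p_ext_def pp)
  have dP: "(P a m has_field_derivative dP a m) (at 0)" for a m
    unfolding Peq[abs_def] dP_def
  proof (cases a)
    case (Some k)
    thus "((\<lambda>z. case a of None \<Rightarrow> (if m = 0 then z * p i n else if m = n then \<kappa> m - z * p i n else \<kappa> m)
       | Some k \<Rightarrow> (if m = 0 then \<theta> (Some k) - (if k = i then z * p i n else 0) else p k m)) has_field_derivative
       (case a of None \<Rightarrow> (if m = 0 then p i n else if m = n then - p i n else 0)
       | Some k \<Rightarrow> (if k = i \<and> m = 0 then - p i n else 0))) (at 0)"
      by (cases "k = i"; cases "m = 0"; simp) (auto intro!: derivative_eq_intros)
  qed (auto intro!: derivative_eq_intros)
  have Q0: "Q a m 0 = (if a = None \<or> m = 0 then 1 else 0)" for a m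
    by (auto simp: Q_def q_ext_def q_def split: option.splits)
  have P0: "P a m 0 = (case a of None \<Rightarrow> (if m = 0 then 0 else \<kappa> m) | Some k \<Rightarrow> if m = 0 then \<theta> (Some k) else p k m)" for a m
    by (auto simp: Peq split: option.splits)
  \<comment> \<open>The product rule for the four factors; at q = 0 most summands vanish, so each
    double sum below collapses to a few indices.\<close>
  define D where "D a m m' = dQ (Some j) m * P a m 0 * Q a m' 0 * P (Some j) m' 0 + Q (Some j) m 0 * dP a m * Q a m' 0 * P (Some j) m' 0
      + Q (Some j) m 0 * P a m 0 * dQ a m' * P (Some j) m' 0 + Q (Some j) m 0 * P a m 0 * Q a m' 0 * dP (Some j) m'" for a m m'
  have d4: "((\<lambda>z. Q (Some j) m z * P a m z * Q a m' z * P (Some j) m' z) has_field_derivative D a m m') (at 0)" for a m m'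
    unfolding D_def by (rule derivative_eq_intros dQ dP refl)+ (simp add: algebra_simps)
  have d2: "((\<lambda>z. e m * Q (Some j) m z * P (Some j) m z) has_field_derivative e m * (dQ (Some j) m * P (Some j) m 0 + Q (Some j) m 0 * dP (Some j) m)) (at 0)" for m
    by (rule derivative_eq_intros dQ dP refl)+ (simp add: algebra_simps)
  have "((\<lambda>z. ((\<Sum>m<L. e m * Q (Some j) m z * P (Some j) m z)
        + (\<Sum>a\<in>UNIV. \<Sum>m'<L. \<Sum>m<m'. Q (Some j) m z * P a m z * Q a m' z * P (Some j) m' z)
        + (\<Sum>a\<in>UNIV - {Some j}. x_ext x a / (x_ext x (Some j) - x_ext x a) *
             (\<Sum>m<L. \<Sum>m'<L. Q (Some j) m z * P a m z * Q a m' z * P (Some j) m' z))) / x $ j)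
     has_field_derivative
       ((\<Sum>m<L. e m * (dQ (Some j) m * P (Some j) m 0 + Q (Some j) m 0 * dP (Some j) m))
        + (\<Sum>a\<in>UNIV. \<Sum>m'<L. \<Sum>m<m'. D a m m')
        + (\<Sum>a\<in>UNIV - {Some j}. x_ext x a / (x_ext x (Some j) - x_ext x a) * (\<Sum>m<L. \<Sum>m'<L. D a m m'))) / x $ j) (at 0)"
    by (intro DERIV_cdivide DERIV_add DERIV_sum DERIV_cmult d2 d4)
  hence "deriv (\<lambda>z. hamiltonian L e \<kappa> \<theta> j x (q z) p) 0 =
       ((\<Sum>m<L. e m * (dQ (Some j) m * P (Some j) m 0 + Q (Some j) m 0 * dP (Some j) m))
        + (\<Sum>a\<in>UNIV. \<Sum>m'<L. \<Sum>m<m'. D a m m')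
        + (\<Sum>a\<in>UNIV - {Some j}. x_ext x a / (x_ext x (Some j) - x_ext x a) * (\<Sum>m<L. \<Sum>m'<L. D a m m'))) / x $ j"
    unfolding hamiltonian_def Let_def Q_def P_def by (rule DERIV_imp_deriv)
  moreover have "(\<Sum>m<L. e m * (dQ (Some j) m * P (Some j) m 0 + Q (Some j) m 0 * dP (Some j) m)) = (if i = j then (e n - e 0) * p j n else 0)"
  proof -
    have "(\<Sum>m=1..L-1. e m * (dQ (Some j) m * P (Some j) m 0 + Q (Some j) m 0 * dP (Some j) m)) = (\<Sum>m=1..L-1. if m = n then (if i = j then e n * p j n else 0) else 0)"
      by (rule sum.cong) (auto simp: dQ_def dP_def Q0 P0)
    also have "\<dots> = (if i = j then e n * p j n else 0)" using n by simp
    finally show ?thesis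
      using n0 by (simp add: sum_lessThan_split[OF L] dQ_def dP_def Q0 P0 algebra_simps)
  qed
  \<comment> \<open>Only m = 0, through the change of \<open>p_0^(0)\<close>, and m = n, through
    \<open>q_n^(i)\<close> itself, contribute. The ordering m < m' in the Hamiltonian turns the
    latter into the tail sum beyond n.\<close>
  moreover have triN: "(\<Sum>m'<L. \<Sum>m<m'. D None m m') = p i n * (\<Sum>m=1..L-1. p j m) + (if i = j then \<kappa> n * (\<Sum>m=n+1..L-1. p j m) else 0)"
  proof -
    have "(\<Sum>m<m'. D None m m') = (if m' = 0 then 0 else p i n * p j m' + (if i = j \<and> n < m' then \<kappa> n * p j m' else 0))" for m'
    proof (cases m')
      case (Suc k)
      have "D None 0 m' = p i n * p j m'" using Suc n0 by (simp add: D_def dQ_def dP_def Q0 P0)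
      moreover have "(\<Sum>m<k. D None (Suc m) m') = (\<Sum>m<k. if m = n - 1 then (if i = j then \<kappa> n * p j m' else 0) else 0)"
        using Suc n0 by (intro sum.cong) (auto simp: D_def dQ_def dP_def Q0 P0)
      moreover have "n - 1 < k \<longleftrightarrow> n < m'" using Suc n0 by auto
      ultimately show ?thesis unfolding Suc sum.lessThan_Suc_shift by simp
    qed simp
    hence "(\<Sum>m'<L. \<Sum>m<m'. D None m m') = (\<Sum>m'=1..L-1. p i n * p j m') + (\<Sum>m'=1..L-1. if i = j \<and> n < m' then \<kappa> n * p j m' else 0)"
      by (simp add: sum_lessThan_split[OF L] sum.distrib)
    also have "(\<Sum>m'=1..L-1. if i = j \<and> n < m' then \<kappa> n * p j m' else 0) = (\<Sum>m'=n+1..L-1. if i = j then \<kappa> n * p j m' else 0)"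
      by (rule sum.mono_neutral_cong_right) auto
    finally show ?thesis by (simp add: sum_distrib_left)
  qed
  moreover have triS: "(\<Sum>m'<L. \<Sum>m<m'. D (Some a) m m') = (if a = i then \<theta> (Some i) * p j n else 0)" for a
  proof -
    have "(\<Sum>m<m'. D (Some a) m m') = (if m' = n then (if a = i then \<theta> (Some i) * p j n else 0) else 0)" for m'
    proof (cases m')
      case (Suc k)
      have "D (Some a) 0 m' = (if m' = n then (if a = i then \<theta> (Some i) * p j n else 0) else 0)"
        using Suc n0 by (simp add: D_def dQ_def dP_def Q0 P0)
      moreover have "(\<Sum>m<k. D (Some a) (Suc m) m') = 0"
        using Suc n0 by (intro sum.neutral) (auto simp: D_def dQ_def dP_def Q0 P0)
      ultimately show ?thesis unfolding Suc sum.lessThan_Suc_shift by simp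
    qed (use n0 in simp)
    thus ?thesis using nL by simp
  qed
  moreover have sqN: "(\<Sum>m<L. \<Sum>m'<L. D None m m') = (p i n + (if i = j then \<kappa> n else 0)) * (\<theta> (Some j) + (\<Sum>m=1..L-1. p j m))"
  proof -
    have "(\<Sum>m'<L. D None m m') = (if m = 0 then p i n * (\<theta> (Some j) + (\<Sum>m=1..L-1. p j m)) 
        else if m = n then (if i = j then \<kappa> n * (\<theta> (Some j) + (\<Sum>m=1..L-1. p j m)) else 0) else 0)" for m
    proof -
      have "(\<Sum>m'=1..L-1. D None m m') = (\<Sum>m'=1..L-1. (if m = 0 then p i n else if m = n \<and> i = j then \<kappa> n else 0) * p j m')"
        using n0 by (intro sum.cong) (auto simp: D_def dQ_def dP_def Q0 P0)
      moreover have "D None m 0 = (if m = 0 then p i n else if m = n \<and> i = j then \<kappa> n else 0) * \<theta> (Some j)"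
        using n0 by (auto simp: D_def dQ_def dP_def Q0 P0)
      ultimately show ?thesis by (simp add: sum_lessThan_split[OF L] sum_distrib_left[symmetric] distrib_left)
    qed
    hence "(\<Sum>m<L. \<Sum>m'<L. D None m m') = p i n * (\<theta> (Some j) + (\<Sum>m=1..L-1. p j m)) +
       (\<Sum>m=1..L-1. if m = n then (if i = j then \<kappa> n * (\<theta> (Some j) + (\<Sum>m=1..L-1. p j m)) else 0) else 0)"
      unfolding sum_lessThan_split[OF L, of "\<lambda>m. \<Sum>m'<L. D None m m'"] by simp
    thus ?thesis using n by (simp add: distrib_right)
  qed
  moreover have sqS: "(\<Sum>m<L. \<Sum>m'<L. D (Some a) m m') = (if i = a then \<theta> (Some i) * p j n - p i n * \<theta> (Some j) else 0)
       + (if i = j then p a n * \<theta> (Some j) - \<theta> (Some a) * p j n else 0)" if "a \<noteq> j" for a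
  proof -
    have "(\<Sum>m'<L. D (Some a) m m') = (if m = 0 then (if i = a then \<theta> (Some i) * p j n - p i n * \<theta> (Some j) else 0)
         + (if i = j then - \<theta> (Some a) * p j n else 0) else if m = n then (if i = j then p a n * \<theta> (Some j) else 0) else 0)" for m
    proof -
      have "(\<Sum>m'=1..L-1. D (Some a) m m') = (\<Sum>m'=1..L-1. if m' = n then (if m = 0 \<and> i = a then \<theta> (Some i) * p j n else 0) else 0)"
        using n0 by (intro sum.cong) (auto simp: D_def dQ_def dP_def Q0 P0)
      also have "\<dots> = (if m = 0 \<and> i = a then \<theta> (Some i) * p j n else 0)" using n by simp
      moreover have "D (Some a) m 0 = (if m = 0 then (if i = a then - p i n * \<theta> (Some j) else 0)
         + (if i = j then - \<theta> (Some a) * p j n else 0) else if m = n then (if i = j then p a n * \<theta> (Some j) else 0) else 0)"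
        using n0 that by (auto simp: D_def dQ_def dP_def Q0 P0)
      ultimately show ?thesis unfolding sum_lessThan_split[OF L, of "\<lambda>m'. D (Some a) m m'"] using n0 by simp
    qed
    hence "(\<Sum>m<L. \<Sum>m'<L. D (Some a) m m') = (if i = a then \<theta> (Some i) * p j n - p i n * \<theta> (Some j) else 0)
         + (if i = j then - \<theta> (Some a) * p j n else 0) + (\<Sum>m=1..L-1. if m = n then (if i = j then p a n * \<theta> (Some j) else 0) else 0)"
      unfolding sum_lessThan_split[OF L, of "\<lambda>m. \<Sum>m'<L. D (Some a) m m'"] by simp
    thus ?thesis using n by simp
  qed
  moreover have "(\<Sum>a\<in>UNIV-{j}. x $ a / (x $ j - x $ a) * (\<Sum>m<L. \<Sum>m'<L. D (Some a) m m'))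
      = (if i = j then (\<Sum>a\<in>UNIV-{j}. x $ a / (x $ j - x $ a) * (\<theta> (Some j) * p a n - \<theta> (Some a) * p j n))
         else x $ i / (x $ j - x $ i) * (\<theta> (Some i) * p j n - \<theta> (Some j) * p i n))"
  proof (cases "i = j")
    case True
    thus ?thesis by (auto simp: sqS mult_ac intro!: sum.cong)
  next
    case False
    hence "(\<Sum>a\<in>UNIV-{j}. x $ a / (x $ j - x $ a) * (\<Sum>m<L. \<Sum>m'<L. D (Some a) m m'))
       = (\<Sum>a\<in>UNIV-{j}. if a = i then x $ i / (x $ j - x $ i) * (\<theta> (Some i) * p j n - \<theta> (Some j) * p i n) else 0)"
      by (intro sum.cong) (auto simp: sqS mult_ac)
    thus ?thesis using False by simp
  qed
  ultimately show ?thesis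
    unfolding q_def[symmetric] sum_option sum_option_minus
    by (simp add: x_ext_def triN triS sqN add_divide_distrib distrib_right distrib_left mult_ac)
qed

end

section \<open>Chains and the Hamiltonian system\<close>

text \<open>Here D = d_j \<pi>^i_n, qi = \<pi>^i_n, qj = \<pi>^j_n, yj = d_j y, and s is the sum of
  the momenta with upper index j. The last hypothesis turns the quadratic terms into the logarithmic
  derivative required by the quotient rule.\<close>

lemma offdiagonal_identity:
  fixes y :: complex
  assumes "y \<noteq> 0" "xj \<noteq> 0" "xj \<noteq> 1" "xj \<noteq> xi" "(xj - xi) * D = tj * qi - ti * qj"
    and "tj + s = (xj - 1) * yj / y"
  shows "(D * y - qi * yj) / (y * y) = - ((xi / (xj - xi) * (ti * (qj / y) - tj * (qi / y))
     + qi / y * s + ti * (qj / y) + 1 / (xj - 1) * (qi / y) * (tj + s)) / xj)"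
proof -
  have s: "s = (xj - 1) * yj / y - tj" using assms(6) by (simp add: algebra_simps)
  have D: "D = (tj * qi - ti * qj) / (xj - xi)" using assms(4,5) by (simp add: field_simps)
  have "1 / (xj - 1) * (qi / y) * (tj + s) = qi / y * yj / y"
    unfolding assms(6) using assms(3) by simp
  moreover have "qi / y * s + qi / y * yj / y = qi / y * (xj * yj / y - tj)"
    unfolding s by (simp add: algebra_simps diff_divide_distrib)
  ultimately have "(xi / (xj - xi) * (ti * (qj / y) - tj * (qi / y)) + qi / y * s + ti * (qj / y) + 1 / (xj - 1) * (qi / y) * (tj + s))
     = xi / (xj - xi) * (ti * (qj / y) - tj * (qi / y)) + ti * (qj / y) + qi / y * (xj * yj / y - tj)" by simp
  also have "\<dots> = - xj * ((D * y - qi * yj) / (y * y))"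
    unfolding D using assms(1,4) by (simp add: field_simps)
  finally show ?thesis using assms(2) by simp
qed

text \<open>The case i = j, with a = \<alpha>_n, k = \<kappa>_n, t = T j n and R the sum of x_a d_a
  \<pi>^j_n over indices other than j, so the fourth hypothesis gives the total Euler derivative of
  \<pi>^j_n. The two terms with k combine to k t / y.\<close>

lemma diagonal_identity:
  fixes y :: complex
  assumes "y \<noteq> 0" "xj \<noteq> 0" "xj \<noteq> 1" "xj * D + R = - a * pj - k * t"
    and "tj + s = (xj - 1) * yj / y"
  shows "(D * y - pj * yj) / (y * y) = - ((a * (pj / y) + k * ((t - yj) / y) + k / (xj - 1) * (tj + s) + R / y
     + pj / y * s + tj * (pj / y) + 1 / (xj - 1) * (pj / y) * (tj + s)) / xj)"
proof -
  have s: "s = (xj - 1) * yj / y - tj" using assms(5) by (simp add: algebra_simps)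
  have "D * xj = - (a * pj + k * t + R)" using assms(4) by algebra
  hence D: "D = - (a * pj + k * t + R) / xj" using assms(2) by (simp add: eq_divide_eq)
  have "1 / (xj - 1) * (pj / y) * (tj + s) = pj / y * yj / y" "k / (xj - 1) * (tj + s) = k * yj / y"
    unfolding assms(5) using assms(3) by simp_all
  moreover have "pj / y * s + pj / y * yj / y = pj / y * (xj * yj / y - tj)"
    unfolding s by (simp add: algebra_simps diff_divide_distrib)
  ultimately have "a * (pj / y) + k * ((t - yj) / y) + k / (xj - 1) * (tj + s) + R / y
     + pj / y * s + tj * (pj / y) + 1 / (xj - 1) * (pj / y) * (tj + s)
     = a * (pj / y) + k * t / y + R / y + pj / y * (xj * yj / y)"
    by (simp add: algebra_simps diff_divide_distrib)
  also have "\<dots> = - xj * ((D * y - pj * yj) / (y * y))"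
    unfolding D using assms(1,2) by (simp add: field_simps)
  finally show ?thesis using assms(2) by simp
qed

lemma sum_telescope_ivl: "n \<le> K \<Longrightarrow> (\<Sum>m=n+1..K. f (m-1) - f m) = f n - f (K::nat)"
  for f :: "nat \<Rightarrow> complex"
  by (induction K rule: dec_induct) (simp_all add: algebra_simps)

context
  fixes S :: "(complex^'n::finite) set" and \<alpha> \<gamma> :: "nat \<Rightarrow> complex" and \<beta> :: "'n \<Rightarrow> complex"
    and y T L
  assumes S: "open S" "S \<subseteq> regular_points" and L: "L \<ge> 2"
    and y: "holomorphic_sev S y" and chain: "hg_chain L \<alpha> \<beta> \<gamma> S y T"
begin

text \<open>After n steps the chain has traded n factors: (\<alpha>_1 + D)...(\<alpha>_n + D) T_0 =
  (\<gamma>_1 + D)...(\<gamma>_n + D) T_n. For n = L-1 the prescribed ends of the chain make this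
  (HG).\<close>

lemma hg_chain_imp_hg_solution: "hg_solution L \<alpha> \<beta> \<gamma> S y"
proof -
  have hT: "holomorphic_sev S (T i n)" if "n \<le> L - 1" for i n
    using chain that L by (auto simp: hg_chain_def)
  have step: "teuler_prod \<alpha> n (T i 0) z = teuler_prod \<gamma> n (T i n) z" if "n \<le> L - 1" "z \<in> S" for i n z
    using that
  proof (induction n arbitrary: z)
    case (Suc n)
    \<comment> \<open>The new factor has to pass the \<gamma>-factors so that it meets
      \<open>T i n\<close> directly, where the recursion applies.\<close>
    have comm: "c * teuler_prod \<gamma> n f z + teuler (teuler_prod \<gamma> n f) z = teuler_prod \<gamma> n (\<lambda>z. c * f z + teuler f z) z"
      if "holomorphic_sev S f" for f c
    proof -
      have "(\<lambda>f z. c * f z + teuler f z) (teuler_prod \<gamma> n f) z = teuler_prod (\<lambda>n. \<gamma> n + 0) n ((\<lambda>f z. c * f z + teuler f z) f) z"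
        by (rule teuler_prod_commute[where E="\<lambda>f z. c * f z + teuler f z", OF S(1) _ _ that Suc.prems(2)])
           (auto simp: teuler_lincomb[OF S(1)] holomorphic_sev_teuler[OF S(1)] distrib_left mult.left_commute)
      thus ?thesis by simp
    qed
    have "teuler_prod \<alpha> (Suc n) (T i 0) z = \<alpha> (Suc n) * teuler_prod \<gamma> n (T i n) z + teuler (teuler_prod \<gamma> n (T i n)) z"
      using Suc.IH Suc.prems teuler_cong[OF S(1) Suc.prems(2), of "teuler_prod \<alpha> n (T i 0)" "teuler_prod \<gamma> n (T i n)"] by simp
    also have "\<dots> = teuler_prod \<gamma> n (\<lambda>z. \<alpha> (Suc n) * T i n z + teuler (T i n) z) z"
      by (rule comm[OF hT]) (use Suc.prems in simp)
    also have "\<dots> = teuler_prod \<gamma> n (\<lambda>z. \<gamma> (Suc n) * T i (Suc n) z + teuler (T i (Suc n)) z) z"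
    proof (rule teuler_prod_cong[OF S(1) _ Suc.prems(2)])
      fix w assume "w \<in> S"
      hence "\<forall>m\<in>{1..L-1}. \<gamma> m * T i m w + teuler (T i m) w = \<alpha> m * T i (m-1) w + teuler (T i (m-1)) w"
        using chain by (simp add: hg_chain_def)
      from this[rule_format, of "Suc n"] Suc.prems
      show "\<alpha> (Suc n) * T i n w + teuler (T i n) w = \<gamma> (Suc n) * T i (Suc n) w + teuler (T i (Suc n)) w" by simp
    qed
    also have "\<dots> = teuler_prod \<gamma> (Suc n) (T i (Suc n)) z"
      using comm[OF hT[OF Suc.prems(1)], of "\<gamma> (Suc n)"] by simp
    finally show ?case .
  qed simp
  have "teuler_prod \<alpha> (L-1) (\<lambda>z. \<beta> i * y z + euler i y z) z = teuler_prod \<gamma> (L-1) (pdiff i y) z" if z: "z \<in> S" for i z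
  proof -
    have "teuler_prod \<alpha> (L-1) (\<lambda>z. \<beta> i * y z + euler i y z) z = teuler_prod \<alpha> (L-1) (T i 0) z"
      by (rule teuler_prod_cong[OF S(1) _ z]) (use chain in \<open>simp add: hg_chain_def\<close>)
    also have "\<dots> = teuler_prod \<gamma> (L-1) (T i (L-1)) z" by (rule step[OF _ z]) simp
    also have "\<dots> = teuler_prod \<gamma> (L-1) (pdiff i y) z"
      by (rule teuler_prod_cong[OF S(1) _ z]) (use chain in \<open>simp add: hg_chain_def\<close>)
    finally show ?thesis .
  qed
  thus ?thesis unfolding hg_solution_iff[OF S] using y by blast
qed

text \<open>The chain relation controls only D \<pi>. Transversality supplies d_j \<pi>^i for
  distinct i and j, and the diagonal derivative follows by subtraction.\<close>

lemma hg_chain_imp_hamiltonian_solution: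
  assumes trans: "\<And>n. n \<in> {1..L-1} \<Longrightarrow> transversal S \<beta> (\<lambda>i z. T i (n-1) z - T i n z)"
    and \<kappa>0: "\<kappa> 0 = (\<Sum>i\<in>UNIV. \<theta> (Some i))"
    and \<alpha>: "\<And>n. n \<in> {1..L-1} \<Longrightarrow> \<alpha> n = e n - e 0"
    and \<gamma>: "\<And>n. n \<in> {1..L-1} \<Longrightarrow> \<gamma> n = e n - e 0 - \<kappa> n"
    and \<beta>: "\<And>i. \<beta> i = - \<theta> (Some i)"
  shows "hamiltonian_solution L e \<kappa> \<theta> {x\<in>S. y x \<noteq> 0} (\<lambda>_ _ _. 0) (hg_momentum y T)"
proof -
  have hT: "holomorphic_sev S (T i n)" if "n \<le> L - 1" for i n
    using chain that L by (auto simp: hg_chain_def)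
  define \<pi> where "\<pi> i n z = T i (n-1) z - T i n z" for i n z
  have h\<pi>: "hol_at (\<pi> i n) z" if "n \<in> {1..L-1}" "z \<in> S" for i n z
    unfolding \<pi>_def[abs_def] using that by (intro hol_at_intros holomorphic_sevD[OF hT]) auto
  have mom: "hg_momentum y T i n = (\<lambda>z. \<pi> i n z / y z)" for i n
    by (simp add: hg_momentum_def[abs_def] \<pi>_def)
  have pmom: "pdiff j (hg_momentum y T i n) z = (pdiff j (\<pi> i n) z * y z - \<pi> i n z * pdiff j y z) / (y z * y z)"
    if "n \<in> {1..L-1}" "z \<in> S" "y z \<noteq> 0" for i j n z
    unfolding mom by (rule pdiff_divide) (use that h\<pi> holomorphic_sevD[OF y] in auto)
  have eqs: "pdiff j (hg_momentum y T i n) x =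
      - deriv (\<lambda>z. hamiltonian L e \<kappa> \<theta> j x ((\<lambda>_ _. 0)(i := ((\<lambda>_. 0)(n := z)))) (\<lambda>k m. hg_momentum y T k m x)) 0"
    if x: "x \<in> S" and yx: "y x \<noteq> 0" and n: "n \<in> {1..L-1}" for x i j n
  proof -
    have reg: "x $ j \<noteq> 0" "x $ j \<noteq> 1" "\<And>a b. a \<noteq> b \<Longrightarrow> x $ a \<noteq> x $ b" for j
      using x S(2) by (auto simp: regular_points_def)
    \<comment> \<open>The momenta telescope, and the chain ends in T j (L-1) = d_j y.\<close>
    have tail: "(\<Sum>m=k+1..L-1. hg_momentum y T j m x) = (T j k x - pdiff j y x) / y x" if "k \<le> L - 1" for k j
    proof -
      have "(\<Sum>m=k+1..L-1. T j (m-1) x - T j m x) = T j k x - pdiff j y x"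
        using sum_telescope_ivl[OF that, of "\<lambda>m. T j m x"] chain x by (simp add: hg_chain_def)
      thus ?thesis by (simp add: hg_momentum_def sum_divide_distrib[symmetric])
    qed
    define s where "s = (\<Sum>m=1..L-1. hg_momentum y T j m x)"
    \<comment> \<open>The linearising relation: inserting T j 0 = -\<theta>_j y + x_j d_j y shows
      that \<theta>_j plus the sum of the momenta is x_j - 1 times the logarithmic derivative of
      y.\<close>
    have s: "\<theta> (Some j) + s = (x $ j - 1) * pdiff j y x / y x"
    proof -
      have "T j 0 x = - \<theta> (Some j) * y x + x $ j * pdiff j y x"
        using chain x by (simp add: hg_chain_def \<beta> euler_def)
      moreover have "s = (T j 0 x - pdiff j y x) / y x" using tail[of 0 j] by (simp add: s_def)
      hence "s * y x = T j 0 x - pdiff j y x" using yx by simp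
      ultimately have "(\<theta> (Some j) + s) * y x = (x $ j - 1) * pdiff j y x" by algebra
      thus ?thesis using yx by (simp add: eq_divide_eq)
    qed
    have tr: "(x $ b - x $ a) * pdiff b (\<pi> a n) x = \<theta> (Some b) * \<pi> a n x - \<theta> (Some a) * \<pi> b n x" if "a \<noteq> b" for a b
      using trans[OF n] that x by (simp add: transversal_def \<pi>_def[abs_def] \<beta>)
    note D = deriv_hamiltonian_q[where e=e and \<kappa>=\<kappa> and \<theta>=\<theta>, OF L \<kappa>0 n, of j x i "\<lambda>k m. hg_momentum y T k m x"]
    have p: "hg_momentum y T k n x = \<pi> k n x / y x" for k by (simp add: mom)
    show ?thesis
    proof (cases "i = j")
      case False
      have "(pdiff j (\<pi> i n) x * y x - \<pi> i n x * pdiff j y x) / (y x * y x) =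
        - ((x $ i / (x $ j - x $ i) * (\<theta> (Some i) * (\<pi> j n x / y x) - \<theta> (Some j) * (\<pi> i n x / y x))
          + \<pi> i n x / y x * s + \<theta> (Some i) * (\<pi> j n x / y x) + 1 / (x $ j - 1) * (\<pi> i n x / y x) * (\<theta> (Some j) + s)) / x $ j)"
        by (rule offdiagonal_identity) (use yx reg tr s False in auto)
      thus ?thesis unfolding D pmom[OF n x yx] p s_def[symmetric] using False by simp
    next
      case True
      define R where "R = (\<Sum>a\<in>UNIV-{j}. x $ a / (x $ j - x $ a) * (\<theta> (Some j) * \<pi> a n x - \<theta> (Some a) * \<pi> j n x))"
      \<comment> \<open>The Euler--Darboux relations clear the denominators of the interaction sum;
        what remains is D \<pi>^j_n without its j-th term.\<close>
      have R: "R = (\<Sum>a\<in>UNIV-{j}. x $ a * pdiff a (\<pi> j n) x)"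
        unfolding R_def
      proof (rule sum.cong[OF refl])
        fix a assume "a \<in> UNIV - {j}"
        hence a: "a \<noteq> j" by simp
        hence "x $ j - x $ a \<noteq> 0" using reg(3)[of j a] by auto
        moreover from tr[of j a] a have "\<theta> (Some j) * \<pi> a n x - \<theta> (Some a) * \<pi> j n x = (x $ j - x $ a) * pdiff a (\<pi> j n) x"
          by (simp add: algebra_simps)
        ultimately show "x $ a / (x $ j - x $ a) * (\<theta> (Some j) * \<pi> a n x - \<theta> (Some a) * \<pi> j n x) = x $ a * pdiff a (\<pi> j n) x"
          by simp
      qed
      have "x $ j * pdiff j (\<pi> j n) x + R = teuler (\<pi> j n) x"
        unfolding R teuler_def euler_def by (simp add: sum.remove[of UNIV j])
      also have "\<dots> = (- 1) * teuler (T j n) x + teuler (T j (n-1)) x"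
        using le_trans[OF diff_le_self, of n "L - 1" 1]
         teuler_lincomb[OF S(1) hT hT x, of n "n-1" "-1" j j] n unfolding \<pi>_def[abs_def] by simp
      also have "\<dots> = - \<alpha> n * \<pi> j n x - \<kappa> n * T j n x"
      proof -
        have "\<gamma> n * T j n x + teuler (T j n) x = \<alpha> n * T j (n-1) x + teuler (T j (n-1)) x"
          using chain x n by (simp add: hg_chain_def)
        moreover have "\<gamma> n = \<alpha> n - \<kappa> n" using \<alpha>[OF n] \<gamma>[OF n] by simp
        ultimately show ?thesis unfolding \<pi>_def by (simp add: algebra_simps)
      qed
      finally have "x $ j * pdiff j (\<pi> j n) x + R = - \<alpha> n * \<pi> j n x - \<kappa> n * T j n x" .
      from diagonal_identity[OF yx reg(1,2) this s]
      have "(pdiff j (\<pi> j n) x * y x - \<pi> j n x * pdiff j y x) / (y x * y x) =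
        - ((\<alpha> n * (\<pi> j n x / y x) + \<kappa> n * ((T j n x - pdiff j y x) / y x) + \<kappa> n / (x $ j - 1) * (\<theta> (Some j) + s) + R / y x
         + \<pi> j n x / y x * s + \<theta> (Some j) * (\<pi> j n x / y x) + 1 / (x $ j - 1) * (\<pi> j n x / y x) * (\<theta> (Some j) + s)) / x $ j)" .
      moreover have "R / y x = (\<Sum>a\<in>UNIV-{j}. x $ a / (x $ j - x $ a) * (\<theta> (Some j) * (\<pi> a n x / y x) - \<theta> (Some a) * (\<pi> j n x / y x)))"
        unfolding R_def sum_divide_distrib
        by (intro sum.cong refl) (simp only: times_divide_eq_right diff_divide_distrib[symmetric])
      ultimately show ?thesis
        unfolding D pmom[OF n x yx] p s_def[symmetric] using True tail[of n j] n \<alpha>[OF n] by simp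
    qed
  qed
  have "holomorphic_sev {x\<in>S. y x \<noteq> 0} (hg_momentum y T i n)" if "n \<in> {1..L-1}" for i n
    unfolding mom using h\<pi>[OF that] holomorphic_sevD[OF y] by (auto intro!: holomorphic_sevI hol_at_intros)
  thus ?thesis
    unfolding hamiltonian_solution_def Let_def
    using eqs deriv_hamiltonian_p[where e=e and \<kappa>=\<kappa> and \<theta>=\<theta>, OF L \<kappa>0]
    by (auto simp: holomorphic_sev_iff)
qed

end

section \<open>The linear system for the momenta\<close>

text \<open>A linear form is kept as a functional and its coefficients are its values on unit
  vectors; the condition also says that only the entries in \<open>I\<close> matter.
  \<open>frobenius\<close> receives a matrix this way, while computations keep the closed
  formulas.\<close>

definition coord_linear :: "'m set \<Rightarrow> (('m \<Rightarrow> complex) \<Rightarrow> complex) \<Rightarrow> bool" where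
  "coord_linear I \<Phi> \<longleftrightarrow> (\<forall>u. (\<Sum>b\<in>I. \<Phi> (\<lambda>c. if c = b then 1 else 0) * u b) = \<Phi> u)"

lemma coord_linearD: "coord_linear I \<Phi> \<Longrightarrow> (\<Sum>b\<in>I. \<Phi> (\<lambda>c. if c = b then 1 else 0) * u b) = \<Phi> u"
  by (simp add: coord_linear_def)

lemma coord_linear_proj: "finite I \<Longrightarrow> c \<in> I \<Longrightarrow> coord_linear I (\<lambda>u. u c)"
  by (simp add: coord_linear_def if_distrib[of "\<lambda>x. x * _"] cong: if_cong)

lemma coord_linear_add: "coord_linear I f \<Longrightarrow> coord_linear I g \<Longrightarrow> coord_linear I (\<lambda>u. f u + g u)"
  unfolding coord_linear_def by (simp add: distrib_right sum.distrib)

lemma coord_linear_diff: "coord_linear I f \<Longrightarrow> coord_linear I g \<Longrightarrow> coord_linear I (\<lambda>u. f u - g u)"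
  unfolding coord_linear_def by (simp add: left_diff_distrib sum_subtractf)

lemma coord_linear_cmult: "coord_linear I f \<Longrightarrow> coord_linear I (\<lambda>u. c * f u)"
  unfolding coord_linear_def by (simp add: mult.assoc sum_distrib_left[symmetric])

lemma coord_linear_divide: "coord_linear I f \<Longrightarrow> coord_linear I (\<lambda>u. f u / c)"
  using coord_linear_cmult[of I f "1 / c"] by simp

lemma coord_linear_minus: "coord_linear I f \<Longrightarrow> coord_linear I (\<lambda>u. - f u)"
  using coord_linear_cmult[of I f "-1"] by simp

lemma coord_linear_sum: "(\<And>j. j \<in> J \<Longrightarrow> coord_linear I (f j)) \<Longrightarrow> coord_linear I (\<lambda>u. \<Sum>j\<in>J. f j u)"
proof (induction J rule: infinite_finite_induct)
  case (insert x F)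
  thus ?case by (simp add: coord_linear_add)
qed (simp_all add: coord_linear_def)

lemmas coord_linear_intros = coord_linear_proj coord_linear_add coord_linear_diff coord_linear_cmult coord_linear_divide coord_linear_minus coord_linear_sum

lemma coord_linear_sum_apply:
  assumes "coord_linear I \<Phi>"
  shows "\<Phi> (\<lambda>b. \<Sum>k\<in>J. w k * u k b) = (\<Sum>k\<in>J. w k * \<Phi> (u k))"
proof -
  have "\<Phi> (\<lambda>b. \<Sum>k\<in>J. w k * u k b) = (\<Sum>b\<in>I. \<Phi> (\<lambda>c. if c = b then 1 else 0) * (\<Sum>k\<in>J. w k * u k b))"
    by (rule coord_linearD[OF assms, symmetric])
  also have "\<dots> = (\<Sum>k\<in>J. w k * (\<Sum>b\<in>I. \<Phi> (\<lambda>c. if c = b then 1 else 0) * u k b))"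
    unfolding sum_distrib_left by (subst sum.swap) (simp add: mult.left_commute)
  finally show ?thesis unfolding coord_linearD[OF assms] .
qed

text \<open>The left side is d_k of \<open>pf_dy j\<close> after inserting the system. The right
  side is a quotient of two antisymmetric expressions in j and k, hence symmetric, which is
  integrability for y.\<close>

lemma pf_dy_identity:
  assumes "zk - zj \<noteq> 0" "zk - 1 \<noteq> 0" "zj - 1 \<noteq> (0 :: complex)"
  shows "((bj * Sk - bk * Sj) / (zk - zj) - bj * ((Sk - bk * y) / (zk - 1))) / (zj - 1)
     = (bj * ((Sk - bk * y) / (zk - 1)) - bk * ((Sj - bj * y) / (zj - 1))) / (zk - zj)"
  using assms by (simp add: divide_simps) (simp add: algebra_simps)

text \<open>The two mixed second derivatives of \<pi>^i in the directions j and k, for three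
  distinct indices, after inserting \<open>pf_off\<close>.\<close>

lemma pf_off_identity:
  assumes "zj - zi \<noteq> 0" "zk - zi \<noteq> 0" "zk - zj \<noteq> (0 :: complex)"
  shows "(bi * ((bj * pk - bk * pj) / (zk - zj)) - bj * ((bi * pk - bk * qi) / (zk - zi))) / (zj - zi)
     = (bi * ((bk * pj - bj * pk) / (zj - zk)) - bk * ((bi * pj - bj * qi) / (zj - zi))) / (zk - zi)"
proof -
  have "(bk * pj - bj * pk) / (zj - zk) = (bj * pk - bk * pj) / (zk - zj)"
    by (metis minus_diff_eq minus_divide_divide)
  thus ?thesis using assms by (simp add: divide_simps) (simp add: algebra_simps)
qed

context
  fixes K :: nat and \<alpha> \<kappa> :: "nat \<Rightarrow> complex" and \<beta> :: "'n::finite \<Rightarrow> complex"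
begin

text \<open>The unknowns are \<open>y\<close>, with index \<open>None\<close>, and \<open>\<pi>\<^sup>i\<^sub>n = y p\<^sub>n\<^sup>(\<^sup>i\<^sup>) = T i (n-1) - T i n\<close>, with index
  \<open>Some (i, n)\<close>. The functions \<open>pf_dy\<close>, \<open>pf_off\<close>, \<open>pf_diag\<close> and \<open>pf_chain\<close> express \<open>\<partial>\<^sub>j y\<close>,
  \<open>\<partial>\<^sub>j \<pi>\<^sup>i\<^sub>n\<close> for \<open>i \<noteq> j\<close>, \<open>\<partial>\<^sub>j \<pi>\<^sup>j\<^sub>n\<close> and \<open>T i n\<close> through the unknowns.\<close>

definition pf_index :: "('n \<times> nat) option set" where
  "pf_index = insert None (Some ` (UNIV \<times> {1..K}))"

definition pf_dy :: "'n \<Rightarrow> complex^'n \<Rightarrow> (('n \<times> nat) option \<Rightarrow> complex) \<Rightarrow> complex" where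
  "pf_dy j x u = ((\<Sum>n=1..K. u (Some (j, n))) - \<beta> j * u None) / (x $ j - 1)"

definition pf_off :: "'n \<Rightarrow> 'n \<Rightarrow> nat \<Rightarrow> complex^'n \<Rightarrow> (('n \<times> nat) option \<Rightarrow> complex) \<Rightarrow> complex" where
  "pf_off i j n x u = (\<beta> i * u (Some (j, n)) - \<beta> j * u (Some (i, n))) / (x $ j - x $ i)"

definition pf_chain :: "'n \<Rightarrow> nat \<Rightarrow> complex^'n \<Rightarrow> (('n \<times> nat) option \<Rightarrow> complex) \<Rightarrow> complex" where
  "pf_chain i n x u = (\<Sum>m=n+1..K. u (Some (i, m))) + pf_dy i x u"

definition pf_diag :: "'n \<Rightarrow> nat \<Rightarrow> complex^'n \<Rightarrow> (('n \<times> nat) option \<Rightarrow> complex) \<Rightarrow> complex" where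
  "pf_diag j n x u = - (\<alpha> n * u (Some (j, n)) + \<kappa> n * pf_chain j n x u + (\<Sum>a\<in>UNIV-{j}. x $ a * pf_off j a n x u)) / x $ j"

definition pf_rhs :: "'n \<Rightarrow> ('n \<times> nat) option \<Rightarrow> complex^'n \<Rightarrow> (('n \<times> nat) option \<Rightarrow> complex) \<Rightarrow> complex" where
  "pf_rhs j a x u = (case a of None \<Rightarrow> pf_dy j x u
     | Some (i, n) \<Rightarrow> if i = j then pf_diag j n x u else pf_off i j n x u)"

lemma finite_pf_index: "finite pf_index" by (simp add: pf_index_def)

lemma pf_index_memb [simp]: "None \<in> pf_index" "Some (i, n) \<in> pf_index \<longleftrightarrow> n \<in> {1..K}"
  by (auto simp: pf_index_def)

lemma coord_linear_pf_dy: "coord_linear pf_index (pf_dy j x)"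
  unfolding pf_dy_def by (intro coord_linear_intros finite_pf_index) auto

lemma coord_linear_pf_off: "n \<in> {1..K} \<Longrightarrow> coord_linear pf_index (pf_off i j n x)"
  unfolding pf_off_def by (intro coord_linear_intros finite_pf_index) auto

lemma coord_linear_pf_chain: "coord_linear pf_index (pf_chain i n x)"
  unfolding pf_chain_def by (intro coord_linear_intros finite_pf_index coord_linear_pf_dy) auto

lemma coord_linear_pf_diag: "n \<in> {1..K} \<Longrightarrow> coord_linear pf_index (pf_diag j n x)"
  unfolding pf_diag_def
  by (intro coord_linear_divide coord_linear_minus coord_linear_add coord_linear_cmult coord_linear_sum coord_linear_proj finite_pf_index coord_linear_pf_chain coord_linear_pf_off) auto

lemma coord_linear_pf_rhs:
  assumes "a \<in> pf_index"
  shows "coord_linear pf_index (pf_rhs j a x)"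
proof (cases a)
  case None
  thus ?thesis by (simp add: pf_rhs_def[abs_def] coord_linear_pf_dy)
next
  case (Some b)
  thus ?thesis using assms
    by (cases b; cases "fst b = j") (auto simp add: pf_rhs_def[abs_def] coord_linear_pf_diag coord_linear_pf_off)
qed

context
  fixes u :: "('n \<times> nat) option \<Rightarrow> complex^'n \<Rightarrow> complex" and z :: "complex^'n"
  assumes z: "z \<in> regular_points" and hu: "\<And>a. a \<in> pf_index \<Longrightarrow> hol_at (u a) z"
begin

private lemma reg: "z $ i \<noteq> 0" "z $ i \<noteq> 1" "i \<noteq> j \<Longrightarrow> z $ i \<noteq> z $ j"
  using z by (auto simp: regular_points_def)

lemma hol_pf_dy: "hol_at (\<lambda>x. pf_dy j x (\<lambda>a. u a x)) z"
  unfolding pf_dy_def using reg by (intro hol_at_intros hu hol_at_const hol_at_coord) auto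

lemma hol_pf_off: "n \<in> {1..K} \<Longrightarrow> i \<noteq> j \<Longrightarrow> hol_at (\<lambda>x. pf_off i j n x (\<lambda>a. u a x)) z"
  unfolding pf_off_def using reg(3)[of j i] by (intro hol_at_intros hu hol_at_const hol_at_coord) auto

lemma hol_pf_chain: "hol_at (\<lambda>x. pf_chain i n x (\<lambda>a. u a x)) z"
  unfolding pf_chain_def by (intro hol_at_intros hu hol_pf_dy) auto

lemma hol_pf_diag: "n \<in> {1..K} \<Longrightarrow> hol_at (\<lambda>x. pf_diag j n x (\<lambda>a. u a x)) z"
  unfolding pf_diag_def using reg(1)
  by (intro hol_at_intros hu hol_pf_chain hol_pf_off hol_at_const hol_at_coord) auto

lemma hol_pf_rhs: "a \<in> pf_index \<Longrightarrow> hol_at (\<lambda>x. pf_rhs j a x (\<lambda>a. u a x)) z"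
  unfolding pf_rhs_def by (cases a; cases "fst (the a) = j") (auto simp: hol_pf_dy hol_pf_off hol_pf_diag)

context
  assumes jet: "\<And>a k. a \<in> pf_index \<Longrightarrow> pdiff k (u a) z = pf_rhs k a z (\<lambda>a. u a z)"
begin

private lemma jet_None: "pdiff k (u None) z = pf_dy k z (\<lambda>a. u a z)"
  and jet_off: "n \<in> {1..K} \<Longrightarrow> i \<noteq> k \<Longrightarrow> pdiff k (u (Some (i, n))) z = pf_off i k n z (\<lambda>a. u a z)"
  and jet_diag: "n \<in> {1..K} \<Longrightarrow> pdiff k (u (Some (k, n))) z = pf_diag k n z (\<lambda>a. u a z)"
  by (simp_all add: jet pf_rhs_def)

private lemma sum_off:
  "(\<Sum>n\<in>J. pf_off i k n z v) = (\<beta> i * (\<Sum>n\<in>J. v (Some (k, n))) - \<beta> k * (\<Sum>n\<in>J. v (Some (i, n)))) / (z $ k - z $ i)"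
  by (simp add: pf_off_def sum_divide_distrib[symmetric] sum_subtractf sum_distrib_left)

private lemma sum_u:
  assumes "M \<ge> 1"
  shows "hol_at (\<lambda>x. \<Sum>n=M..K. u (Some (j, n)) x) z"
    and "j \<noteq> k \<Longrightarrow> pdiff k (\<lambda>x. \<Sum>n=M..K. u (Some (j, n)) x) z = (\<Sum>n=M..K. pf_off j k n z (\<lambda>a. u a z))"
proof -
  have h: "hol_at (u (Some (j, n))) z" if "n \<in> {M..K}" for n using that assms by (intro hu) auto
  show "hol_at (\<lambda>x. \<Sum>n=M..K. u (Some (j, n)) x) z" by (rule hol_at_sum[OF h])
  show "pdiff k (\<lambda>x. \<Sum>n=M..K. u (Some (j, n)) x) z = (\<Sum>n=M..K. pf_off j k n z (\<lambda>a. u a z))" if "j \<noteq> k"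
  proof -
    have "pdiff k (\<lambda>x. \<Sum>n=M..K. u (Some (j, n)) x) z = (\<Sum>n=M..K. pdiff k (u (Some (j, n))) z)"
      by (rule pdiff_sum) (rule h)
    also have "\<dots> = (\<Sum>n=M..K. pf_off j k n z (\<lambda>a. u a z))"
      using assms that by (intro sum.cong) (auto simp: jet_off)
    finally show ?thesis .
  qed
qed

lemma pdiff_pf_dy:
  assumes "j \<noteq> k"
  shows "pdiff k (\<lambda>x. pf_dy j x (\<lambda>a. u a x)) z =
     (\<beta> j * pf_dy k z (\<lambda>a. u a z) - \<beta> k * pf_dy j z (\<lambda>a. u a z)) / (z $ k - z $ j)"
proof -
  let ?S = "\<lambda>j. \<Sum>n=1..K. u (Some (j, n)) z"
  have ne: "z $ k - z $ j \<noteq> 0" "z $ k - 1 \<noteq> 0" "z $ j - 1 \<noteq> 0" using reg(2) reg(3)[OF assms] by auto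
  have "pdiff k (\<lambda>x. pf_dy j x (\<lambda>a. u a x)) z =
     ((\<Sum>n=1..K. pf_off j k n z (\<lambda>a. u a z)) - \<beta> j * pdiff k (u None) z) * (z $ j - 1) / ((z $ j - 1) * (z $ j - 1))"
    unfolding pf_dy_def using assms ne hu sum_u[of 1 j]
    by (simp add: pdiff_diff pdiff_divide pdiff_mult hol_at_diff hol_at_mult hol_at_divide del: One_nat_def)
  also have "\<dots> = ((\<Sum>n=1..K. pf_off j k n z (\<lambda>a. u a z)) - \<beta> j * pf_dy k z (\<lambda>a. u a z)) / (z $ j - 1)"
    using ne assms by (simp add: jet_None)
  also have "\<dots> = (\<beta> j * pf_dy k z (\<lambda>a. u a z) - \<beta> k * pf_dy j z (\<lambda>a. u a z)) / (z $ k - z $ j)"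
    unfolding sum_off pf_dy_def by (rule pf_dy_identity[OF ne])
  finally show ?thesis .
qed

lemma pdiff_pf_off_symmetric:
  assumes n: "n \<in> {1..K}" and "i \<noteq> j" "i \<noteq> k" "j \<noteq> k"
  shows "pdiff k (\<lambda>x. pf_off i j n x (\<lambda>a. u a x)) z = pdiff j (\<lambda>x. pf_off i k n x (\<lambda>a. u a x)) z"
proof -
  have *: "pdiff k (\<lambda>x. pf_off i j n x (\<lambda>a. u a x)) z =
      (\<beta> i * pf_off j k n z (\<lambda>a. u a z) - \<beta> j * pf_off i k n z (\<lambda>a. u a z)) / (z $ j - z $ i)"
    if "i \<noteq> j" "i \<noteq> k" "j \<noteq> k" for j k
  proof -
    have ne: "z $ j - z $ i \<noteq> 0" using reg(3)[of j i] that by auto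
    thus ?thesis unfolding pf_off_def[of i j] using n that hu
      by (simp add: pdiff_rules hol_at_intros jet_off)
  qed
  have ne: "z $ j - z $ i \<noteq> 0" "z $ k - z $ i \<noteq> 0" "z $ k - z $ j \<noteq> 0" "z $ j - z $ k \<noteq> 0"
    using reg(3) assms by (metis right_minus_eq)+
  have "(\<beta> i * pf_off j k n z (\<lambda>a. u a z) - \<beta> j * pf_off i k n z (\<lambda>a. u a z)) / (z $ j - z $ i)
      = (\<beta> i * pf_off k j n z (\<lambda>a. u a z) - \<beta> k * pf_off i j n z (\<lambda>a. u a z)) / (z $ k - z $ i)"
    unfolding pf_off_def by (rule pf_off_identity[OF ne(1-3)])
  thus ?thesis using *[of j k] *[of k j] assms by simp
qed

lemma pf_teuler:
  assumes n: "n \<in> {1..K}"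
  shows "(\<Sum>a\<in>UNIV. z $ a * pdiff a (u (Some (i, n))) z) = - \<alpha> n * u (Some (i, n)) z - \<kappa> n * pf_chain i n z (\<lambda>a. u a z)"
proof -
  have "(\<Sum>a\<in>UNIV. z $ a * pdiff a (u (Some (i, n))) z) = z $ i * pf_diag i n z (\<lambda>a. u a z) + (\<Sum>a\<in>UNIV-{i}. z $ a * pf_off i a n z (\<lambda>a. u a z))"
    using n by (subst sum.remove[of UNIV i]) (auto simp: jet_diag jet_off intro!: sum.cong)
  thus ?thesis unfolding pf_diag_def using reg(1) by simp
qed

text \<open>The diagonal derivatives are determined by \<open>\<D> \<pi>\<^sup>j\<^sub>n = - \<alpha>\<^sub>n \<pi>\<^sup>j\<^sub>n - \<kappa>\<^sub>n T j n\<close>. The off-diagonal ones,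
  being homogeneous of degree \<open>-1\<close> in \<open>x\<close>, satisfy \<open>\<D> \<partial>\<^sub>k = \<partial>\<^sub>k \<D> - \<partial>\<^sub>k\<close>, which yields the mixed case from the
  off-diagonal one.\<close>

lemma pdiff_pf_mixed:
  assumes n: "n \<in> {1..K}" and jk: "j \<noteq> k"
  shows "pdiff k (\<lambda>x. pf_diag j n x (\<lambda>a. u a x)) z = pdiff j (\<lambda>x. pf_off j k n x (\<lambda>a. u a x)) z"
proof -
  define G where "G a x = pf_off j a n x (\<lambda>a. u a x)" for a x
  let ?U = "\<lambda>a. u a z"
  have kj: "z $ k - z $ j \<noteq> 0" using reg(3)[of k j] jk by auto
  have hG: "hol_at (G a) z" if "a \<noteq> j" for a unfolding G_def[abs_def] using hol_pf_off[OF n] that by auto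
  \<comment> \<open>\<open>pf_chain j n\<close> is a sum of \<pi>^j_m and of d_j y; each of these
    obeys the Euler--Darboux rule with the same coefficients, hence so does the sum.\<close>
  have pchain: "pdiff k (\<lambda>x. pf_chain j n x (\<lambda>a. u a x)) z = (\<beta> j * pf_chain k n z ?U - \<beta> k * pf_chain j n z ?U) / (z $ k - z $ j)"
  proof -
    have "pdiff k (\<lambda>x. pf_chain j n x (\<lambda>a. u a x)) z = (\<Sum>m=n+1..K. pf_off j k m z ?U) + (\<beta> j * pf_dy k z ?U - \<beta> k * pf_dy j z ?U) / (z $ k - z $ j)"
      unfolding pf_chain_def pdiff_pf_dy[OF jk, symmetric]
      using sum_u[of "n + 1" j] jk by (subst pdiff_add) (simp_all add: hol_pf_dy)
    thus ?thesis unfolding sum_off pf_chain_def add_divide_distrib[symmetric] by (simp add: algebra_simps)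
  qed
  have "pdiff k (\<lambda>x. pf_diag j n x (\<lambda>a. u a x)) z =
      - (\<alpha> n * pf_off j k n z ?U + \<kappa> n * pdiff k (\<lambda>x. pf_chain j n x (\<lambda>a. u a x)) z
         + (\<Sum>a\<in>UNIV-{j}. (if k = a then 1 else 0) * G a z + z $ a * pdiff k (G a) z)) / z $ j"
  proof -
    define c where "c x = pf_chain j n x (\<lambda>a. u a x)" for x
    define R where "R x = (\<Sum>a\<in>UNIV-{j}. x $ a * G a x)" for x
    define v where "v = u (Some (j, n))"
    have h: "hol_at c z" "hol_at v z" "hol_at R z"
      unfolding c_def[abs_def] v_def R_def[abs_def] using n by (auto intro!: hol_pf_chain hu hol_at_intros hG)
    have pR: "pdiff k R z = (\<Sum>a\<in>UNIV-{j}. (if k = a then 1 else 0) * G a z + z $ a * pdiff k (G a) z)"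
      unfolding R_def[abs_def] by (subst pdiff_sum) (auto intro!: hol_at_intros hG sum.cong simp: pdiff_mult hG)
    have "pdiff k (\<lambda>x. pf_diag j n x (\<lambda>a. u a x)) z = pdiff k (\<lambda>x. - (\<alpha> n * v x + \<kappa> n * c x + R x) / x $ j) z"
      by (simp add: pf_diag_def G_def c_def R_def v_def)
    also have "\<dots> = - (\<alpha> n * pdiff k v z + \<kappa> n * pdiff k c z + pdiff k R z) / z $ j"
      using h jk reg(1)[of j] by (simp add: pdiff_rules hol_at_intros)
    finally show ?thesis unfolding pR c_def[abs_def] v_def jet_off[OF n jk] .
  qed
  \<comment> \<open>Off-diagonal symmetry trades d_k \<open>G a\<close> for d_a \<open>G k\<close>,
    so the sum becomes D \<open>G k\<close> without its j-th term, plus one stray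
    \<open>G k\<close>.\<close>
  also have "(\<Sum>a\<in>UNIV-{j}. (if k = a then 1 else 0) * G a z + z $ a * pdiff k (G a) z)
      = G k z + (\<Sum>a\<in>UNIV-{j}. z $ a * pdiff a (G k) z)"
  proof -
    have "(\<Sum>a\<in>UNIV-{j}. (if k = a then 1 else 0) * G a z) = (\<Sum>a\<in>UNIV-{j}. if a = k then G k z else 0)"
      by (rule sum.cong) auto
    also have "\<dots> = G k z" using jk by simp
    moreover have "pdiff k (G a) z = pdiff a (G k) z" if "a \<noteq> j" for a
      using pdiff_pf_off_symmetric[OF n, of j a k] that jk unfolding G_def[abs_def] by (cases "a = k") auto
    ultimately show ?thesis by (simp add: sum.distrib)
  qed
  finally have L: "z $ j * pdiff k (\<lambda>x. pf_diag j n x (\<lambda>a. u a x)) z =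
      - (\<alpha> n * pf_off j k n z ?U + \<kappa> n * ((\<beta> j * pf_chain k n z ?U - \<beta> k * pf_chain j n z ?U) / (z $ k - z $ j))
         + (G k z + (\<Sum>a\<in>UNIV-{j}. z $ a * pdiff a (G k) z)))"
    unfolding pchain using reg(1) by simp
  have "z $ j * pdiff j (G k) z + (\<Sum>a\<in>UNIV-{j}. z $ a * pdiff a (G k) z) = (\<Sum>a\<in>UNIV. z $ a * pdiff a (G k) z)"
    by (simp add: sum.remove[of UNIV j])
  also have "\<dots> = (\<beta> j * (- \<alpha> n * ?U (Some (k, n)) - \<kappa> n * pf_chain k n z ?U) - \<beta> k * (- \<alpha> n * ?U (Some (j, n)) - \<kappa> n * pf_chain j n z ?U)) / (z $ k - z $ j) - G k z"
  proof -
    \<comment> \<open>The quotient rule, arranged so that the derivative of the denominator stands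
      apart: weighted by z_a and summed, that part yields -\<open>G k\<close>, the degree -1
      correction.\<close>
    have pG: "pdiff a (G k) z = (\<beta> j * pdiff a (u (Some (k, n))) z - \<beta> k * pdiff a (u (Some (j, n))) z) / (z $ k - z $ j)
        - G k z * (((if a = k then 1 else 0) - (if a = j then 1 else 0)) / (z $ k - z $ j))" for a
    proof -
      have quot: "(A * d - N * e) / (d * d) = A / d - N / d * (e / d)" if "d \<noteq> 0" for A d N e :: complex
        using that by (simp add: diff_divide_distrib)
      have h: "hol_at (u (Some (k, n))) z" "hol_at (u (Some (j, n))) z" using n by (auto intro!: hu)
      have "pdiff a (G k) z = ((\<beta> j * pdiff a (u (Some (k, n))) z - \<beta> k * pdiff a (u (Some (j, n))) z) * (z $ k - z $ j)
        - (\<beta> j * u (Some (k, n)) z - \<beta> k * u (Some (j, n)) z) * ((if a = k then 1 else 0) - (if a = j then 1 else 0)))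
          / ((z $ k - z $ j) * (z $ k - z $ j))"
        unfolding G_def[abs_def] pf_off_def using kj h
        by (simp add: pdiff_divide pdiff_diff pdiff_mult hol_at_diff hol_at_mult)
      thus ?thesis unfolding quot[OF kj] by (simp add: G_def pf_off_def)
    qed
    have "(\<Sum>a\<in>UNIV. z $ a * pdiff a (G k) z) = (\<beta> j * (\<Sum>a\<in>UNIV. z $ a * pdiff a (u (Some (k, n))) z) - \<beta> k * (\<Sum>a\<in>UNIV. z $ a * pdiff a (u (Some (j, n))) z)) / (z $ k - z $ j)
        - G k z * ((\<Sum>a\<in>UNIV. z $ a * (if a = k then 1 else 0) - z $ a * (if a = j then 1 else 0)) / (z $ k - z $ j))"
      unfolding pG by (simp add: right_diff_distrib sum_subtractf sum_divide_distrib sum_distrib_left diff_divide_distrib mult.left_commute)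
    also have "(\<Sum>a\<in>UNIV. z $ a * (if a = k then 1 else 0) - z $ a * (if a = j then 1 else 0)) = z $ k - z $ j"
      by (simp add: sum_subtractf if_distrib[of "\<lambda>x. _ * x"] cong: if_cong)
    finally show ?thesis unfolding pf_teuler[OF n] using kj by simp
  qed
  also have "(\<beta> j * (- \<alpha> n * ?U (Some (k, n)) - \<kappa> n * pf_chain k n z ?U) - \<beta> k * (- \<alpha> n * ?U (Some (j, n)) - \<kappa> n * pf_chain j n z ?U)) / (z $ k - z $ j)
      = - (\<alpha> n * pf_off j k n z ?U + \<kappa> n * ((\<beta> j * pf_chain k n z ?U - \<beta> k * pf_chain j n z ?U) / (z $ k - z $ j)))"
  proof -
    have "(bj * (- a * pk - c * ck) - bk * (- a * pj - c * cj)) / d = - (a * ((bj * pk - bk * pj) / d) + c * ((bj * ck - bk * cj) / d))"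
      for a c bj bk pj pk cj ck d :: complex
      by (simp add: add_divide_distrib diff_divide_distrib algebra_simps)
    thus ?thesis unfolding pf_off_def .
  qed
  finally have "z $ j * pdiff j (G k) z + (\<Sum>a\<in>UNIV-{j}. z $ a * pdiff a (G k) z)
    = - (\<alpha> n * pf_off j k n z ?U + \<kappa> n * ((\<beta> j * pf_chain k n z ?U - \<beta> k * pf_chain j n z ?U) / (z $ k - z $ j))) - G k z" .
  moreover have "x = - (A + (g + s))" if "x + s = - A - g" for x s A g :: complex using that by algebra
  ultimately have R: "z $ j * pdiff j (G k) z = - (\<alpha> n * pf_off j k n z ?U + \<kappa> n * ((\<beta> j * pf_chain k n z ?U - \<beta> k * pf_chain j n z ?U) / (z $ k - z $ j))
         + (G k z + (\<Sum>a\<in>UNIV-{j}. z $ a * pdiff a (G k) z)))" by blast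
  from L R have "z $ j * pdiff k (\<lambda>x. pf_diag j n x (\<lambda>a. u a x)) z = z $ j * pdiff j (G k) z" by simp
  thus ?thesis using reg(1)[of j] by (simp add: G_def[abs_def])
qed

lemma pf_integrable:
  assumes "a \<in> pf_index"
  shows "pdiff k (\<lambda>x. pf_rhs j a x (\<lambda>a. u a x)) z = pdiff j (\<lambda>x. pf_rhs k a x (\<lambda>a. u a x)) z"
proof (cases "j = k")
  case jk: False
  show ?thesis
  proof (cases a)
    case None
    have "(p - q) / (r - s) = (q - p) / (s - r)" for p q r s :: complex
      by (metis minus_diff_eq minus_divide_divide)
    thus ?thesis
      unfolding pf_rhs_def None option.case pdiff_pf_dy[OF jk] pdiff_pf_dy[OF jk[symmetric]] .
  next
    case (Some b)
    then obtain i n where [simp]: "a = Some (i, n)" by (cases b) auto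
    with assms have n: "n \<in> {1..K}" by simp
    show ?thesis
      using pdiff_pf_off_symmetric[OF n, of i j k] pdiff_pf_mixed[OF n, of j k] pdiff_pf_mixed[OF n, of k j] jk
      by (cases "i = j"; cases "i = k") (auto simp: pf_rhs_def)
  qed
qed simp

end

end

section \<open>Solutions of the linear system and the chains they carry\<close>

definition pf_solution :: "(complex^'n) set \<Rightarrow> (('n \<times> nat) option \<Rightarrow> complex^'n \<Rightarrow> complex) \<Rightarrow> bool" where
  "pf_solution S U \<longleftrightarrow> (\<forall>a\<in>pf_index. \<forall>z\<in>S. hol_at (U a) z \<and> (\<forall>j. pdiff j (U a) z = pf_rhs j a z (\<lambda>c. U c z)))"

lemma pf_solution_sum:
  assumes U: "\<And>b. b \<in> J \<Longrightarrow> pf_solution S (U b)"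
  shows "pf_solution S (\<lambda>a z. \<Sum>b\<in>J. w b * U b a z)"
  unfolding pf_solution_def
proof (intro ballI conjI allI)
  fix a z j assume az: "a \<in> pf_index" "z \<in> S"
  have h: "hol_at (U b a) z" and d: "pdiff j (U b a) z = pf_rhs j a z (\<lambda>c. U b c z)" if "b \<in> J" for b
    using U[OF that] az by (auto simp: pf_solution_def)
  show "hol_at (\<lambda>z. \<Sum>b\<in>J. w b * U b a z) z" using h by (intro hol_at_intros hol_at_const) auto
  have "pdiff j (\<lambda>z. \<Sum>b\<in>J. w b * U b a z) z = (\<Sum>b\<in>J. w b * pdiff j (U b a) z)"
    using h by (simp add: pdiff_rules hol_at_intros)
  also have "\<dots> = (\<Sum>b\<in>J. w b * pf_rhs j a z (\<lambda>c. U b c z))" using d by simp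
  also have "\<dots> = pf_rhs j a z (\<lambda>c. \<Sum>b\<in>J. w b * U b c z)"
    by (rule coord_linear_sum_apply[OF coord_linear_pf_rhs[OF az(1)], symmetric])
  finally show "pdiff j (\<lambda>z. \<Sum>b\<in>J. w b * U b a z) z = pf_rhs j a z (\<lambda>c. \<Sum>b\<in>J. w b * U b c z)" .
qed

end

lemma open_regular_points: "open (regular_points :: (complex^'n::finite) set)"
proof -
  have "regular_points = (\<Inter>i. {x :: complex^'n. x $ i \<noteq> 0} \<inter> {x. x $ i \<noteq> 1} \<inter> (\<Inter>j\<in>-{i}. {x. x $ i \<noteq> x $ j}))"
    by (auto simp: regular_points_def)
  also have "open \<dots>"
    by (intro open_INT open_Int ballI) (auto intro!: open_Collect_neq continuous_intros)
  finally show ?thesis .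
qed

text \<open>T is recovered from its differences by summing back from the end value d_i y. The
  prescribed start \<beta>_i y + x_i d_i y is then the formula for \<open>pf_dy\<close> with its
  denominator cleared.\<close>

lemma pf_solution_chain:
  fixes S :: "(complex^'n::finite) set"
  assumes S: "open S" "S \<subseteq> regular_points"
    and U: "pf_solution K \<alpha> \<kappa> \<beta> S U"
    and L: "L = Suc K"
    and \<gamma>: "\<forall>n\<in>{1..K}. \<gamma> n = \<alpha> n - \<kappa> n"
  defines "T \<equiv> \<lambda>i n z. pf_chain K \<beta> i n z (\<lambda>c. U c z)"
  shows "\<And>i n z. n \<in> {1..K} \<Longrightarrow> T i (n-1) z - T i n z = U (Some (i, n)) z"
    and "hg_chain L \<alpha> \<beta> \<gamma> S (U None) T"
    and "\<And>n. n \<in> {1..K} \<Longrightarrow> transversal S \<beta> (\<lambda>i z. T i (n-1) z - T i n z)"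
proof -
  have hU: "hol_at (U a) z" and dU: "pdiff j (U a) z = pf_rhs K \<alpha> \<kappa> \<beta> j a z (\<lambda>c. U c z)"
    if "a \<in> pf_index K" "z \<in> S" for a j z using U that by (auto simp: pf_solution_def)
  have reg: "z \<in> regular_points" "z $ i \<noteq> 1" "i \<noteq> j \<Longrightarrow> z $ i \<noteq> z $ j" if "z \<in> S" for z i j
    using that S(2) by (auto simp: regular_points_def)
  show diff: "T i (n-1) z - T i n z = U (Some (i, n)) z" if "n \<in> {1..K}" for i n z
    using that sum.atLeast_Suc_atMost[of n K "\<lambda>m. U (Some (i, m)) z"] by (simp add: T_def pf_chain_def)
  have dy: "pdiff i (U None) z = pf_dy K \<beta> i z (\<lambda>c. U c z)" if "z \<in> S" for i z
    using dU[OF _ that, of None] by (simp add: pf_rhs_def)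
  have hT: "hol_at (T i n) z" if "z \<in> S" for i n z
    unfolding T_def by (rule hol_pf_chain[OF reg(1)[OF that] hU[OF _ that]])
  show "hg_chain L \<alpha> \<beta> \<gamma> S (U None) T"
    unfolding hg_chain_def
  proof (intro conjI allI impI ballI)
    show "holomorphic_sev S (T i n)" for i n using hT by (intro holomorphic_sevI)
    fix z i assume z: "z \<in> S"
    show "T i (L-1) z = pdiff i (U None) z" by (simp add: T_def pf_chain_def dy[OF z] L)
    have "(z $ i - 1) * pf_dy K \<beta> i z (\<lambda>c. U c z) = (\<Sum>n=1..K. U (Some (i, n)) z) - \<beta> i * U None z"
      using reg(2)[OF z] by (simp add: pf_dy_def)
    thus "T i 0 z = \<beta> i * U None z + euler i (U None) z"
      by (simp add: T_def pf_chain_def euler_def dy[OF z] algebra_simps)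
    fix n assume "n \<in> {1..L-1}"
    hence n: "n \<in> {1..K}" by (simp add: L)
    have "teuler (T i (n-1)) z = teuler (\<lambda>z. 1 * U (Some (i, n)) z + T i n z) z"
      using diff[OF n, of i] by (intro teuler_cong[OF S(1) z]) (simp add: diff_eq_eq)
    also have "\<dots> = 1 * teuler (U (Some (i, n))) z + teuler (T i n) z"
      by (rule teuler_lincomb[OF S(1) _ _ z]) (use n hU hT in \<open>auto intro!: holomorphic_sevI\<close>)
    also have "teuler (U (Some (i, n))) z = - \<alpha> n * U (Some (i, n)) z - \<kappa> n * T i n z"
      unfolding teuler_def euler_def T_def by (rule pf_teuler[OF reg(1)[OF z] hU[OF _ z] dU[OF _ z] n])
    finally show "\<gamma> n * T i n z + teuler (T i n) z = \<alpha> n * T i (n-1) z + teuler (T i (n-1)) z"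
      using diff[OF n, of i z] by (simp add: \<gamma>[rule_format, OF n] algebra_simps)
  qed
  show "transversal S \<beta> (\<lambda>i z. T i (n-1) z - T i n z)" if n: "n \<in> {1..K}" for n
    unfolding transversal_def diff[OF n]
  proof (intro ballI allI impI)
    fix z i j assume z: "z \<in> S" and ij: "i \<noteq> (j :: 'n)"
    have "pdiff j (\<lambda>z. U (Some (i, n)) z) z = pf_off \<beta> i j n z (\<lambda>c. U c z)"
      using dU[OF _ z, of "Some (i, n)" j] n ij by (simp add: pf_rhs_def)
    thus "(z $ j - z $ i) * pdiff j (\<lambda>z. U (Some (i, n)) z) z = \<beta> i * U (Some (j, n)) z - \<beta> j * U (Some (i, n)) z"
      using reg(3)[OF z ij] by (simp add: pf_off_def)
  qed
qed

text \<open>The radius from \<open>frobenius\<close> is independent of the initial vector, so the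
  solutions with unit initial vectors share one ball.\<close>

lemma pf_fundamental_solutions:
  fixes x0 :: "complex^'n::finite"
  assumes "x0 \<in> regular_points"
  obtains r U where "r > 0" "ball x0 r \<subseteq> regular_points"
    "\<And>a b. a \<in> pf_index K \<Longrightarrow> U b a x0 = (if a = b then 1 else 0)"
    "\<And>b. pf_solution K \<alpha> \<kappa> \<beta> (ball x0 r) (U b)"
proof -
  define A where "A j a b x = pf_rhs K \<alpha> \<kappa> \<beta> j a x (\<lambda>c. if c = b then 1 else 0)" for j a b x
  have A: "(\<Sum>b\<in>pf_index K. A j a b x * u b) = pf_rhs K \<alpha> \<kappa> \<beta> j a x u" if "a \<in> pf_index K" for j a x u
    unfolding A_def by (rule coord_linearD[OF coord_linear_pf_rhs[OF that]])
  obtain r where r: "r > 0" "ball x0 r \<subseteq> regular_points"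
    "\<And>u0. \<exists>U. \<forall>a\<in>pf_index K. U a x0 = u0 a \<and>
       (\<forall>z\<in>ball x0 r. hol_at (U a) z \<and> (\<forall>j. pdiff j (U a) z = (\<Sum>b\<in>pf_index K. A j a b z * U b z)))"
  proof (rule frobenius[where A=A and I="pf_index K" and S=regular_points and ?x0.0=x0, OF open_regular_points assms finite_pf_index])
    show "hol_at (A j a b) z" if "a \<in> pf_index K" "z \<in> regular_points" for j z and a b :: "('n \<times> nat) option"
      \<comment> \<open>A matrix entry is the right-hand side evaluated on a constant unit vector,
        and constant functions are holomorphic.\<close>
      unfolding A_def[abs_def] by (rule hol_pf_rhs[where u="\<lambda>c _. if c = b then 1 else 0", OF that(2) _ that(1)]) simp
  next
    fix u :: "('n \<times> nat) option \<Rightarrow> complex^'n \<Rightarrow> complex" and z j k and a :: "('n \<times> nat) option"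
    assume z: "z \<in> regular_points" and a: "a \<in> pf_index K" and hu: "\<And>b y. hol_at (u b) y"
      and du: "\<And>b k. b \<in> pf_index K \<Longrightarrow> pdiff k (u b) z = (\<Sum>c\<in>pf_index K. A k b c z * u c z)"
    show "pdiff k (\<lambda>y. \<Sum>b\<in>pf_index K. A j a b y * u b y) z = pdiff j (\<lambda>y. \<Sum>b\<in>pf_index K. A k a b y * u b y) z"
      unfolding A[OF a] by (rule pf_integrable[OF z hu _ a]) (use du A in simp)
  qed blast
  define U where "U b = (SOME U. \<forall>a\<in>pf_index K. U a x0 = (if a = b then 1 else 0) \<and>
       (\<forall>z\<in>ball x0 r. hol_at (U a) z \<and> (\<forall>j. pdiff j (U a) z = (\<Sum>b\<in>pf_index K. A j a b z * U b z))))" for b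
  have U: "\<forall>a\<in>pf_index K. U b a x0 = (if a = b then 1 else 0) \<and>
       (\<forall>z\<in>ball x0 r. hol_at (U b a) z \<and> (\<forall>j. pdiff j (U b a) z = (\<Sum>c\<in>pf_index K. A j a c z * U b c z)))" for b
    unfolding U_def by (rule someI_ex[OF r(3)])
  show ?thesis
  proof (rule that[OF r(1,2)])
    show "U b a x0 = (if a = b then 1 else 0)" if "a \<in> pf_index K" for a b using U that by blast
    show "pf_solution K \<alpha> \<kappa> \<beta> (ball x0 r) (U b)" for b
      using U[of b] A unfolding pf_solution_def by auto
  qed
qed

text \<open>The affine family is the slice of a linear span on which the coefficient at
  \<open>None\<close> equals 1.\<close>

lemma affine_comb_eq_sum:
  "affine_comb L (g None) (\<lambda>i n. g (Some (i, n))) c x =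
     (\<Sum>b\<in>pf_index (L-1). (case b of None \<Rightarrow> 1 | Some (i, n) \<Rightarrow> c i n) * g b x)"
proof -
  have "(\<Sum>b\<in>Some ` (UNIV \<times> {1..L-1}). (case b of None \<Rightarrow> 1 | Some (i, n) \<Rightarrow> c i n) * g b x)
      = (\<Sum>i\<in>UNIV. \<Sum>n=1..L-1. c i n * g (Some (i, n)) x)"
    by (simp add: sum.reindex sum.cartesian_product case_prod_unfold)
  thus ?thesis unfolding affine_comb_def pf_index_def by (subst sum.insert) auto
qed

theorem theorem1p1:
  fixes L :: nat
    and e \<kappa> \<alpha> \<gamma> :: "nat \<Rightarrow> complex"
    and \<theta> :: "'n::finite option \<Rightarrow> complex"
    and \<beta> :: "'n \<Rightarrow> complex"
  assumes "L \<ge> 2"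
    and "(\<Sum>n<L. e n) = (of_nat L - 1) / 2"
    and "(\<Sum>n<L. \<kappa> n) = (\<Sum>i\<in>UNIV. \<theta> i)"
    and "\<And>n. n \<in> {1..L-1} \<Longrightarrow> \<alpha> n = e n - e 0"
    and "\<And>n. n \<in> {1..L-1} \<Longrightarrow> \<gamma> n = e n - e 0 - \<kappa> n"
    and "\<And>i. \<beta> i = - \<theta> (Some i)"
    and "\<kappa> 0 - (\<Sum>i\<in>UNIV. \<theta> (Some i)) = 0"
  shows
    \<comment> \<open>Near every regular point there is a family of solutions, parametrised by the \<open>N(L-1)\<close>
        arbitrary initial values \<open>c\<close> of the momenta and expressed by solutions \<open>y\<close> of (HG)
        that depend affinely on \<open>c\<close>.\<close>
    "(\<forall>x0\<in>regular_points. \<exists>\<Omega>. open \<Omega> \<and> connected \<Omega> \<and> x0 \<in> \<Omega> \<and> \<Omega> \<subseteq> regular_points \<and>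
       (\<exists>y0 yb T0 Tb. \<forall>c :: 'n \<Rightarrow> nat \<Rightarrow> complex.
          (let y = affine_comb L y0 yb c;
               T = (\<lambda>i n. affine_comb L (T0 i n) (Tb i n) c)
           in hg_solution L \<alpha> \<beta> \<gamma> \<Omega> y \<and> hg_chain L \<alpha> \<beta> \<gamma> \<Omega> y T \<and> y x0 \<noteq> 0 \<and>
              hamiltonian_solution L e \<kappa> \<theta> {x\<in>\<Omega>. y x \<noteq> 0} (\<lambda>_ _ _. 0) (hg_momentum y T) \<and>
              (\<forall>i. \<forall>n\<in>{1..L-1}. hg_momentum y T i n x0 = c i n))))
     \<and>
     (\<comment> \<open>An arbitrary solution of (HG) occurs, and the chain is an explicit differential
          expression in it, unless the parameters are degenerate.\<close>
      (\<forall>m\<in>{1..L-1}. \<forall>k\<in>{1..<m}. \<alpha> m \<noteq> \<gamma> k) \<and>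
      (CARD('n) \<ge> 2 \<longrightarrow> (\<forall>m\<in>{1..L-1}. \<forall>k\<in>{1..L-1}. \<alpha> m \<noteq> \<gamma> k - 1)) \<longrightarrow>
      (\<exists>P Q :: nat \<Rightarrow> complex poly. \<forall>\<Omega> y.
         open \<Omega> \<and> \<Omega> \<subseteq> regular_points \<and> hg_solution L \<alpha> \<beta> \<gamma> \<Omega> y \<longrightarrow>
         (let T = (\<lambda>i n x. teuler_poly (P n) (\<lambda>z. \<beta> i * y z + euler i y z) x
                           + teuler_poly (Q n) (pdiff i y) x)
          in hg_chain L \<alpha> \<beta> \<gamma> \<Omega> y T \<and>
             hamiltonian_solution L e \<kappa> \<theta> {x\<in>\<Omega>. y x \<noteq> 0} (\<lambda>_ _ _. 0) (hg_momentum y T))))"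
proof (intro conjI ballI impI)
  have \<kappa>0: "\<kappa> 0 = (\<Sum>i\<in>UNIV. \<theta> (Some i))" using assms(7) by simp
  fix x0 :: "complex^'n" assume x0: "x0 \<in> regular_points"
  define K where "K = L - 1"
  have L: "L = Suc K" using assms(1) by (simp add: K_def)
  have \<gamma>: "\<forall>n\<in>{1..K}. \<gamma> n = \<alpha> n - \<kappa> n" using assms(4,5) by (simp add: K_def)
  obtain r U where r: "r > 0" "ball x0 r \<subseteq> regular_points"
    and U0: "\<And>a b. a \<in> pf_index K \<Longrightarrow> U b a x0 = (if a = b then 1 else 0)"
    and U: "\<And>b. pf_solution K \<alpha> \<kappa> \<beta> (ball x0 r) (U b)"
    by (rule pf_fundamental_solutions[OF x0, where K=K and \<alpha>=\<alpha> and \<kappa>=\<kappa> and \<beta>=\<beta>]) blast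
  have main: "let y = affine_comb L (U None None) (\<lambda>i n. U (Some (i, n)) None) c;
               T = (\<lambda>i n. affine_comb L (\<lambda>x. pf_chain K \<beta> i n x (\<lambda>a. U None a x)) (\<lambda>k m x. pf_chain K \<beta> i n x (\<lambda>a. U (Some (k, m)) a x)) c)
           in hg_solution L \<alpha> \<beta> \<gamma> (ball x0 r) y \<and> hg_chain L \<alpha> \<beta> \<gamma> (ball x0 r) y T \<and> y x0 \<noteq> 0 \<and>
              hamiltonian_solution L e \<kappa> \<theta> {x\<in>ball x0 r. y x \<noteq> 0} (\<lambda>_ _ _. 0) (hg_momentum y T) \<and>
              (\<forall>i. \<forall>n\<in>{1..L-1}. hg_momentum y T i n x0 = c i n)" for c :: "'n \<Rightarrow> nat \<Rightarrow> complex"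
  proof -
    \<comment> \<open>The initial vector of the combined solution: y = 1 and \<pi>^i_n = c i n at
      \<open>x0\<close>, so the momenta there are exactly \<open>c\<close>.\<close>
    define w where "w b = (case b of None \<Rightarrow> 1 | Some (i, n) \<Rightarrow> c i n)" for b
    define V where "V a x = (\<Sum>b\<in>pf_index K. w b * U b a x)" for a x
    have V: "pf_solution K \<alpha> \<kappa> \<beta> (ball x0 r) V"
      unfolding V_def[abs_def] by (rule pf_solution_sum[OF U])
    have V0: "V a x0 = w a" if "a \<in> pf_index K" for a
      unfolding V_def using U0[OF that] that
      by (simp add: finite_pf_index if_distrib[of "\<lambda>x. _ * x"] cong: if_cong)
    define T where "T i n z = pf_chain K \<beta> i n z (\<lambda>c. V c z)" for i n z
    note sol = pf_solution_chain[OF open_ball r(2) V L \<gamma>, folded T_def]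
    have hy: "holomorphic_sev (ball x0 r) (V None)" using V by (auto simp: pf_solution_def holomorphic_sev_iff)
    have y: "affine_comb L (U None None) (\<lambda>i n. U (Some (i, n)) None) c = V None"
      using affine_comb_eq_sum[of L "\<lambda>b. U b None" c] by (auto simp: V_def w_def K_def)
    have T: "(\<lambda>i n. affine_comb L (\<lambda>x. pf_chain K \<beta> i n x (\<lambda>a. U None a x)) (\<lambda>k m x. pf_chain K \<beta> i n x (\<lambda>a. U (Some (k, m)) a x)) c) = T"
    proof (intro ext)
      fix i n x
      show "affine_comb L (\<lambda>x. pf_chain K \<beta> i n x (\<lambda>a. U None a x)) (\<lambda>k m x. pf_chain K \<beta> i n x (\<lambda>a. U (Some (k, m)) a x)) c x = T i n x"
        using affine_comb_eq_sum[of L "\<lambda>b x. pf_chain K \<beta> i n x (\<lambda>a. U b a x)" c x]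
          coord_linear_sum_apply[OF coord_linear_pf_chain[of K \<beta> i n x], of w "\<lambda>b a. U b a x" "pf_index K"]
        by (simp add: T_def V_def w_def K_def)
    qed
    have "hg_momentum (V None) T i n x0 = c i n" if "n \<in> {1..L-1}" for i n
    proof -
      have n: "n \<in> {1..K}" using that by (simp add: K_def)
      thus ?thesis unfolding hg_momentum_def sol(1)[OF n] using V0[of None] V0[of "Some (i, n)"] by (simp add: w_def)
    qed
    moreover have "V None x0 \<noteq> 0" using V0[of None] by (simp add: w_def)
    moreover have "hg_solution L \<alpha> \<beta> \<gamma> (ball x0 r) (V None)"
      by (rule hg_chain_imp_hg_solution[OF open_ball r(2) assms(1) hy sol(2)])
    moreover have "hamiltonian_solution L e \<kappa> \<theta> {x\<in>ball x0 r. V None x \<noteq> 0} (\<lambda>_ _ _. 0) (hg_momentum (V None) T)"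
      by (rule hg_chain_imp_hamiltonian_solution[OF open_ball r(2) assms(1) hy sol(2) _ \<kappa>0 assms(4,5,6)])
         (use sol(3) in \<open>auto simp: K_def\<close>)
    ultimately show ?thesis unfolding y T Let_def using sol(2) by blast
  qed
  show "\<exists>\<Omega>. open \<Omega> \<and> connected \<Omega> \<and> x0 \<in> \<Omega> \<and> \<Omega> \<subseteq> regular_points \<and>
       (\<exists>y0 yb T0 Tb. \<forall>c :: 'n \<Rightarrow> nat \<Rightarrow> complex.
          (let y = affine_comb L y0 yb c;
               T = (\<lambda>i n. affine_comb L (T0 i n) (Tb i n) c)
           in hg_solution L \<alpha> \<beta> \<gamma> \<Omega> y \<and> hg_chain L \<alpha> \<beta> \<gamma> \<Omega> y T \<and> y x0 \<noteq> 0 \<and>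
              hamiltonian_solution L e \<kappa> \<theta> {x\<in>\<Omega>. y x \<noteq> 0} (\<lambda>_ _ _. 0) (hg_momentum y T) \<and>
              (\<forall>i. \<forall>n\<in>{1..L-1}. hg_momentum y T i n x0 = c i n)))"
    by (rule exI[of _ "ball x0 r"], intro conjI, rule open_ball, rule connected_ball, (use r in simp), rule r(2),
        rule exI[of _ "U None None"], rule exI[of _ "\<lambda>i n. U (Some (i, n)) None"],
        rule exI[of _ "\<lambda>i n x. pf_chain K \<beta> i n x (\<lambda>a. U None a x)"],
        rule exI[of _ "\<lambda>i n k m x. pf_chain K \<beta> i n x (\<lambda>a. U (Some (k, m)) a x)"], rule allI, rule main)
next
  have \<kappa>0: "\<kappa> 0 = (\<Sum>i\<in>UNIV. \<theta> (Some i))" using assms(7) by simp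
  assume "(\<forall>m\<in>{1..L-1}. \<forall>k\<in>{1..<m}. \<alpha> m \<noteq> \<gamma> k) \<and>
      (CARD('n) \<ge> 2 \<longrightarrow> (\<forall>m\<in>{1..L-1}. \<forall>k\<in>{1..L-1}. \<alpha> m \<noteq> \<gamma> k - 1))"
  hence ne1: "\<And>m k. m \<in> {1..L-1} \<Longrightarrow> k \<in> {1..<m} \<Longrightarrow> \<alpha> m \<noteq> \<gamma> k"
    and ne2: "CARD('n) \<ge> 2 \<Longrightarrow> \<forall>m\<in>{1..L-1}. \<forall>k\<in>{1..L-1}. \<alpha> m \<noteq> \<gamma> k - 1" by blast+
  \<comment> \<open>The polynomials are fixed through \<open>R\<close> before any domain or solution
    is introduced, as the order of quantifiers in the claim demands.\<close>
  define R where "R P Q \<longleftrightarrow> (\<forall>(S :: (complex^'n) set) u v. open S \<longrightarrow> holomorphic_sev S u \<longrightarrow> holomorphic_sev S v \<longrightarrow>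
       (\<forall>z\<in>S. teuler_prod \<alpha> (L-1) u z = teuler_prod \<gamma> (L-1) v z) \<longrightarrow>
       (let T = (\<lambda>n z. teuler_poly (P n) u z + teuler_poly (Q n) v z) in
        \<forall>z\<in>S. T 0 z = u z \<and> T (L-1) z = v z \<and>
          (\<forall>n\<in>{1..L-1}. \<gamma> n * T n z + teuler (T n) z = \<alpha> n * T (n-1) z + teuler (T (n-1)) z)))" for P Q
  have "\<exists>P Q. R P Q"
    unfolding R_def by (rule teuler_chain_polynomials) (rule ne1)
  then obtain P Q where "R P Q" by blast
  note PQ = this[unfolded R_def]
  show "\<exists>P Q :: nat \<Rightarrow> complex poly. \<forall>\<Omega> y.
         open \<Omega> \<and> \<Omega> \<subseteq> regular_points \<and> hg_solution L \<alpha> \<beta> \<gamma> \<Omega> y \<longrightarrow>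
         (let T = (\<lambda>i n x. teuler_poly (P n) (\<lambda>z. \<beta> i * y z + euler i y z) x
                           + teuler_poly (Q n) (pdiff i y) x)
          in hg_chain L \<alpha> \<beta> \<gamma> \<Omega> y T \<and>
             hamiltonian_solution L e \<kappa> \<theta> {x\<in>\<Omega>. y x \<noteq> 0} (\<lambda>_ _ _. 0) (hg_momentum y T))"
  proof (rule exI[of _ P], rule exI[of _ Q], intro allI impI, elim conjE)
    fix \<Omega> :: "(complex^'n) set" and y
    assume \<Omega>: "open \<Omega>" "\<Omega> \<subseteq> regular_points" and hg: "hg_solution L \<alpha> \<beta> \<gamma> \<Omega> y"
    define u where "u i z = \<beta> i * y z + euler i y z" for i z
    define T where "T i n z = teuler_poly (P n) (u i) z + teuler_poly (Q n) (pdiff i y) z" for i n z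
    have hy: "holomorphic_sev \<Omega> y" and rel: "\<And>z i. z \<in> \<Omega> \<Longrightarrow> teuler_prod \<alpha> (L-1) (u i) z = teuler_prod \<gamma> (L-1) (pdiff i y) z"
      using hg unfolding hg_solution_iff[OF \<Omega>] u_def[abs_def] by auto
    have hu: "holomorphic_sev \<Omega> (u i)" for i
      unfolding u_def[abs_def] by (rule holomorphic_sev_lincomb[OF \<Omega>(1) hy holomorphic_sev_euler[OF \<Omega>(1) hy]])
    note hv = holomorphic_sev_pdiff[OF \<Omega>(1) hy]
    have hT: "holomorphic_sev \<Omega> (T i n)" for i n
      using holomorphic_sev_lincomb[OF \<Omega>(1) holomorphic_sev_teuler_poly[OF \<Omega>(1) hu] holomorphic_sev_teuler_poly[OF \<Omega>(1) hv], of 1]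
      by (simp add: T_def[abs_def])
    have chain: "hg_chain L \<alpha> \<beta> \<gamma> \<Omega> y T"
      unfolding hg_chain_def using hT PQ[rule_format, OF \<Omega>(1) hu hv rel] by (simp add: Let_def T_def[abs_def] u_def)
    \<comment> \<open>Transversality is passed on from the gradient of y to (\<beta>_i + \<delta>_i)
      y, then to polynomials in D applied to both, and finally to the differences of the
      chain.\<close>
    have tv: "transversal \<Omega> \<beta> (\<lambda>i. pdiff i y)" by (rule hg_solution_transversal[OF \<Omega> hg ne2])
    have tu: "transversal \<Omega> \<beta> u"
      using transversal_euler[OF \<Omega>(1) hy tv] by (simp add: u_def[abs_def])
    have tT: "transversal \<Omega> \<beta> (\<lambda>i. T i n)" for n
      using transversal_lincomb[OF \<Omega>(1) transversal_teuler_poly[OF \<Omega>(1) tu hu] transversal_teuler_poly[OF \<Omega>(1) tv hv]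
          holomorphic_sev_teuler_poly[OF \<Omega>(1) hu] holomorphic_sev_teuler_poly[OF \<Omega>(1) hv], of 1]
      by (simp add: T_def[abs_def])
    have "transversal \<Omega> \<beta> (\<lambda>i z. T i (n-1) z - T i n z)" for n
      using transversal_lincomb[OF \<Omega>(1) tT tT hT hT, of "-1" n "n-1"] by simp
    from hg_chain_imp_hamiltonian_solution[OF \<Omega> assms(1) hy chain this \<kappa>0 assms(4,5,6)]
    have "hamiltonian_solution L e \<kappa> \<theta> {x\<in>\<Omega>. y x \<noteq> 0} (\<lambda>_ _ _. 0) (hg_momentum y T)" .
    with chain show "let T = (\<lambda>i n x. teuler_poly (P n) (\<lambda>z. \<beta> i * y z + euler i y z) x + teuler_poly (Q n) (pdiff i y) x)
          in hg_chain L \<alpha> \<beta> \<gamma> \<Omega> y T \<and> hamiltonian_solution L e \<kappa> \<theta> {x\<in>\<Omega>. y x \<noteq> 0} (\<lambda>_ _ _. 0) (hg_momentum y T)"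
      by (simp add: Let_def T_def[abs_def] u_def[abs_def])
  qed
qed

end
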